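(* Let $(U(t,s))_{t\ge s}$ be an evolution family on a real separable Hilbert space $\mathbb{H}$, and let $(\mu_{t,s})_{t\ge s}$ be infinitely divisible probability measures on $\mathbb{H}$, $\mu_{t,s}=[a_{t,s},R_{t,s},m_{t,s}]$, with $\mu_{t,s}=\mu_{t,r}*(\mu_{r,s}\circ U(t,r)^{-1})$ for all $t\ge r\ge s$. Let $p_{s,t}f(x)=\int_{\mathbb{H}}f(U(t,s)x+y)\,\mu_{t,s}(dy)$. Suppose that for every $t\in\mathbb{R}$: (H1) $\sup_{s\le t}\operatorname{tr}R_{t,s}<\infty$; (H2) $\sup_{s\le t}\int_{\mathbb{H}}(1\wedge|x|^2)\,m_{t,s}(dx)<\infty$; (H3) the limit $a_{t,-\infty}:=\lim_{s\to-\infty}a_{t,s}$ exists in $\mathbb{H}$. Then for every $t\in\mathbb{R}$, $m_{t,-\infty}$ is a Lévy measure, $R_{t,-\infty}$ is a non-negative definite self-adjoint trace class operator with $\operatorname{tr}R_{t,-\infty}=\sup_{s\le t}\operatorname{tr}R_{t,s}<\infty$, and the system $(\nu_t)_{t\in\mathbb{R}}$ given by $\nu_t=[a_{t,-\infty},R_{t,-\infty},m_{t,-\infty}]$ is an evolution system of measures for $(p_{s,t})_{t\ge s}$.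
   Context: Evolution family: bounded linear operators $U(t,s)$, $t\ge s$, on $\mathbb{H}$ with $U(s,s)=I$, $U(t,r)U(r,s)=U(t,s)$ for $t\ge r\ge s$, and $(t,s)\mapsto U(t,s)x$ continuous for each $x$. $\mu=[a,R,m]$ means that $\mu$ is infinitely divisible with $\hat\mu(\xi)=\int e^{i\langle x,\xi\rangle}\mu(dx)=e^{-\psi(\xi)}$, $\psi(\xi)=-i\langle a,\xi\rangle+\frac12\langle R\xi,\xi\rangle-\int_{\mathbb{H}}\bigl(e^{i\langle\xi,x\rangle}-1-\frac{i\langle\xi,x\rangle}{1+|x|^2}\bigr)m(dx)$, where $a\in\mathbb{H}$, $R$ is a non-negative symmetric trace class operator and $m$ is a Lévy measure (a $\sigma$-finite measure on $\mathbb{H}\setminus\{0\}$ with $\int(1\wedge|x|^2)\,dm<\infty$). For fixed $t$, $m_{t,s}(A)$ and $\langle R_{t,s}x,x\rangle$ are non-increasing in $s\le t$. Define $m_{t,-\infty}(\{0\})=0$, $m_{t,-\infty}(A)=\lim_{s\to-\infty}m_{t,s}(A)$ for Borel $A\subset\mathbb{H}\setminus\{0\}$, and (under (H1)) $R_{t,-\infty}$ by $\langle R_{t,-\infty}x,y\rangle=\lim_{s\to-\infty}\langle R_{t,s}x,y\rangle$, $x,y\in\mathbb{H}$. An evolution system of measures for $(p_{s,t})_{t\ge s}$ is a family of Borel probability measures $(\nu_t)_{t\in\mathbb{R}}$ on $\mathbb{H}$ with $\int_{\mathbb{H}}p_{s,t}f\,d\nu_s=\int_{\mathbb{H}}f\,d\nu_t$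 for all $s\le t$ and all bounded Borel $f$. *)

theory Defs
  imports "HOL-Probability.Probability"
begin

text \<open>
  A real separable Hilbert space is a type of sort \<open>{real_inner, polish_space}\<close>
  (complete and second countable); no restriction on the dimension is made.
\<close>

definition symmetric_op :: "('a::real_inner \<Rightarrow>\<^sub>L 'a) \<Rightarrow> bool" where
  "symmetric_op R \<longleftrightarrow> (\<forall>x y. R x \<bullet> y = x \<bullet> R y)"

definition nonneg_op :: "('a::real_inner \<Rightarrow>\<^sub>L 'a) \<Rightarrow> bool" where
  "nonneg_op R \<longleftrightarrow> (\<forall>x. 0 \<le> R x \<bullet> x)"

definition orthonormal_basis :: "'a::real_inner set \<Rightarrow> bool" where
  "orthonormal_basis B \<longleftrightarrow>
     (\<forall>e\<in>B. norm e = 1) \<and> pairwise orthogonal B \<and> closure (span B) = UNIV"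

text \<open>
  The trace of a non-negative symmetric operator, with value in \<open>[0, \<infinity>]\<close>.  The sum does not
  depend on the orthonormal basis.  For operators that are not non-negative this is not the trace,
  because \<open>ennreal\<close> truncates negative numbers to \<open>0\<close>.
\<close>

definition tr :: "('a::real_inner \<Rightarrow>\<^sub>L 'a) \<Rightarrow> ennreal" where
  "tr R = (\<Sum>\<^sub>\<infinity>e\<in>(SOME B. orthonormal_basis B). ennreal (R e \<bullet> e))"

text \<open>
  A non-negative symmetric \<open>R\<close> coincides with its modulus \<open>|R|\<close>, so it is of trace class exactly
  if \<open>tr R\<close> is finite.
\<close>

definition nonneg_symmetric_trace_class :: "('a::real_inner \<Rightarrow>\<^sub>L 'a) \<Rightarrow> bool" where
  "nonneg_symmetric_trace_class R \<longleftrightarrow> symmetric_op R \<and> nonneg_op R \<and> tr R < \<infinity>"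

text \<open>
  The convolution of \<open>HOL-Probability\<close> is restricted to ordered Euclidean spaces.
\<close>

definition hconv :: "'a::{real_inner, polish_space} measure \<Rightarrow> 'a measure \<Rightarrow> 'a measure" where
  "hconv M N = distr (M \<Otimes>\<^sub>M N) borel (\<lambda>(x, y). x + y)"

definition borel_prob :: "'a::topological_space measure \<Rightarrow> bool" where
  "borel_prob M \<longleftrightarrow> prob_space M \<and> sets M = sets borel"

definition infinitely_divisible :: "'a::{real_inner, polish_space} measure \<Rightarrow> bool" where
  "infinitely_divisible M \<longleftrightarrow> borel_prob M \<and>
     (\<forall>n\<ge>1. \<exists>N. borel_prob N \<and> M = (hconv N ^^ n) (return borel 0))"

definition char_fun :: "'a::{real_inner, polish_space} measure \<Rightarrow> 'a \<Rightarrow> complex" where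
  "char_fun M \<xi> = (CLINT x|M. iexp (x \<bullet> \<xi>))"

text \<open>A measure on the complement of \<open>0\<close> is regarded as a Borel measure giving no mass to \<open>0\<close>.\<close>

definition levy_measure :: "'a::{real_inner, polish_space} measure \<Rightarrow> bool" where
  "levy_measure m \<longleftrightarrow> sets m = sets borel \<and> sigma_finite_measure m \<and> emeasure m {0} = 0 \<and>
     (\<integral>\<^sup>+x. ennreal (min 1 ((norm x)\<^sup>2)) \<partial>m) < \<infinity>"

definition levy_exponent ::
    "'a::{real_inner, polish_space} \<Rightarrow> ('a \<Rightarrow>\<^sub>L 'a) \<Rightarrow> 'a measure \<Rightarrow> 'a \<Rightarrow> complex" where
  "levy_exponent a R m \<xi> =
     - \<i> * of_real (a \<bullet> \<xi>) + of_real ((R \<xi> \<bullet> \<xi>) / 2)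
     - (CLINT x|m. iexp (\<xi> \<bullet> x) - 1 - \<i> * of_real (\<xi> \<bullet> x) / of_real (1 + (norm x)\<^sup>2))"

definition has_triplet ::
    "'a::{real_inner, polish_space} measure \<Rightarrow> 'a \<Rightarrow> ('a \<Rightarrow>\<^sub>L 'a) \<Rightarrow> 'a measure \<Rightarrow> bool" where
  "has_triplet M a R m \<longleftrightarrow>
     infinitely_divisible M \<and> nonneg_symmetric_trace_class R \<and> levy_measure m \<and>
     (\<forall>\<xi>. char_fun M \<xi> = exp (- levy_exponent a R m \<xi>))"

text \<open>
  Families indexed by \<open>t \<ge> s\<close> are total functions of \<open>t\<close> and \<open>s\<close>, with unconstrained values
  for \<open>t < s\<close>.
\<close>

definition evolution_family :: "(real \<Rightarrow> real \<Rightarrow> 'a::real_normed_vector \<Rightarrow>\<^sub>L 'a) \<Rightarrow> bool" where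
  "evolution_family U \<longleftrightarrow>
     (\<forall>s. U s s = id_blinfun) \<and>
     (\<forall>t r s. s \<le> r \<and> r \<le> t \<longrightarrow> U t r o\<^sub>L U r s = U t s) \<and>
     (\<forall>x. continuous_on {(t, s). s \<le> t} (\<lambda>(t, s). U t s x))"

definition transition ::
    "(real \<Rightarrow> real \<Rightarrow> 'a::{real_inner, polish_space} \<Rightarrow>\<^sub>L 'a) \<Rightarrow> (real \<Rightarrow> real \<Rightarrow> 'a measure) \<Rightarrow>
      real \<Rightarrow> real \<Rightarrow> ('a \<Rightarrow> real) \<Rightarrow> 'a \<Rightarrow> real" where
  "transition U \<mu> s t f x = (LINT y|\<mu> t s. f (U t s x + y))"

definition evolution_system_of_measures ::
    "(real \<Rightarrow> real \<Rightarrow> ('a::topological_space \<Rightarrow> real) \<Rightarrow> 'a \<Rightarrow> real) \<Rightarrow> (real \<Rightarrow> 'a measure) \<Rightarrow> bool"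
  where
  "evolution_system_of_measures p \<nu> \<longleftrightarrow>
     (\<forall>t. borel_prob (\<nu> t)) \<and>
     (\<forall>s t. s \<le> t \<longrightarrow> (\<forall>f\<in>borel_measurable borel. bounded (range f) \<longrightarrow>
        (LINT x|\<nu> s. p s t f x) = (LINT x|\<nu> t. f x)))"

text \<open>
  The following two definitions are meaningful only if the limits exist and, for the first one,
  form a countably additive set function; otherwise they have a default value (for the first one
  the zero measure).
\<close>

definition levy_limit ::
    "(real \<Rightarrow> real \<Rightarrow> 'a::{real_inner, polish_space} measure) \<Rightarrow> real \<Rightarrow> 'a measure" where
  "levy_limit m t =
     measure_of UNIV (sets borel) (\<lambda>A. Lim at_bot (\<lambda>s. emeasure (m t s) (A - {0})))"

definition op_limit ::
    "(real \<Rightarrow> real \<Rightarrow> 'a::real_inner \<Rightarrow>\<^sub>L 'a) \<Rightarrow> real \<Rightarrow> 'a \<Rightarrow>\<^sub>L 'a" where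
  "op_limit R t = (THE Q :: 'a \<Rightarrow>\<^sub>L 'a. \<forall>x y. ((\<lambda>s. R t s x \<bullet> y) \<longlongrightarrow> Q x \<bullet> y) at_bot)"

end

theory Submission
  imports Defs
begin

text \<open>
  Write \<open>\<psi> t s\<close> for the exponent of \<open>\<mu> t s\<close> and \<open>V t r\<close> for the adjoint of \<open>U t r\<close>.  Taking
  characteristic functions in the convolution identity gives \<open>exp (- \<psi> t s) = exp (- \<psi> t r - \<psi> r s \<circ> V t r)\<close>,
  and since exponents are continuous along rays and vanish at \<open>0\<close>, the cocycle identity
  \<open>\<psi> t s = \<psi> t r + \<psi> r s \<circ> V t r\<close> holds exactly (\<open>levy_exponent_cocycle\<close>).

  Second differences of an exponent in a direction \<open>\<eta>\<close> remove the drift and leave, as a function of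
  \<open>\<xi>\<close>, the constant \<open>R \<eta> \<bullet> \<eta> / 2\<close> plus the characteristic function of the finite measure
  \<open>(1 - cos (\<eta> \<bullet> x)) m(dx)\<close>.  Because finite Borel measures are determined by their characteristic
  functions (\<open>char_fun_uniqueness\<close>), the cocycle identity therefore splits into its Gaussian part and
  its jump part, and both \<open>R t s\<close> and \<open>m t s\<close> grow as \<open>s\<close> decreases
  (\<open>levy_exponent_additive_imp_mono\<close>).  Monotonicity and the uniform bounds make all limits of
  the triplets exist, and the exponents \<open>\<psi> t s\<close> converge pointwise to the exponent \<open>\<Psi> t\<close> of the
  limit triplet.

  The remaining point is that \<open>exp (- \<Psi> t)\<close> is the characteristic function of a measure on an
  infinite-dimensional space, where pointwise convergence of characteristic functions does not
  suffice.  The limit is built as the law of a random series.  For \<open>s \<le> r\<close> the measure \<open>\<mu> t s\<close> is the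
  convolution of \<open>\<mu> t r\<close> with a measure \<open>\<rho>\<close> whose exponent has the triplet of the increments.
  Integrating \<open>1 - char_fun \<rho>\<close> against a standard Gaussian vector in \<open>n\<close> orthonormal directions gives the
  dimension-free estimate \<open>levy_weight_integral_bound\<close>: \<open>\<integral> min 1 |x|\<^sup>2 \<rho>(dx)\<close> is bounded by a
  multiple of the sum of the norm of the drift, the trace of the covariance and the mass
  \<open>\<integral> min 1 |x|\<^sup>2 m(dx)\<close> of the jump measure of \<open>\<rho>\<close>.
  Along a sequence of times that goes to \<open>-\<infinity>\<close> fast enough, independent variables with these laws form an almost surely absolutely convergent series
  (\<open>infinite_convolution\<close>), whose sum has characteristic function \<open>exp (- \<Psi> t)\<close>.  The same construction,
  started from the convolution roots of all the measures involved, produces the roots of the limit;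
  so the limit is infinitely divisible.

  Letting \<open>r \<rightarrow> -\<infinity>\<close> in \<open>\<psi> t r = \<psi> t s + \<psi> s r \<circ> V t s\<close> gives \<open>\<Psi> t = \<psi> t s + \<Psi> s \<circ> V t s\<close>.  By
  uniqueness of characteristic functions, \<open>\<nu> t\<close> is then the convolution of \<open>\<mu> t s\<close> with the image of \<open>\<nu> s\<close>
  under \<open>U t s\<close>, which is the evolution property by Fubini's theorem.
\<close>

section \<open>Adjoints and orthonormal bases\<close>

text \<open>
  The representing vector minimises \<open>|x|\<^sup>2 - 2 \<phi> x\<close>: by the parallelogram law a minimising sequence
  is Cauchy, and the first variation at the minimum vanishes.
\<close>
lemma riesz_representation:
  fixes \<phi> :: "'a::{real_inner, complete_space} \<Rightarrow> real"
  assumes "bounded_linear \<phi>"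
  shows "\<exists>z. \<forall>y. \<phi> y = z \<bullet> y"
proof -
  interpret bounded_linear \<phi> by fact
  define J where "J x = (norm x)\<^sup>2 - 2 * \<phi> x" for x
  obtain K where K: "\<And>x. \<bar>\<phi> x\<bar> \<le> norm x * K" using bounded by auto
  have lower: "- K\<^sup>2 \<le> J x" for x
  proof -
    have "0 \<le> (norm x - K)\<^sup>2" by simp
    then show ?thesis using K[of x] by (simp add: J_def power2_eq_square algebra_simps)
  qed
  define c where "c = Inf (range J)"
  have bdd: "bdd_below (range J)" using lower by (auto intro!: bdd_belowI)
  have c_le: "c \<le> J x" for x unfolding c_def by (intro cInf_lower bdd) simp
  have par: "(norm (x - y))\<^sup>2 = 2 * J x + 2 * J y - 4 * J ((1/2) *\<^sub>R (x + y))" for x y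
    by (simp add: J_def add scaleR power2_norm_eq_inner inner_diff inner_add inner_commute algebra_simps)
  have "\<exists>x. J x < c + inverse (Suc n)" for n
  proof -
    have "Inf (range J) < c + inverse (Suc n)" by (simp add: c_def)
    then show ?thesis using cInf_less_iff[OF _ bdd] by auto
  qed
  then obtain X where X: "\<And>n. J (X n) < c + inverse (Suc n)" by metis
  have dist2: "(norm (X n - X m))\<^sup>2 \<le> 4 * inverse (Suc N)" if "n \<ge> N" "m \<ge> N" for n m N
  proof -
    have "inverse (real (Suc n)) \<le> inverse (Suc N)" "inverse (real (Suc m)) \<le> inverse (Suc N)"
      using that by (auto intro!: le_imp_inverse_le)
    then show ?thesis using X[of n] X[of m] c_le[of "(1/2) *\<^sub>R (X n + X m)"]
      unfolding par by (smt (verit))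
  qed
  have "Cauchy X"
  proof (rule CauchyI)
    fix e :: real assume "0 < e"
    then have "0 < e\<^sup>2 / 4" by simp
    then obtain N where N: "inverse (real (Suc N)) < e\<^sup>2 / 4" using reals_Archimedean by blast
    show "\<exists>M. \<forall>m\<ge>M. \<forall>n\<ge>M. norm (X m - X n) < e"
    proof (intro exI allI impI)
      fix m n assume "N \<le> m" "N \<le> n"
      then have "(norm (X m - X n))\<^sup>2 < e\<^sup>2" using dist2[of N m n] N by auto
      then show "norm (X m - X n) < e" using \<open>0 < e\<close> by (simp add: power2_less_imp_less)
    qed
  qed
  then obtain z where z: "X \<longlonglongrightarrow> z" using Cauchy_convergent convergent_def by blast
  have "(\<lambda>n. J (X n)) \<longlonglongrightarrow> J z"
    unfolding J_def by (intro tendsto_intros z tendsto)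
  moreover have "(\<lambda>n. c + inverse (real (Suc n))) \<longlonglongrightarrow> c + 0"
    by (intro tendsto_intros LIMSEQ_inverse_real_of_nat)
  ultimately have "J z \<le> c + 0"
    using X by (intro LIMSEQ_le[of "\<lambda>n. J (X n)"]) (auto intro: less_imp_le)
  then have min: "J z \<le> J x" for x using c_le[of x] by simp
  have "\<phi> y = z \<bullet> y" for y
  proof (cases "y = 0")
    case True then show ?thesis by (simp add: zero)
  next
    case False
    define d where "d = \<phi> y - z \<bullet> y"
    \<comment> \<open>The point at which the parabola \<open>t \<mapsto> J (z + t y)\<close> is minimal.\<close>
    define t where "t = d / (norm y)\<^sup>2"
    have "J (z + t *\<^sub>R y) = J z - 2 * t * d + t\<^sup>2 * (norm y)\<^sup>2"
      unfolding J_def d_def power2_norm_eq_inner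
      by (simp add: add scaleR inner_add inner_commute algebra_simps power2_eq_square)
    then have "0 \<le> - 2 * t * d + t\<^sup>2 * (norm y)\<^sup>2" using min[of "z + t *\<^sub>R y"] by simp
    also have "\<dots> = - d\<^sup>2 / (norm y)\<^sup>2"
      using False by (simp add: t_def power2_eq_square field_simps)
    finally have "d\<^sup>2 \<le> 0" using False by (simp add: divide_simps)
    then show ?thesis by (simp add: d_def)
  qed
  then show ?thesis by blast
qed

lemma adjoint_exists:
  fixes U :: "'a::{real_inner, complete_space} \<Rightarrow>\<^sub>L 'a"
  shows "\<exists>V. (\<forall>x \<xi>. U x \<bullet> \<xi> = x \<bullet> V \<xi>) \<and> linear V"
proof -
  have "\<exists>z. \<forall>x. U x \<bullet> \<xi> = z \<bullet> x" for \<xi>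
    by (rule riesz_representation)
      (rule bounded_linear_compose[OF bounded_linear_inner_left blinfun.bounded_linear_right])
  then obtain V where V: "\<And>\<xi> x. U x \<bullet> \<xi> = V \<xi> \<bullet> x" by metis
  have V': "U x \<bullet> \<xi> = x \<bullet> V \<xi>" for x \<xi> using V by (simp add: inner_commute)
  have "linear V"
  proof (rule linearI)
    fix a b show "V (a + b) = V a + V b"
      by (rule vector_eq_rdot[THEN iffD1]) (auto simp: V[symmetric] inner_add)
  next
    fix c :: real and b show "V (c *\<^sub>R b) = c *\<^sub>R V b"
      by (rule vector_eq_rdot[THEN iffD1]) (auto simp: V[symmetric] )
  qed
  then show ?thesis using V' by blast
qed

definition orthonormal :: "'a::real_inner set \<Rightarrow> bool" where
  "orthonormal F \<longleftrightarrow> (\<forall>e\<in>F. norm e = 1) \<and> pairwise orthogonal F"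

lemma orthonormal_subset: "orthonormal B \<Longrightarrow> F \<subseteq> B \<Longrightarrow> orthonormal F"
  by (auto simp: orthonormal_def pairwise_def)

lemma orthonormal_inner:
  "orthonormal F \<Longrightarrow> e \<in> F \<Longrightarrow> f \<in> F \<Longrightarrow> e \<bullet> f = (if e = f then 1 else 0)"
  by (auto simp: orthonormal_def pairwise_def orthogonal_def norm_eq_1)

definition proj_on :: "'a::real_inner set \<Rightarrow> 'a \<Rightarrow> 'a" where
  "proj_on F x = (\<Sum>e\<in>F. (x \<bullet> e) *\<^sub>R e)"

lemma inner_sum_orthonormal:
  assumes "orthonormal F" "finite F" "f \<in> F"
  shows "(\<Sum>e\<in>F. c e *\<^sub>R e) \<bullet> f = c f"
proof -
  have "(\<Sum>e\<in>F. c e *\<^sub>R e) \<bullet> f = (\<Sum>e\<in>F. if e = f then c e else 0)"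
    unfolding inner_sum_left by (intro sum.cong refl) (use assms in \<open>simp add: orthonormal_inner\<close>)
  then show ?thesis using assms by simp
qed

lemma norm_proj_on:
  assumes "orthonormal F" "finite F"
  shows "(norm (proj_on F x))\<^sup>2 = (\<Sum>e\<in>F. (x \<bullet> e)\<^sup>2)"
proof -
  have "(norm (proj_on F x))\<^sup>2 = (\<Sum>f\<in>F. (x \<bullet> f) * (proj_on F x \<bullet> f))"
    unfolding power2_norm_eq_inner by (subst (2) proj_on_def) (simp add: inner_sum_right)
  also have "\<dots> = (\<Sum>e\<in>F. (x \<bullet> e)\<^sup>2)"
    using assms by (intro sum.cong) (auto simp: proj_on_def inner_sum_orthonormal power2_eq_square)
  finally show ?thesis .
qed

lemma proj_on_orthogonal:
  assumes "orthonormal F" "finite F" "y \<in> span F"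
  shows "(x - proj_on F x) \<bullet> y = 0"
  using assms(3)
proof (induction rule: span_induct_alt)
  case base then show ?case by simp
next
  case (step c f y)
  then show ?case using inner_sum_orthonormal[OF assms(1,2), of f "\<lambda>e. x \<bullet> e"]
    by (simp add: inner_add inner_diff proj_on_def)
qed

lemma proj_on_in_span: "proj_on F x \<in> span F"
  unfolding proj_on_def by (intro span_sum span_scale span_base)

text \<open>
  Hence \<open>proj_on F x\<close> is the best approximation of \<open>x\<close> in the span, and Bessel's
  inequality is the case \<open>y = 0\<close>.
\<close>
lemma pythagoras_proj_on:
  assumes "orthonormal F" "finite F" "y \<in> span F"
  shows "(norm (x - y))\<^sup>2 = (norm (x - proj_on F x))\<^sup>2 + (norm (proj_on F x - y))\<^sup>2"
proof -
  have "(x - proj_on F x) \<bullet> (proj_on F x - y) = 0"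
    by (intro proj_on_orthogonal assms span_diff proj_on_in_span)
  then have "(norm ((x - proj_on F x) + (proj_on F x - y)))\<^sup>2
      = (norm (x - proj_on F x))\<^sup>2 + (norm (proj_on F x - y))\<^sup>2"
    unfolding power2_norm_eq_inner inner_add by (simp add: inner_commute)
  then show ?thesis by simp
qed

lemma norm_diff_proj_on:
  assumes "orthonormal F" "finite F"
  shows "(norm (x - proj_on F x))\<^sup>2 = (norm x)\<^sup>2 - (\<Sum>e\<in>F. (x \<bullet> e)\<^sup>2)"
  using pythagoras_proj_on[OF assms span_zero, of x] by (simp add: norm_proj_on[OF assms])

lemma bessel_ineq:
  assumes "orthonormal F" "finite F"
  shows "(\<Sum>e\<in>F. (x \<bullet> e)\<^sup>2) \<le> (norm x)\<^sup>2"
  using norm_diff_proj_on[OF assms, of x] by (smt (verit) zero_le_power2)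

lemma gram_schmidt_step:
  assumes "orthonormal F" "finite F"
  shows "\<exists>G. F \<subseteq> G \<and> finite G \<and> orthonormal G \<and> (x::'a::real_inner) \<in> span G"
proof (cases "x = proj_on F x")
  case True
  then show ?thesis using assms proj_on_in_span[of F x] by (intro exI[of _ F]) auto
next
  case False
  define e where "e = sgn (x - proj_on F x)"
  have e: "norm e = 1" using False by (simp add: e_def norm_sgn)
  have orth: "e \<bullet> f = 0" if "f \<in> F" for f
    using proj_on_orthogonal[OF assms span_base[OF that], of x] by (simp add: e_def sgn_div_norm)
  have x: "x = proj_on F x + norm (x - proj_on F x) *\<^sub>R e"
    using False by (simp add: e_def sgn_div_norm)
  have "proj_on F x \<in> span (insert e F)" using proj_on_in_span span_mono[of F "insert e F"] by auto
  then have "x \<in> span (insert e F)"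
    using span_add[OF _ span_scale[OF span_base[OF insertI1]]] x by metis
  moreover have "orthonormal (insert e F)"
    using assms e orth unfolding orthonormal_def pairwise_insert
    by (auto simp: orthogonal_def inner_commute)
  ultimately show ?thesis using assms by (intro exI[of _ "insert e F"]) auto
qed

text \<open>
  Existence matters because the trace is defined with a chosen basis, about which nothing would be
  known otherwise.  The basis comes from Gram--Schmidt applied to a countable dense sequence.
\<close>
lemma orthonormal_basis_exists: "\<exists>B::'a::{real_inner, polish_space} set. orthonormal_basis B"
proof -
  obtain D :: "'a set" where D: "countable D" "closure D = UNIV" "D \<noteq> {}"
  proof -
    obtain D :: "'a set" where "countable D" "\<And>X. open X \<Longrightarrow> X \<noteq> {} \<Longrightarrow> \<exists>d\<in>D. d \<in> X"
      using countable_dense_exists by blast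
    then show ?thesis
      
    proof (intro that[of D])
      assume cD: "countable D" and D: "\<And>X. open X \<Longrightarrow> X \<noteq> {} \<Longrightarrow> \<exists>d\<in>D. d \<in> X"
      show "countable D" by fact
      have "x \<in> closure D" for x
        unfolding closure_approachable using D[of "ball x _"] by (auto simp: dist_commute)
      then show "closure D = UNIV" by auto
      show "D \<noteq> {}" using D[of UNIV] by auto
    qed
  qed
  define d where "d = from_nat_into D"
  have "\<exists>G. \<forall>n. (orthonormal (G n) \<and> finite (G n)) \<and>
      (G n \<subseteq> G (Suc n) \<and> d n \<in> span (G (Suc n)))"
  proof (rule dependent_nat_choice[where P="\<lambda>_ G. orthonormal G \<and> finite G"
        and Q="\<lambda>n G G'. G \<subseteq> G' \<and> d n \<in> span G'"])
    show "\<exists>G::'a set. orthonormal G \<and> finite G" by (rule exI[of _ "{}"]) (simp add: orthonormal_def)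
  next
    fix G :: "'a set" and n assume "orthonormal G \<and> finite G"
    then show "\<exists>G'. (orthonormal G' \<and> finite G') \<and> G \<subseteq> G' \<and> d n \<in> span G'"
      using gram_schmidt_step[of G "d n"] by blast
  qed
  then obtain G where G: "\<And>n. orthonormal (G n)" "\<And>n. G n \<subseteq> G (Suc n)" "\<And>n. d n \<in> span (G (Suc n))"
    by blast
  have inc: "G m \<subseteq> G n" if "m \<le> n" for m n using G(2) that by (rule lift_Suc_mono_le)
  have "pairwise orthogonal (\<Union>n. G n)"
  proof (rule pairwiseI)
    fix x y assume "x \<in> (\<Union>n. G n)" "y \<in> (\<Union>n. G n)" "x \<noteq> y"
    then obtain m n where "x \<in> G m" "y \<in> G n" by auto
    then have "x \<in> G (max m n)" "y \<in> G (max m n)" using inc[of m "max m n"] inc[of n "max m n"] by auto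
    then show "orthogonal x y" using G(1)[of "max m n"] \<open>x \<noteq> y\<close> by (auto simp: orthonormal_def pairwise_def)
  qed
  moreover have "D \<subseteq> span (\<Union>n. G n)"
  proof
    fix x assume "x \<in> D"
    then obtain n where "x = d n" using D(1) by (metis d_def from_nat_into_surj)
    then show "x \<in> span (\<Union>n. G n)" using G(3)[of n] span_mono[of "G (Suc n)" "\<Union>n. G n"] by auto
  qed
  then have "closure (span (\<Union>n. G n)) = UNIV" using D(2) closure_mono by blast
  ultimately show ?thesis using G(1) unfolding orthonormal_basis_def orthonormal_def by blast
qed

text \<open>Distinct unit vectors of the set have distance \<open>sqrt 2\<close>, so the balls of radius \<open>1/2\<close> are disjoint.\<close>
lemma countable_orthonormal:
  fixes B :: "'a::{real_inner, second_countable_topology} set"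
  assumes "orthonormal B"
  shows "countable B"
proof -
  have far: "dist e f > 1" if "e \<in> B" "f \<in> B" "e \<noteq> f" for e f
  proof -
    have "(dist e f)\<^sup>2 = 2"
      using orthonormal_inner[OF assms that(1,2)] that orthonormal_inner[OF assms that(1,1)]
        orthonormal_inner[OF assms that(2,2)]
      by (simp add: dist_norm power2_norm_eq_inner inner_diff inner_commute)
    then show ?thesis by (smt (verit) one_power2 power_mono zero_le_dist)
  qed
  have inj: "inj_on (\<lambda>e. ball e (1/2)) B"
  proof (rule inj_onI, rule ccontr)
    fix e f assume *: "e \<in> B" "f \<in> B" "ball e (1/2) = ball f (1/2)" "e \<noteq> f"
    then have "e \<in> ball f (1/2)" using centre_in_ball[of e "1/2"] by auto
    then show False using far[of f e] * by auto
  qed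
  have "countable ((\<lambda>e. ball e (1/2)) ` B)"
  proof (rule countable_disjoint_open_subsets)
    show "pairwise disjnt ((\<lambda>e. ball e (1/2)) ` B)"
    proof (clarsimp simp: pairwise_image pairwise_def disjnt_def)
      fix e f assume *: "e \<in> B" "f \<in> B" "ball e (1/2) \<noteq> ball f (1/2)"
      show "ball e (1/2) \<inter> ball f (1/2) = {}"
      proof (rule ccontr)
        assume "ball e (1/2) \<inter> ball f (1/2) \<noteq> {}"
        then obtain x where "dist e x < 1/2" "dist f x < 1/2" by auto
        then have "dist e f < 1" by (smt (verit) dist_commute dist_triangle field_sum_of_halves)
        then show False using far[of e f] * by auto
      qed
    qed
  qed auto
  then show ?thesis using inj countable_image_inj_on by blast
qed

text \<open>
  A sequence of finite sets is needed, and not only the net of all finite subsets, because the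
  projections will be passed through a monotone convergence theorem.
\<close>
lemma orthonormal_basis_exhaustion:
  fixes B :: "'a::{real_inner, second_countable_topology} set"
  assumes "orthonormal_basis B"
  shows "\<exists>F. (\<forall>n::nat. finite (F n) \<and> F n \<subseteq> B \<and> orthonormal (F n)) \<and> incseq F \<and>
    (\<forall>x. (\<lambda>n. proj_on (F n) x) \<longlonglongrightarrow> x)"
proof -
  have on: "orthonormal B" using assms by (auto simp: orthonormal_def orthonormal_basis_def)
  define F where "F n = from_nat_into B ` {..n} \<inter> B" for n
  have inc: "F m \<subseteq> F n" if "m \<le> n" for m n using that by (auto simp: F_def)
  have F: "finite (F n)" "F n \<subseteq> B" "orthonormal (F n)" for n
    using orthonormal_subset[OF on] by (auto simp: F_def)
  have lim: "(\<lambda>n. proj_on (F n) x) \<longlonglongrightarrow> x" for x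
  proof (rule LIMSEQ_I)
    fix r :: real assume "0 < r"
    have "x \<in> closure (span B)" using assms by (simp add: orthonormal_basis_def)
    then obtain y where y: "y \<in> span B" "dist y x < r" using \<open>0 < r\<close> by (auto simp: closure_approachable)
    then obtain T where T: "finite T" "T \<subseteq> B" "y \<in> span T"
      using span_explicit by (smt (verit, best) mem_Collect_eq span_sum span_scale span_base)
    have "\<exists>N. T \<subseteq> F N" using T(1,2)
    proof (induction T)
      case (insert e T)
      then obtain N where "T \<subseteq> F N" by auto
      obtain k where "e = from_nat_into B k"
        using countable_orthonormal[OF on] insert.prems by (metis from_nat_into_surj insert_subset)
      then have "insert e T \<subseteq> F (max k N)" using inc[of N "max k N"] \<open>T \<subseteq> F N\<close> insert.prems
        by (auto simp: F_def)
      then show ?case by blast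
    qed auto
    then obtain N where N: "T \<subseteq> F N" by auto
    show "\<exists>no. \<forall>n\<ge>no. norm (proj_on (F n) x - x) < r"
    proof (intro exI allI impI)
      fix n assume "N \<le> n"
      then have "T \<subseteq> F n" using N inc[of N n] by auto
      then have "y \<in> span (F n)" using T(3) span_mono[of T "F n"] by blast
      from pythagoras_proj_on[OF F(3,1) this, of x]
      have "(norm (x - proj_on (F n) x))\<^sup>2 \<le> (norm (x - y))\<^sup>2" by simp
      then have "norm (x - proj_on (F n) x) \<le> norm (x - y)" by (rule power2_le_imp_le) simp
      then show "norm (proj_on (F n) x - x) < r" using y by (simp add: dist_norm norm_minus_commute)
    qed
  qed
  have "incseq F" using inc by (rule incseq_def[THEN iffD2, rule_format])
  then show ?thesis using F lim by blast
qed

text \<open>The discriminant argument for the quadratic polynomial \<open>t \<mapsto> R (x + t y) \<bullet> (x + t y)\<close>.\<close>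
lemma nonneg_op_Cauchy_Schwarz:
  assumes R: "symmetric_op R" "nonneg_op R"
  shows "(R x \<bullet> y)\<^sup>2 \<le> (R x \<bullet> x) * (R y \<bullet> y)"
proof -
  have sym: "R y \<bullet> x = R x \<bullet> y" using R(1) by (simp add: symmetric_op_def inner_commute)
  have *: "0 \<le> R x \<bullet> x + 2 * t * (R x \<bullet> y) + t\<^sup>2 * (R y \<bullet> y)" for t
  proof -
    have "0 \<le> R (x + t *\<^sub>R y) \<bullet> (x + t *\<^sub>R y)" using R(2) by (simp add: nonneg_op_def)
    also have "\<dots> = R x \<bullet> x + 2 * t * (R x \<bullet> y) + t\<^sup>2 * (R y \<bullet> y)"
      by (simp add: blinfun.add_right blinfun.scaleR_right inner_add sym power2_eq_square algebra_simps)
    finally show ?thesis .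
  qed
  have nn: "0 \<le> R y \<bullet> y" "0 \<le> R x \<bullet> x" using R(2) by (auto simp: nonneg_op_def)
  show ?thesis
  proof (cases "R y \<bullet> y = 0")
    case True
    have "R x \<bullet> y = 0"
    proof (rule ccontr)
      assume "R x \<bullet> y \<noteq> 0"
      \<comment> \<open>A value of \<open>t\<close> at which the affine function \<open>R x \<bullet> x + 2 t (R x \<bullet> y)\<close> equals \<open>- 1\<close>.\<close>
      then show False using *[of "- (R x \<bullet> x + 1) / (2 * (R x \<bullet> y))"] True nn
        by (simp add: field_simps)
    qed
    then show ?thesis using nn by simp
  next
    case False
    then have "0 < R y \<bullet> y" using nn by simp
    then show ?thesis using *[of "- (R x \<bullet> y) / (R y \<bullet> y)"]
      by (simp add: power2_eq_square field_simps)
  qed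
qed

lemma nonneg_op_proj_on_bound:
  assumes R: "symmetric_op R" "nonneg_op R" and F: "orthonormal F" "finite F"
  shows "R (proj_on F x) \<bullet> proj_on F x \<le> (norm x)\<^sup>2 * (\<Sum>e\<in>F. R e \<bullet> e)"
proof -
  have nn: "0 \<le> R y \<bullet> y" for y using R(2) by (auto simp: nonneg_op_def)
  have entry: "\<bar>R e \<bullet> f\<bar> \<le> sqrt (R e \<bullet> e) * sqrt (R f \<bullet> f)" for e f
    using nonneg_op_Cauchy_Schwarz[OF R, of e f] by (simp add: real_le_rsqrt real_sqrt_mult[symmetric])
  have "R (proj_on F x) \<bullet> proj_on F x = (\<Sum>e\<in>F. \<Sum>f\<in>F. (x \<bullet> e) * (x \<bullet> f) * (R e \<bullet> f))"
    unfolding proj_on_def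
    apply (simp add: blinfun.sum_right blinfun.scaleR_right inner_sum_left inner_sum_right sum_distrib_left mult.assoc)
    apply (subst sum.swap)
    apply (intro sum.cong refl)
    apply (simp add: ac_simps)
    done
  also have "\<dots> \<le> (\<Sum>e\<in>F. \<Sum>f\<in>F. (\<bar>x \<bullet> e\<bar> * sqrt (R e \<bullet> e)) * (\<bar>x \<bullet> f\<bar> * sqrt (R f \<bullet> f)))"
  proof (intro sum_mono)
    fix e f
    have "(x \<bullet> e) * (x \<bullet> f) * (R e \<bullet> f) \<le> \<bar>(x \<bullet> e) * (x \<bullet> f)\<bar> * \<bar>R e \<bullet> f\<bar>"
      by (metis abs_ge_self abs_mult)
    also have "\<dots> \<le> \<bar>(x \<bullet> e) * (x \<bullet> f)\<bar> * (sqrt (R e \<bullet> e) * sqrt (R f \<bullet> f))"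
      by (intro mult_left_mono entry) auto
    finally show "(x \<bullet> e) * (x \<bullet> f) * (R e \<bullet> f)
        \<le> (\<bar>x \<bullet> e\<bar> * sqrt (R e \<bullet> e)) * (\<bar>x \<bullet> f\<bar> * sqrt (R f \<bullet> f))"
      by (simp add: abs_mult ac_simps)
  qed
  also have "\<dots> = (\<Sum>e\<in>F. \<bar>x \<bullet> e\<bar> * sqrt (R e \<bullet> e))\<^sup>2"
    by (simp add: power2_eq_square sum_product)
  also have "\<dots> \<le> (\<Sum>e\<in>F. \<bar>x \<bullet> e\<bar>\<^sup>2) * (\<Sum>e\<in>F. (sqrt (R e \<bullet> e))\<^sup>2)"
    by (rule Cauchy_Schwarz_ineq_sum)
  also have "\<dots> = (\<Sum>e\<in>F. (x \<bullet> e)\<^sup>2) * (\<Sum>e\<in>F. R e \<bullet> e)"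
    using nn by simp
  also have "\<dots> \<le> (norm x)\<^sup>2 * (\<Sum>e\<in>F. R e \<bullet> e)"
    by (intro mult_right_mono bessel_ineq F sum_nonneg nn)
  finally show ?thesis .
qed

abbreviation onb :: "'a::real_inner set" where
  "onb \<equiv> SOME B. orthonormal_basis B"

lemma orthonormal_basis_onb: "orthonormal_basis (onb :: 'a::{real_inner, polish_space} set)"
  using orthonormal_basis_exists by (rule someI_ex)

lemma tr_eq_SUP:
  fixes R :: "'a::real_inner \<Rightarrow>\<^sub>L 'a"
  shows "tr R = (SUP F\<in>{F. finite F \<and> F \<subseteq> onb}. \<Sum>e\<in>F. ennreal (R e \<bullet> e))"
  unfolding tr_def by (rule nonneg_infsum_complete) (rule zero_le)

lemma sum_le_tr:
  fixes R :: "'a::real_inner \<Rightarrow>\<^sub>L 'a"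
  assumes "finite F" "F \<subseteq> onb"
  shows "(\<Sum>e\<in>F. ennreal (R e \<bullet> e)) \<le> tr R"
  unfolding tr_eq_SUP by (rule SUP_upper) (use assms in blast)

text \<open>
  The operator norm is at most the trace.  This turns the bound on the traces into a uniform bound
  on the operators, which makes their weak limit bounded.
\<close>
lemma quadratic_form_le_tr:
  fixes R :: "'a::{real_inner, polish_space} \<Rightarrow>\<^sub>L 'a"
  assumes R: "nonneg_symmetric_trace_class R"
  shows "R x \<bullet> x \<le> enn2real (tr R) * (norm x)\<^sup>2"
proof -
  obtain F :: "nat \<Rightarrow> 'a set" where F: "\<And>n. finite (F n)" "\<And>n. F n \<subseteq> onb" "\<And>n. orthonormal (F n)"
    "incseq F" "\<And>x. (\<lambda>n. proj_on (F n) x) \<longlonglongrightarrow> x"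
    using orthonormal_basis_exhaustion[OF orthonormal_basis_onb] by metis
  have R': "symmetric_op R" "nonneg_op R" "tr R < \<infinity>" using R by (auto simp: nonneg_symmetric_trace_class_def)
  have "R (proj_on (F n) x) \<bullet> proj_on (F n) x \<le> enn2real (tr R) * (norm x)\<^sup>2" for n
  proof -
    have "ennreal (\<Sum>e\<in>F n. R e \<bullet> e) = (\<Sum>e\<in>F n. ennreal (R e \<bullet> e))"
      using R'(2) by (simp add: nonneg_op_def sum_ennreal)
    also have "\<dots> \<le> tr R" by (intro sum_le_tr F)
    finally have "(\<Sum>e\<in>F n. R e \<bullet> e) \<le> enn2real (tr R)"
      using R'(2,3) enn2real_mono[of "ennreal (\<Sum>e\<in>F n. R e \<bullet> e)" "tr R"]
      by (simp add: nonneg_op_def sum_nonneg)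
    then show ?thesis
      using nonneg_op_proj_on_bound[OF R'(1,2) F(3) F(1), of n x]
        mult_left_mono[of _ _ "(norm x)\<^sup>2"] by (fastforce simp: mult.commute intro: order_trans)
  qed
  moreover have "(\<lambda>n. R (proj_on (F n) x) \<bullet> proj_on (F n) x) \<longlonglongrightarrow> R x \<bullet> x"
    by (intro tendsto_intros F(5))
  ultimately show ?thesis by (intro LIMSEQ_le_const2) auto
qed

section \<open>Characteristic functions determine finite Borel measures\<close>

text \<open>
  A closed ball is the intersection of the slabs \<open>(x - y) \<bullet> \<eta> \<le> r |\<eta>|\<close> over a countable dense set
  of \<open>\<eta>\<close>, and an open set is a countable union of closed balls.
\<close>
lemma half_spaces_generate_borel:
  "sets (borel :: 'a::{real_inner, second_countable_topology} measure)
     = sigma_sets UNIV {{x. x \<bullet> \<eta> \<in> A} | \<eta> A. A \<in> sets (borel :: real measure)}"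
    (is "_ = sigma_sets UNIV ?G")
proof
  have G: "{x. x \<bullet> \<eta> \<in> A} \<in> sets borel" if [measurable]: "A \<in> sets borel" for \<eta> :: 'a and A :: "real set"
    by measurable
  have "?G \<subseteq> sets borel" using G by blast
  then have "sigma_sets (space borel) ?G \<subseteq> sets borel" by (rule sets.sigma_sets_subset)
  then show "sigma_sets UNIV ?G \<subseteq> sets borel" unfolding space_borel .
  obtain D :: "'a set" where D: "countable D" "\<And>X. open X \<Longrightarrow> X \<noteq> {} \<Longrightarrow> \<exists>d\<in>D. d \<in> X"
    using countable_dense_exists by blast
  have norm_le: "norm z \<le> r \<longleftrightarrow> (\<forall>\<eta>\<in>D. z \<bullet> \<eta> \<le> r * norm \<eta>)" if "0 \<le> r" for z :: 'a and r
  proof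
    assume "norm z \<le> r"
    then show "\<forall>\<eta>\<in>D. z \<bullet> \<eta> \<le> r * norm \<eta>"
      by (metis mult_right_mono norm_cauchy_schwarz norm_ge_zero order_trans)
  next
    assume *: "\<forall>\<eta>\<in>D. z \<bullet> \<eta> \<le> r * norm \<eta>"
    have "z \<bullet> z \<le> r * norm z"
    proof (rule ccontr)
      assume "\<not> z \<bullet> z \<le> r * norm z"
      then have "{\<eta>. r * norm \<eta> < z \<bullet> \<eta>} \<noteq> {}" by (auto intro: exI[of _ z])
      moreover have "open {\<eta>. r * norm \<eta> < z \<bullet> \<eta>}" by (intro open_Collect_less continuous_intros)
      ultimately show False using D(2) * by fastforce
    qed
    then have "norm z * norm z \<le> r * norm z" by (simp add: power2_norm_eq_inner[symmetric] power2_eq_square)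
    then show "norm z \<le> r" using that by (cases "z = 0") auto
  qed
  interpret sigma_algebra UNIV "sigma_sets UNIV ?G" by (rule sigma_algebra_sigma_sets) simp
  have ball: "cball y r \<in> sigma_sets UNIV ?G" if "0 \<le> r" for y r
  proof -
    have "cball y r = UNIV \<inter> (\<Inter>\<eta>\<in>D. {x. x \<bullet> \<eta> \<in> {y \<bullet> \<eta> - r * norm \<eta>..}})"
      using that by (auto simp: dist_norm norm_le inner_diff_left algebra_simps)
    also have "\<dots> \<in> sigma_sets UNIV ?G"
    proof (cases "D = {}")
      case False
      then show ?thesis
      proof (intro Int top countable_INT'' D(1))
        fix \<eta> assume "\<eta> \<in> D"
        show "{x. x \<bullet> \<eta> \<in> {y \<bullet> \<eta> - r * norm \<eta>..}} \<in> sigma_sets UNIV ?G"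
          by (rule sigma_sets.Basic, rule CollectI, intro exI conjI, rule refl) simp
      qed
    qed simp
    finally show ?thesis .
  qed
  have "S \<in> sigma_sets UNIV ?G" if "open S" for S :: "'a set"
  proof -
    let ?I = "{(d, q). d \<in> D \<and> q \<in> \<rat> \<and> 0 \<le> q \<and> cball d q \<subseteq> S}"
    have "countable ?I"
      by (rule countable_subset[of _ "D \<times> \<rat>"]) (auto intro!: countable_SIGMA D(1) countable_rat)
    have "S = (\<Union>(d, q)\<in>?I. cball d q)"
    proof (rule set_eqI, rule iffI)
      fix x assume "x \<in> S"
      then obtain e where e: "0 < e" "ball x e \<subseteq> S" using \<open>open S\<close> open_contains_ball by blast
      obtain d where d: "d \<in> D" "d \<in> ball x (e/3)" using D(2)[of "ball x (e/3)"] e by auto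
      obtain q where q: "q \<in> \<rat>" "e/3 < q" "q < e/2" using Rats_dense_in_real[of "e/3" "e/2"] e by auto
      have "cball d q \<subseteq> ball x e"
      proof
        fix z assume "z \<in> cball d q"
        then have "dist x z \<le> dist x d + q" using dist_triangle[of x z d] by simp
        then show "z \<in> ball x e" using d q e by simp
      qed
      then have "cball d q \<subseteq> S" "0 \<le> q" using e q by auto
      moreover have "x \<in> cball d q" using d(2) q(2) by (simp add: dist_commute)
      ultimately show "x \<in> (\<Union>(d, q)\<in>?I. cball d q)"
        using d(1) q(1) by (auto intro!: bexI[of _ "(d, q)"])
    qed auto
    also have "\<dots> \<in> sigma_sets UNIV ?G"
      using \<open>countable ?I\<close> by (intro countable_UN') (auto simp: ball)
    finally show ?thesis .
  qed
  then show "sets borel \<subseteq> sigma_sets UNIV ?G"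
  proof -
    assume "\<And>S :: 'a set. open S \<Longrightarrow> S \<in> sigma_sets UNIV ?G"
    then have "{S. open S} \<subseteq> sigma_sets UNIV ?G" by blast
    then have "sigma_sets UNIV {S. open S} \<subseteq> sigma_sets UNIV ?G" by (rule sigma_sets_mono)
    moreover have "sets borel = sigma_sets UNIV {S :: 'a set. open S}" by (simp add: borel_def)
    ultimately show ?thesis by blast
  qed
qed

text \<open>
  The one-dimensional uniqueness theorem, applied to the normalised images of \<open>g M\<close> and \<open>g N\<close>
  under \<open>X\<close>.  The weight carries the information about all the other directions.
\<close>
lemma weighted_uniqueness_real:
  fixes M N :: "'a measure" and X g :: "'a \<Rightarrow> real"
  assumes fin: "finite_measure M" "finite_measure N" and sets: "sets M = sets N"
    and X[measurable]: "X \<in> borel_measurable M" and g[measurable]: "g \<in> borel_measurable M"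
    and g_bd: "\<And>x. 0 \<le> g x" "\<And>x. g x \<le> C"
    and eq: "\<And>u. (CLINT x|M. g x *\<^sub>R iexp (u * X x)) = (CLINT x|N. g x *\<^sub>R iexp (u * X x))"
    and A: "A \<in> sets borel"
  shows "(LINT x|M. g x * indicator A (X x)) = (LINT x|N. g x * indicator A (X x))"
proof -
  interpret M: finite_measure M by fact
  interpret N: finite_measure N by fact
  have XN[measurable]: "X \<in> borel_measurable N" "g \<in> borel_measurable N"
    using X g unfolding measurable_cong_sets[OF sets refl] .
  have int: "integrable M g" "integrable N g"
    using g_bd by (auto intro!: M.integrable_const_bound[of _ C] N.integrable_const_bound[of _ C])
  have intA: "integrable M (\<lambda>x. g x * indicator A (X x))" "integrable N (\<lambda>x. g x * indicator A (X x))"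
    using A g_bd order_trans[OF g_bd]
    by (auto intro!: M.integrable_const_bound[of _ C] N.integrable_const_bound[of _ C] AE_I2
        split: split_indicator)
  define c where "c = (LINT x|M. g x)"
  have cN: "c = (LINT x|N. g x)"
    using eq[of 0] int unfolding c_def by (simp add: scaleR_conv_of_real flip: of_real_mult)
  show ?thesis
  proof (cases "c = 0")
    case True
    have zero: "(LINT x|K. g x * indicator A (X x)) = 0"
      if "(LINT x|K. g x) = 0" "integrable K g" "integrable K (\<lambda>x. g x * indicator A (X x))" for K
    proof (rule antisym)
      show "(LINT x|K. g x * indicator A (X x)) \<le> 0"
        using integral_mono[OF that(3,2)] g_bd that(1) by (auto split: split_indicator)
    qed (auto intro!: integral_nonneg_AE simp: g_bd)
    show ?thesis using zero[of M] zero[of N] True cN c_def int intA by simp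
  next
    case False
    have "0 \<le> c" unfolding c_def by (intro integral_nonneg_AE) (simp add: g_bd)
    then have c: "0 < c" using False by simp
    define P where "P K = distr (density K (\<lambda>x. ennreal (g x / c))) borel X" for K :: "'a measure"
    have P: "real_distribution (P K) \<and> char (P K) u = (CLINT x|K. g x *\<^sub>R iexp (u * X x)) / c \<and>
        measure (P K) A = (LINT x|K. g x * indicator A (X x)) / c"
      if K: "c = (LINT x|K. g x)" "integrable K g" and [measurable]: "X \<in> borel_measurable K"
         and fin: "finite_measure K" for K u
    proof -
      have [measurable]: "g \<in> borel_measurable K" using K by simp
      have "emeasure (density K (\<lambda>x. ennreal (g x / c))) (space K) = (\<integral>\<^sup>+x. ennreal (g x / c) \<partial>K)"
        by (subst emeasure_density) (auto intro!: nn_integral_cong)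
      also have "\<dots> = ennreal (LINT x|K. g x / c)"
        using K c g_bd by (intro nn_integral_eq_integral) auto
      also have "(LINT x|K. g x / c) = 1" using K c by simp
      finally have "prob_space (density K (\<lambda>x. ennreal (g x / c)))"
        by (intro prob_spaceI) simp
      then have rd: "real_distribution (P K)"
        unfolding P_def by (intro real_distribution.intro prob_space.prob_space_distr)
          (auto simp: real_distribution_axioms_def)
      interpret P: real_distribution "P K" by fact
      have "char (P K) u = (CLINT x|K. (g x / c) *\<^sub>R iexp (u * X x))"
        unfolding char_def P_def using c g_bd
        by (simp add: integral_distr integral_density)
      also have "\<dots> = (CLINT x|K. (g x *\<^sub>R iexp (u * X x)) / c)"
        by (intro Bochner_Integration.integral_cong refl) (simp add: scaleR_conv_of_real)
      also have "\<dots> = (CLINT x|K. g x *\<^sub>R iexp (u * X x)) / c" by simp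
      finally have 1: "char (P K) u = (CLINT x|K. g x *\<^sub>R iexp (u * X x)) / c" .
      have "measure (P K) A = (LINT x|P K. indicator A x)" using A by simp
      also have "\<dots> = (LINT x|density K (\<lambda>x. ennreal (g x / c)). indicator A (X x))"
        unfolding P_def by (rule integral_distr) (use A in auto)
      also have "\<dots> = (LINT x|K. (g x / c) *\<^sub>R indicator A (X x))"
        by (rule integral_density) (use A c g_bd in auto)
      also have "\<dots> = (LINT x|K. (g x * indicator A (X x)) / c)"
        by (intro Bochner_Integration.integral_cong refl) simp
      also have "\<dots> = (LINT x|K. g x * indicator A (X x)) / c" by simp
      finally show ?thesis using 1 rd by simp
    qed
    note PM = P[OF c_def int(1) X fin(1)] and PN = P[OF cN int(2) XN(1) fin(2)]
    have "char (P M) = char (P N)"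
      using PM PN by (intro ext) (simp only: eq)
    then have "P M = P N"
      using PM PN by (intro Levy_uniqueness) auto
    then have "(LINT x|M. g x * indicator A (X x)) / c = (LINT x|N. g x * indicator A (X x)) / c"
      using PM PN by metis
    then show ?thesis using c by simp
  qed
qed

text \<open>
  Demanding agreement of the restricted characteristic functions at all frequencies, and not only
  of the masses of \<open>E\<close>, makes the property stable under intersection with half-spaces.
\<close>
definition char_agree :: "'a::{real_inner, polish_space} measure \<Rightarrow> 'a measure \<Rightarrow> 'a set \<Rightarrow> bool" where
  "char_agree M N E \<longleftrightarrow> E \<in> sets borel \<and>
     (\<forall>\<xi>. (CLINT x:E|M. iexp (x \<bullet> \<xi>)) = (CLINT x:E|N. iexp (x \<bullet> \<xi>)))"

locale finite_borel_pair =
  fixes M N :: "'a::{real_inner, polish_space} measure"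
  assumes finM: "finite_measure M" and finN: "finite_measure N"
    and setsM[measurable_cong]: "sets M = sets borel" and setsN[measurable_cong]: "sets N = sets borel"
begin

interpretation M: finite_measure M by (rule finM)
interpretation N: finite_measure N by (rule finN)

lemma set_integrable_iexp:
  assumes "E \<in> sets borel"
  shows "set_integrable M E (\<lambda>x. iexp (x \<bullet> \<xi>))" "set_integrable N E (\<lambda>x. iexp (x \<bullet> \<xi>))"
  unfolding set_integrable_def
  using assms
  by (intro M.integrable_const_bound[of _ 1] N.integrable_const_bound[of _ 1] AE_I2; simp add: indicator_def)+

text \<open>
  The restriction of \<open>iexp (x \<bullet> \<xi>)\<close> to \<open>E\<close> is complex, but
  \<open>1 + cos (x \<bullet> \<xi>)\<close>, \<open>1 + sin (x \<bullet> \<xi>)\<close> and \<open>1\<close> are non-negative weights on \<open>E\<close> whose Fourier transforms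
  in the direction \<open>\<eta>\<close> are known.  The real uniqueness theorem localises each of them to the
  half-space, and the exponential is a linear combination of the three.
\<close>
lemma char_agree_Int_half_space:
  assumes E: "char_agree M N E" and A[measurable]: "A \<in> sets (borel :: real measure)"
  shows "char_agree M N (E \<inter> {x. x \<bullet> \<eta> \<in> A})"
proof -
  have [measurable]: "E \<in> sets borel" using E by (simp add: char_agree_def)
  have eqE: "(CLINT x:E|M. iexp (x \<bullet> \<xi>)) = (CLINT x:E|N. iexp (x \<bullet> \<xi>))" for \<xi>
    using E by (simp add: char_agree_def)
  have key: "(LINT x|M. (indicator E x * h x) * indicator A (x \<bullet> \<eta>)) =
      (LINT x|N. (indicator E x * h x) * indicator A (x \<bullet> \<eta>))"
    if h: "\<And>x. h x = 1 + Re (w * iexp (x \<bullet> \<xi>))" and w: "norm w \<le> 1" for h :: "'a \<Rightarrow> real" and w \<xi>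
  proof (rule weighted_uniqueness_real[where C=2])
    have hm: "h = (\<lambda>x. 1 + Re (w * iexp (x \<bullet> \<xi>)))" using h by auto
    show "(\<lambda>x. indicator E x * h x) \<in> borel_measurable M" unfolding hm by measurable
    have bd: "\<bar>Re (w * iexp (x \<bullet> \<xi>))\<bar> \<le> 1" for x
      using abs_Re_le_cmod[of "w * iexp (x \<bullet> \<xi>)"] w by (simp add: norm_mult)
    show "0 \<le> indicator E x * h x" "indicator E x * h x \<le> 2" for x
      using bd[of x] h[of x] by (auto split: split_indicator)
    fix u :: real
    \<comment> \<open>\<open>h\<close> is a trigonometric polynomial, so its Fourier transform in the direction \<open>\<eta>\<close> is a combination of
      three values of the characteristic function restricted to \<open>E\<close>.\<close>
    have decomp: "(indicator E x * h x) *\<^sub>R iexp (u * (x \<bullet> \<eta>)) =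
        indicator E x *\<^sub>R iexp (x \<bullet> (u *\<^sub>R \<eta>)) + (w / 2) * (indicator E x *\<^sub>R iexp (x \<bullet> (\<xi> + u *\<^sub>R \<eta>)))
        + (cnj w / 2) * (indicator E x *\<^sub>R iexp (x \<bullet> (- \<xi> + u *\<^sub>R \<eta>)))" for x
    proof -
      have "complex_of_real (h x) = 1 + (w * iexp (x \<bullet> \<xi>) + cnj w * iexp (- (x \<bullet> \<xi>))) / 2"
        unfolding h by (simp add: complex_eq_iff exp_eq_polar cis.ctr)
      moreover have "iexp (x \<bullet> (\<xi> + u *\<^sub>R \<eta>)) = iexp (x \<bullet> \<xi>) * iexp (u * (x \<bullet> \<eta>))"
        "iexp (x \<bullet> (- \<xi> + u *\<^sub>R \<eta>)) = iexp (- (x \<bullet> \<xi>)) * iexp (u * (x \<bullet> \<eta>))"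
        by (simp_all add: inner_add_right exp_add[symmetric] algebra_simps)
      ultimately show ?thesis
        by (cases "x \<in> E") (simp_all add: scaleR_conv_of_real distrib_right add_divide_distrib mult.assoc)
    qed
    have int: "integrable M (\<lambda>x. indicator E x *\<^sub>R iexp (x \<bullet> \<zeta>))" "integrable N (\<lambda>x. indicator E x *\<^sub>R iexp (x \<bullet> \<zeta>))" for \<zeta>
      using set_integrable_iexp[of E \<zeta>] by (auto simp: set_integrable_def)
    show "(CLINT x|M. (indicator E x * h x) *\<^sub>R iexp (u * (x \<bullet> \<eta>))) =
        (CLINT x|N. (indicator E x * h x) *\<^sub>R iexp (u * (x \<bullet> \<eta>)))"
    proof -
      define f where "f \<zeta> x = indicator E x *\<^sub>R iexp (x \<bullet> \<zeta>)" for \<zeta> and x :: 'a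
      have "integrable M (f \<zeta>)" "integrable N (f \<zeta>)" for \<zeta>
        using int[of \<zeta>] by (simp_all add: f_def[abs_def])
      moreover have "integral\<^sup>L M (f \<zeta>) = integral\<^sup>L N (f \<zeta>)" for \<zeta>
        using eqE[of \<zeta>] by (simp add: f_def[abs_def] set_lebesgue_integral_def)
      ultimately show ?thesis
        unfolding decomp f_def[symmetric] by simp
    qed
  qed (use finM finN in \<open>simp_all add: setsM setsN\<close>)
  have split: "(CLINT x:E \<inter> {x. x \<bullet> \<eta> \<in> A}|K. iexp (x \<bullet> \<xi>)) =
      Complex ((LINT x|K. (indicator E x * (1 + Re (1 * iexp (x \<bullet> \<xi>)))) * indicator A (x \<bullet> \<eta>))
               - (LINT x|K. (indicator E x * (1 + Re (0 * iexp (x \<bullet> 0)))) * indicator A (x \<bullet> \<eta>)))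
              ((LINT x|K. (indicator E x * (1 + Re ((-\<i>) * iexp (x \<bullet> \<xi>)))) * indicator A (x \<bullet> \<eta>))
               - (LINT x|K. (indicator E x * (1 + Re (0 * iexp (x \<bullet> 0)))) * indicator A (x \<bullet> \<eta>)))"
    if K: "finite_measure K" and [measurable_cong]: "sets K = sets borel" for K \<xi>
  proof -
    interpret K: finite_measure K by fact
    have int: "integrable K (\<lambda>x. (indicator E x * (1 + Re (w * iexp (x \<bullet> \<zeta>)))) * indicator A (x \<bullet> \<eta>))"
      if "norm w \<le> 1" for w \<zeta>
    proof (rule K.integrable_const_bound[of _ 2])
      have bd: "\<bar>Re (w * iexp (x \<bullet> \<zeta>))\<bar> \<le> 1" for x
        using abs_Re_le_cmod[of "w * iexp (x \<bullet> \<zeta>)"] that by (simp add: norm_mult)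
      show "AE x in K. norm ((indicator E x * (1 + Re (w * iexp (x \<bullet> \<zeta>)))) * indicator A (x \<bullet> \<eta>)) \<le> 2"
      proof (rule AE_I2)
        fix x
        have "\<bar>1 + Re (w * iexp (x \<bullet> \<zeta>))\<bar> \<le> 2" using bd[of x] by linarith
        then show "norm ((indicator E x * (1 + Re (w * iexp (x \<bullet> \<zeta>)))) * indicator A (x \<bullet> \<eta>)) \<le> 2"
          by (auto split: split_indicator simp del: times_complex.simps)
      qed
    qed measurable
    have i2: "integrable K (\<lambda>x. indicator (E \<inter> {x. x \<bullet> \<eta> \<in> A}) x *\<^sub>R iexp (x \<bullet> \<xi>))"
      by (rule K.integrable_const_bound[of _ 1]) (auto simp: indicator_def)
    have re: "(LINT x|K. (indicator E x * (1 + Re (1 * iexp (x \<bullet> \<xi>)))) * indicator A (x \<bullet> \<eta>))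
               - (LINT x|K. (indicator E x * (1 + Re (0 * iexp (x \<bullet> 0)))) * indicator A (x \<bullet> \<eta>))
        = (LINT x|K. Re (indicator (E \<inter> {x. x \<bullet> \<eta> \<in> A}) x *\<^sub>R iexp (x \<bullet> \<xi>)))"
      by (subst Bochner_Integration.integral_diff[OF int[of 1 \<xi>] int[of 0 0], symmetric])
        (auto intro!: Bochner_Integration.integral_cong split: split_indicator simp del: times_complex.simps)
    have im: "(LINT x|K. (indicator E x * (1 + Re ((-\<i>) * iexp (x \<bullet> \<xi>)))) * indicator A (x \<bullet> \<eta>))
               - (LINT x|K. (indicator E x * (1 + Re (0 * iexp (x \<bullet> 0)))) * indicator A (x \<bullet> \<eta>))
        = (LINT x|K. Im (indicator (E \<inter> {x. x \<bullet> \<eta> \<in> A}) x *\<^sub>R iexp (x \<bullet> \<xi>)))"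
      by (subst Bochner_Integration.integral_diff[OF int[of "-\<i>" \<xi>] int[of 0 0], symmetric])
        (auto intro!: Bochner_Integration.integral_cong split: split_indicator simp del: times_complex.simps)
    show ?thesis
      unfolding set_lebesgue_integral_def re im integral_Re[OF i2] integral_Im[OF i2] by simp
  qed
  show ?thesis
    unfolding char_agree_def split[OF finM setsM] split[OF finN setsN]
    using key[OF refl, of 1] key[OF refl, of 0] key[OF refl, of "-\<i>"] by simp
qed

lemma char_agree_Diff:
  assumes E: "char_agree M N E" and F: "char_agree M N F" "F \<subseteq> E"
  shows "char_agree M N (E - F)"
proof -
  have [measurable]: "E \<in> sets borel" "F \<in> sets borel" using E F by (auto simp: char_agree_def)
  have *: "(CLINT x:E|K. iexp (x \<bullet> \<xi>)) = (CLINT x:E - F|K. iexp (x \<bullet> \<xi>)) + (CLINT x:F|K. iexp (x \<bullet> \<xi>))"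
    if "K = M \<or> K = N" for K \<xi>
  proof -
    have "(E - F) \<union> F = E" using F(2) by auto
    moreover have "set_integrable K (E - F) (\<lambda>x. iexp (x \<bullet> \<xi>))" "set_integrable K F (\<lambda>x. iexp (x \<bullet> \<xi>))"
      using that set_integrable_iexp[of "E - F" \<xi>] set_integrable_iexp[of F \<xi>] by auto
    ultimately show ?thesis using set_integral_Un[of "E - F" F K "\<lambda>x. iexp (x \<bullet> \<xi>)"] by auto
  qed
  show ?thesis using E F *[of M] *[of N] by (auto simp: char_agree_def)
qed

lemma char_agree_Un:
  assumes "char_agree M N E" "char_agree M N F" "E \<inter> F = {}"
  shows "char_agree M N (E \<union> F)"
proof -
  have [measurable]: "E \<in> sets borel" "F \<in> sets borel" using assms by (auto simp: char_agree_def)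
  have "(CLINT x:E \<union> F|K. iexp (x \<bullet> \<xi>)) = (CLINT x:E|K. iexp (x \<bullet> \<xi>)) + (CLINT x:F|K. iexp (x \<bullet> \<xi>))"
    if "K = M \<or> K = N" for K \<xi>
    using that set_integrable_iexp[of E \<xi>] set_integrable_iexp[of F \<xi>]
    by (intro set_integral_Un assms(3)) auto
  from this[of M] this[of N] show ?thesis using assms by (simp add: char_agree_def)
qed

lemma char_agree_Int_borel:
  assumes "A \<in> sets borel" "char_agree M N F"
  shows "char_agree M N (A \<inter> F)"
proof -
  have "A \<in> sigma_sets UNIV {{x. x \<bullet> \<eta> \<in> A} | \<eta> A. A \<in> sets (borel :: real measure)}"
    using assms(1) half_spaces_generate_borel by blast
  \<comment> \<open>Quantifying over \<open>F\<close> makes the property closed under intersections, so that complements and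
    finite unions can be handled without a separate pi-system argument.\<close>
  then have "A \<in> sets borel \<and> (\<forall>F. char_agree M N F \<longrightarrow> char_agree M N (A \<inter> F))"
  proof (induction rule: sigma_sets.induct)
    case (Basic A)
    then obtain \<eta> B where A: "A = {x. x \<bullet> \<eta> \<in> B}" and [measurable]: "B \<in> sets (borel :: real measure)"
      by blast
    have "A \<in> sets borel" unfolding A by measurable
    moreover have "char_agree M N (A \<inter> F)" if "char_agree M N F" for F
      using char_agree_Int_half_space[OF that, of B \<eta>] by (simp add: A Int_commute)
    ultimately show ?case by blast
  next
    case Empty
    then show ?case by (simp add: char_agree_def set_lebesgue_integral_def)
  next
    case (Compl A)
    have "(UNIV - A) \<inter> F = F - (A \<inter> F)" for F by auto
    then show ?case using Compl char_agree_Diff by (metis Int_lower2 borel_comp Compl_eq_Diff_UNIV)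
  next
    case (Union A)
    then have [measurable]: "A i \<in> sets borel" for i by simp
    have fin: "char_agree M N ((\<Union>i<n. A i) \<inter> F)" if F: "char_agree M N F" for F n
    proof (induction n)
      case 0
      then show ?case by (simp add: char_agree_def set_lebesgue_integral_def)
    next
      case (Suc n)
      have "char_agree M N (F - (\<Union>i<n. A i) \<inter> F)" by (rule char_agree_Diff[OF F Suc]) simp
      then have "char_agree M N (A n \<inter> (F - (\<Union>i<n. A i) \<inter> F))" using Union by simp
      then have "char_agree M N (((\<Union>i<n. A i) \<inter> F) \<union> (A n \<inter> (F - (\<Union>i<n. A i) \<inter> F)))"
        by (intro char_agree_Un Suc) auto
      also have "((\<Union>i<n. A i) \<inter> F) \<union> (A n \<inter> (F - (\<Union>i<n. A i) \<inter> F)) = (\<Union>i<Suc n. A i) \<inter> F"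
        by (auto simp: less_Suc_eq)
      finally show ?case .
    qed
    have "char_agree M N ((\<Union>i. A i) \<inter> F)" if F: "char_agree M N F" for F
    proof -
      have [measurable]: "F \<in> sets borel" using F by (simp add: char_agree_def)
      have U: "(\<Union>n. (\<Union>i<n. A i) \<inter> F) = (\<Union>i. A i) \<inter> F" by auto
      have inc: "incseq (\<lambda>n. (\<Union>i<n. A i) \<inter> F)"
        by (intro incseq_SucI Int_mono UN_mono) auto
      have lim: "(\<lambda>n. CLINT x:(\<Union>i<n. A i) \<inter> F|K. iexp (x \<bullet> \<xi>)) \<longlonglongrightarrow> (CLINT x:(\<Union>i. A i) \<inter> F|K. iexp (x \<bullet> \<xi>))"
        if "K = M \<or> K = N" for K \<xi>
        using that set_integral_cont_up[OF _ inc, of K "\<lambda>x. iexp (x \<bullet> \<xi>)"] set_integrable_iexp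
        unfolding U by (auto simp: setsM setsN)
      have "(CLINT x:(\<Union>i. A i) \<inter> F|M. iexp (x \<bullet> \<xi>)) = (CLINT x:(\<Union>i. A i) \<inter> F|N. iexp (x \<bullet> \<xi>))" for \<xi>
        using lim[of M \<xi>] lim[of N \<xi>] fin[OF F] by (auto simp: char_agree_def intro: LIMSEQ_unique)
      then show ?thesis by (simp add: char_agree_def)
    qed
    then show ?case by auto
  qed
  then show ?thesis using assms(2) by blast
qed

theorem char_fun_uniqueness:
  assumes "\<And>\<xi>. char_fun M \<xi> = char_fun N \<xi>"
  shows "M = N"
proof (rule measure_eqI)
  show "sets M = sets N" by (simp add: setsM setsN)
  fix A assume "A \<in> sets M"
  then have A[measurable]: "A \<in> sets borel" by (simp add: setsM)
  have "char_agree M N UNIV"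
    using assms by (simp add: char_agree_def char_fun_def set_lebesgue_integral_def)
  then have "char_agree M N A" using char_agree_Int_borel[OF A] by force
  then have "(CLINT x:A|M. iexp (x \<bullet> 0)) = (CLINT x:A|N. iexp (x \<bullet> 0))" unfolding char_agree_def by blast
  then have "complex_of_real (measure M A) = complex_of_real (measure N A)"
    by (simp add: set_lebesgue_integral_def scaleR_conv_of_real setsM setsN)
  then show "emeasure M A = emeasure N A"
    by (simp add: M.emeasure_eq_measure N.emeasure_eq_measure)
qed

end

section \<open>Sums and differences of measures\<close>
definition msum :: "'a measure \<Rightarrow> 'a measure \<Rightarrow> 'a measure" where
  "msum M N = measure_of (space M) (sets M) (\<lambda>A. emeasure M A + emeasure N A)"

lemma sets_msum[simp, measurable_cong]: "sets (msum M N) = sets M"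
  by (simp add: msum_def)

lemma space_msum[simp]: "space (msum M N) = space M"
  by (simp add: msum_def)

lemma emeasure_msum:
  assumes "sets N = sets M" "A \<in> sets M"
  shows "emeasure (msum M N) A = emeasure M A + emeasure N A"
  unfolding msum_def
proof (rule emeasure_measure_of_sigma)
  show "sigma_algebra (space M) (sets M)" ..
  show "positive (sets M) (\<lambda>A. emeasure M A + emeasure N A)" by (simp add: positive_def)
  show "countably_additive (sets M) (\<lambda>A. emeasure M A + emeasure N A)"
  proof (rule countably_additiveI)
    fix B :: "nat \<Rightarrow> _" assume B: "range B \<subseteq> sets M" "disjoint_family B" "(\<Union>i. B i) \<in> sets M"
    have "(\<Sum>i. emeasure M (B i) + emeasure N (B i)) = (\<Sum>i. emeasure M (B i)) + (\<Sum>i. emeasure N (B i))"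
      by (rule suminf_add[symmetric]) auto
    also have "\<dots> = emeasure M (\<Union>i. B i) + emeasure N (\<Union>i. B i)"
      using B assms(1) by (simp add: suminf_emeasure)
    finally show "(\<Sum>i. emeasure M (B i) + emeasure N (B i)) = emeasure M (\<Union>i. B i) + emeasure N (\<Union>i. B i)" .
  qed
qed fact

lemma nn_integral_msum:
  assumes [measurable_cong]: "sets N = sets M" and "f \<in> borel_measurable M"
  shows "(\<integral>\<^sup>+x. f x \<partial>msum M N) = (\<integral>\<^sup>+x. f x \<partial>M) + (\<integral>\<^sup>+x. f x \<partial>N)"
  using assms(2)
proof (induction rule: borel_measurable_induct)
  case (cong f g)
  moreover have "space N = space M" using assms(1) by (rule sets_eq_imp_space_eq)
  ultimately have "integral\<^sup>N K f = integral\<^sup>N K g" if "space K = space M" for K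
    using that by (intro nn_integral_cong) auto
  then show ?case using cong \<open>space N = space M\<close> by simp
next
  case (set A)
  then have "A \<in> sets N" using assms(1) by blast
  then show ?case using set emeasure_msum[OF assms(1) set] by simp
next
  case (mult u c)
  then have [measurable]: "u \<in> borel_measurable N" "u \<in> borel_measurable (msum M N)"
    using mult by measurable
  show ?case using mult by (simp add: nn_integral_cmult distrib_left)
next
  case (add u v)
  then have [measurable]: "u \<in> borel_measurable N" "v \<in> borel_measurable N"
    "u \<in> borel_measurable (msum M N)" "v \<in> borel_measurable (msum M N)"
    using add by measurable
  show ?case using add by (simp add: nn_integral_add ac_simps)
next
  case (seq U)
  then have [measurable]: "U i \<in> borel_measurable N" "U i \<in> borel_measurable (msum M N)" for i
    using seq by measurable
  have inc: "incseq (\<lambda>i. \<integral>\<^sup>+x. U i x \<partial>K)" for K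
    using seq by (intro incseq_SucI nn_integral_mono) (auto simp: incseq_def le_fun_def)
  show ?case
    using seq by (simp add: nn_integral_monotone_convergence_SUP image_comp ennreal_SUP_add[OF inc inc])
qed

lemma integrable_msum:
  fixes f :: "'a \<Rightarrow> 'b::{banach, second_countable_topology}"
  assumes sets: "sets N = sets M" and f: "integrable M f" "integrable N f"
  shows "integrable (msum M N) f"
proof -
  have [measurable]: "f \<in> borel_measurable M" using f by simp
  then show ?thesis using f sets by (auto simp: integrable_iff_bounded nn_integral_msum)
qed

lemma integral_msum_real:
  fixes f :: "'a \<Rightarrow> real"
  assumes sets: "sets N = sets M" and f: "integrable M f" "integrable N f"
  shows "(LINT x|msum M N. f x) = (LINT x|M. f x) + (LINT x|N. f x)"
proof -
  have [measurable]: "f \<in> borel_measurable M" using f by simp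
  show ?thesis
    using f integrable_msum[OF sets f]
    by (simp add: real_lebesgue_integral_def nn_integral_msum[OF sets] enn2real_plus real_integrable_def less_top)
qed

lemma integral_msum:
  fixes f :: "'a \<Rightarrow> complex"
  assumes sets: "sets N = sets M" and f: "integrable M f" "integrable N f"
  shows "(CLINT x|msum M N. f x) = (CLINT x|M. f x) + (CLINT x|N. f x)"
  using integral_msum_real[OF sets integrable_Re[OF f(1)] integrable_Re[OF f(2)]]
    integral_msum_real[OF sets integrable_Im[OF f(1)] integrable_Im[OF f(2)]]
  unfolding integral_Re[OF f(1)] integral_Re[OF f(2)] integral_Im[OF f(1)] integral_Im[OF f(2)]
      integral_Re[OF integrable_msum[OF sets f]] integral_Im[OF integrable_msum[OF sets f]]
  by (intro complex_eqI) auto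

text \<open>
  A dominated measure has a density \<open>f \<le> 1\<close> with respect to the larger one, and \<open>1 - f\<close> is the
  density of the difference.
\<close>
lemma measure_difference:
  assumes sets: "sets M = sets N" and le: "\<And>A. A \<in> sets N \<Longrightarrow> emeasure M A \<le> emeasure N A"
    and sf: "sigma_finite_measure N"
  shows "\<exists>D. sets D = sets N \<and> N = msum M D"
proof -
  interpret N: sigma_finite_measure N by fact
  have "absolutely_continuous N M"
    unfolding absolutely_continuous_def
    using le sets by (auto simp: null_sets_def) (metis le_zero_eq)
  then obtain f where [measurable]: "f \<in> borel_measurable N" and f: "density N f = M"
    using N.Radon_Nikodym[OF _ sets] by blast
  obtain B :: "nat \<Rightarrow> _" where B: "range B \<subseteq> sets N" "(\<Union>i. B i) = space N" "\<And>i. emeasure N (B i) \<noteq> \<infinity>"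
    using N.sigma_finite by blast
  have "AE x in N. x \<in> B i \<longrightarrow> f x \<le> 1" for i
  proof -
    have [measurable]: "B i \<in> sets N" using B by auto
    define C where "C = {x \<in> space N. x \<in> B i \<and> 1 < f x}"
    have [measurable]: "C \<in> sets N" unfolding C_def by measurable
    have fin: "emeasure N C < \<infinity>"
      using B(3)[of i] emeasure_mono[of C "B i" N]
      by (metis (no_types, lifting) C_def \<open>B i \<in> sets N\<close> infinity_ennreal_def mem_Collect_eq order_le_less_trans subsetI top.not_eq_extremum)
    have "(\<integral>\<^sup>+x. f x * indicator C x \<partial>N) = emeasure M C"
      unfolding f[symmetric] by (simp add: emeasure_density)
    then have le': "(\<integral>\<^sup>+x. f x * indicator C x \<partial>N) \<le> (\<integral>\<^sup>+x. indicator C x \<partial>N)"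
      using le[of C] by simp
    have "(\<integral>\<^sup>+x. f x * indicator C x - indicator C x \<partial>N) =
      (\<integral>\<^sup>+x. f x * indicator C x \<partial>N) - (\<integral>\<^sup>+x. indicator C x \<partial>N)"
      using fin by (intro nn_integral_diff) (auto simp: C_def intro!: AE_I2 split: split_indicator)
    also have "\<dots> = 0" using le' fin by (intro diff_eq_0_ennreal) (auto intro: order_le_less_trans)
    finally have "AE x in N. f x * indicator C x - indicator C x = 0"
      by (subst (asm) nn_integral_0_iff_AE) auto
    then show ?thesis
    proof eventually_elim
      case (elim x)
      show ?case
      proof (intro impI, rule ccontr)
        assume x: "x \<in> B i" "\<not> f x \<le> 1"
        then have "x \<in> C" using B(1) sets.sets_into_space by (auto simp: C_def)
        then show False using elim x by (auto simp: diff_eq_0_iff_ennreal not_le)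
      qed
    qed
  qed
  then have "AE x in N. \<forall>i. x \<in> B i \<longrightarrow> f x \<le> 1" unfolding AE_all_countable by blast
  then have f1: "AE x in N. f x \<le> 1"
    using AE_space by eventually_elim (use B(2) in blast)
  define D where "D = density N (\<lambda>x. 1 - f x)"
  have "N = msum M D"
  proof (rule measure_eqI)
    show "sets N = sets (msum M D)" by (simp add: sets)
    fix A assume [measurable]: "A \<in> sets N"
    have "emeasure (msum M D) A = emeasure (density N f) A + emeasure D A"
      unfolding f using sets by (subst emeasure_msum) (auto simp: D_def)
    also have "\<dots> = (\<integral>\<^sup>+x. f x * indicator A x \<partial>N) + (\<integral>\<^sup>+x. (1 - f x) * indicator A x \<partial>N)"
      by (simp add: D_def emeasure_density)
    also have "\<dots> = (\<integral>\<^sup>+x. f x * indicator A x + (1 - f x) * indicator A x \<partial>N)"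
      by (rule nn_integral_add[symmetric]) auto
    also have "\<dots> = (\<integral>\<^sup>+x. indicator A x \<partial>N)"
      using f1 by (intro nn_integral_cong_AE, eventually_elim) (simp add: add_diff_inverse_ennreal split: split_indicator)
    finally show "emeasure N A = emeasure (msum M D) A" by simp
  qed
  then show ?thesis by (intro exI[of _ D]) (simp add: D_def)
qed

section \<open>Levy exponents\<close>
definition levy_weight :: "'a::real_normed_vector \<Rightarrow> real" where
  "levy_weight x = min 1 ((norm x)\<^sup>2)"

definition levy_kernel :: "'a::real_inner \<Rightarrow> 'a \<Rightarrow> complex" where
  "levy_kernel \<xi> x = iexp (\<xi> \<bullet> x) - 1 - \<i> * of_real (\<xi> \<bullet> x) / of_real (1 + (norm x)\<^sup>2)"

lemma levy_weight_nonneg[simp]: "0 \<le> levy_weight x"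
  by (simp add: levy_weight_def)

lemma levy_weight_measurable[measurable]:
  "levy_weight \<in> borel_measurable (borel :: 'a::{real_inner, polish_space} measure)"
  unfolding levy_weight_def[abs_def] by measurable

lemma levy_kernel_measurable[measurable]:
  "levy_kernel (\<xi> :: 'a::{real_inner, polish_space}) \<in> borel_measurable borel"
  unfolding levy_kernel_def[abs_def] by measurable

text \<open>
  The dependence on \<open>\<xi>\<close> is kept in the quadratic form \<open>(\<xi> \<bullet> x)\<^sup>2\<close>, and not estimated by the norm
  of \<open>\<xi>\<close>, because the expectation of this form over a Gaussian \<open>\<xi>\<close> is at most \<open>|x|\<^sup>2\<close> whatever the
  number of coordinates.  Close to \<open>0\<close> the bound comes from the second-order expansion of the
  exponential; for \<open>|x| > 1\<close> the kernel is at most \<open>2 + |\<xi> \<bullet> x| / (1 + |x|\<^sup>2)\<close>.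
\<close>
lemma norm_levy_kernel_le:
  "norm (levy_kernel \<xi> x) \<le> 3 * levy_weight x + (\<xi> \<bullet> x)\<^sup>2 * (levy_weight x / (norm x)\<^sup>2)"
proof -
  define u where "u = \<xi> \<bullet> x"
  define r where "r = (norm x)\<^sup>2"
  have r: "0 \<le> r" by (simp add: r_def)
  have k: "levy_kernel \<xi> x = iexp u - 1 - \<i> * of_real (u / (1 + r))"
    by (simp add: levy_kernel_def u_def r_def)
  show ?thesis
  proof (cases "norm x \<le> 1")
    case True
    then have r1: "r \<le> 1" by (simp add: r_def power_le_one)
    have w: "levy_weight x = r" using r1 by (simp add: levy_weight_def r_def)
    have "levy_kernel \<xi> x = (iexp u - 1 - \<i> * of_real u) + \<i> * of_real (u * r / (1 + r))"
    proof -
      have "u / (1 + r) = u - u * r / (1 + r)" using r by (simp add: field_simps)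
      then have "complex_of_real (u / (1 + r)) = of_real u - of_real (u * r / (1 + r))"
        by (metis of_real_diff)
      then show ?thesis unfolding k by (simp only:) (simp add: algebra_simps)
    qed
    then have "norm (levy_kernel \<xi> x) \<le> norm (iexp u - 1 - \<i> * of_real u) + norm (\<i> * of_real (u * r / (1 + r)))"
      by (metis norm_triangle_ineq)
    also have "norm (iexp u - 1 - \<i> * of_real u) \<le> u\<^sup>2 / 2"
      using iexp_approx1[of u 1] by (simp add: diff_diff_eq power2_eq_square)
    also have "norm (\<i> * of_real (u * r / (1 + r))) = \<bar>u\<bar> * r / (1 + r)"
      using r by (simp only: norm_mult norm_ii norm_of_real mult_1) (simp add: abs_mult)
    also have "\<bar>u\<bar> * r / (1 + r) \<le> \<bar>u\<bar> * r"
      using divide_left_mono[of 1 "1 + r" "\<bar>u\<bar> * r"] r by simp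
    also have "\<bar>u\<bar> * r \<le> (u\<^sup>2 + r) / 2"
    proof -
      have "0 \<le> (\<bar>u\<bar> - r)\<^sup>2" by simp
      then have "2 * \<bar>u\<bar> * r \<le> u\<^sup>2 + r\<^sup>2" by (simp add: power2_diff)
      moreover have "r\<^sup>2 \<le> r" using r r1 by (simp add: power2_eq_square mult_left_le)
      ultimately show ?thesis by simp
    qed
    finally have *: "norm (levy_kernel \<xi> x) \<le> u\<^sup>2 + r / 2" by (simp add: add_divide_distrib)
    show ?thesis
    proof (cases "x = 0")
      case False
      then have "r \<noteq> 0" by (simp add: r_def)
      then show ?thesis using * r unfolding w u_def[symmetric] r_def[symmetric] by simp
    qed (simp add: levy_kernel_def)
  next
    case False
    then have r1: "1 < r" by (simp add: r_def one_less_power)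
    have w: "levy_weight x = 1" using r1 by (simp add: levy_weight_def r_def)
    have "norm (levy_kernel \<xi> x) \<le> norm (iexp u - 1) + norm (\<i> * of_real (u / (1 + r)))"
      unfolding k by (rule norm_triangle_ineq4)
    also have "norm (iexp u - 1) \<le> norm (iexp u) + norm (1::complex)" by (rule norm_triangle_ineq4)
    also have "\<dots> = 2" by simp
    also have "norm (\<i> * of_real (u / (1 + r))) = \<bar>u\<bar> / (1 + r)"
      using r by (simp only: norm_mult norm_ii norm_of_real mult_1) simp
    also have "\<bar>u\<bar> / (1 + r) \<le> (1 + u\<^sup>2) / (1 + r)"
    proof (intro divide_right_mono)
      have "0 \<le> (\<bar>u\<bar> - 1)\<^sup>2" by simp
      then have "2 * \<bar>u\<bar> \<le> 1 + u\<^sup>2" by (simp add: power2_diff)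
      then show "\<bar>u\<bar> \<le> 1 + u\<^sup>2" by (smt (verit) zero_le_power2)
    qed (use r in auto)
    also have "\<dots> \<le> (1 + u\<^sup>2) / r"
      using r1 by (intro divide_left_mono) auto
    also have "\<dots> \<le> 1 + u\<^sup>2 / r"
      using r1 by (simp add: add_divide_distrib)
    finally show ?thesis
      unfolding w u_def[symmetric] r_def[symmetric] by simp
  qed
qed

lemma norm_levy_kernel_le_weight:
  "norm (levy_kernel \<xi> x) \<le> (3 + (norm \<xi>)\<^sup>2) * levy_weight x"
proof (cases "x = 0")
  case False
  have "(\<xi> \<bullet> x)\<^sup>2 \<le> (norm \<xi>)\<^sup>2 * (norm x)\<^sup>2"
    using Cauchy_Schwarz_ineq[of \<xi> x] by (simp add: power2_norm_eq_inner)
  then have "(\<xi> \<bullet> x)\<^sup>2 * (levy_weight x / (norm x)\<^sup>2) \<le> ((norm \<xi>)\<^sup>2 * (norm x)\<^sup>2) * (levy_weight x / (norm x)\<^sup>2)"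
    by (intro mult_right_mono) auto
  also have "\<dots> = (norm \<xi>)\<^sup>2 * levy_weight x" using False by simp
  finally show ?thesis using norm_levy_kernel_le[of \<xi> x] by (simp add: algebra_simps)
qed (simp add: levy_kernel_def levy_weight_def)

definition levy_mass :: "'a::real_normed_vector measure \<Rightarrow> ennreal" where
  "levy_mass m = (\<integral>\<^sup>+x. ennreal (levy_weight x) \<partial>m)"

lemma levy_measure_iff:
  "levy_measure m \<longleftrightarrow> sets m = sets borel \<and> sigma_finite_measure m \<and> emeasure m {0} = 0 \<and> levy_mass m < \<infinity>"
  by (simp add: levy_measure_def levy_mass_def levy_weight_def)

lemma integrable_levy_weight:
  fixes m :: "'a::{real_inner, polish_space} measure"
  assumes [measurable_cong]: "sets m = sets borel" and "levy_mass m < \<infinity>"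
  shows "integrable m levy_weight"
  using assms(2) by (intro integrableI_bounded) (auto simp: levy_mass_def)

lemma integrable_levy_kernel:
  fixes m :: "'a::{real_inner, polish_space} measure"
  assumes sets[measurable_cong]: "sets m = sets borel" and "levy_mass m < \<infinity>"
  shows "integrable m (levy_kernel \<xi>)"
proof (rule Bochner_Integration.integrable_bound)
  show "integrable m (\<lambda>x. (3 + (norm \<xi>)\<^sup>2) * levy_weight x)"
    by (intro integrable_mult_right integrable_levy_weight assms)
  show "AE x in m. norm (levy_kernel \<xi> x) \<le> norm ((3 + (norm \<xi>)\<^sup>2) * levy_weight x)"
    using norm_levy_kernel_le_weight[of \<xi>] by (auto intro!: AE_I2 intro: order_trans)
qed measurable

lemma levy_exponent_eq:
  "levy_exponent a R m \<xi> =
     - \<i> * of_real (a \<bullet> \<xi>) + of_real ((R \<xi> \<bullet> \<xi>) / 2) - (CLINT x|m. levy_kernel \<xi> x)"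
  by (simp add: levy_exponent_def levy_kernel_def)

lemma continuous_levy_exponent_ray:
  fixes m :: "'a::{real_inner, polish_space} measure"
  assumes sets[measurable_cong]: "sets m = sets borel" and m: "levy_mass m < \<infinity>"
  shows "continuous_on UNIV (\<lambda>t. levy_exponent a R m (t *\<^sub>R \<xi>))"
proof -
  have "continuous_on UNIV (\<lambda>t. CLINT x|m. levy_kernel (t *\<^sub>R \<xi>) x)"
    unfolding continuous_on_sequentially o_def
  proof (intro allI ballI impI)
    fix u :: "nat \<Rightarrow> real" and t assume "(\<forall>n. u n \<in> UNIV) \<and> u \<longlonglongrightarrow> t"
    then have u: "u \<longlonglongrightarrow> t" by simp
    then obtain K where K: "0 < K" "\<And>n. norm (u n) \<le> K" using convergent_imp_Bseq convergentI Bseq_def by metis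
    have nz: "complex_of_real (1 + (norm x)\<^sup>2) \<noteq> 0" for x :: 'a
      unfolding of_real_eq_0_iff using zero_le_power2[of "norm x"] by linarith
    show "(\<lambda>n. CLINT x|m. levy_kernel (u n *\<^sub>R \<xi>) x) \<longlonglongrightarrow> (CLINT x|m. levy_kernel (t *\<^sub>R \<xi>) x)"
    proof (rule integral_dominated_convergence)
      show "integrable m (\<lambda>x. (3 + (K * norm \<xi>)\<^sup>2) * levy_weight x)"
        by (intro integrable_mult_right integrable_levy_weight assms)
      show "AE x in m. (\<lambda>n. levy_kernel (u n *\<^sub>R \<xi>) x) \<longlonglongrightarrow> levy_kernel (t *\<^sub>R \<xi>) x"
        unfolding levy_kernel_def
        by (intro AE_I2 tendsto_intros u nz)
      fix n
      have "(norm (u n *\<^sub>R \<xi>))\<^sup>2 \<le> (K * norm \<xi>)\<^sup>2"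
        using K by (intro power_mono) (auto intro: mult_right_mono)
      then have "(3 + (norm (u n *\<^sub>R \<xi>))\<^sup>2) * levy_weight x \<le> (3 + (K * norm \<xi>)\<^sup>2) * levy_weight x" for x :: 'a
        by (intro mult_right_mono) auto
      then show "AE x in m. norm (levy_kernel (u n *\<^sub>R \<xi>) x) \<le> (3 + (K * norm \<xi>)\<^sup>2) * levy_weight x"
        using norm_levy_kernel_le_weight by (intro AE_I2) (rule order_trans)
    qed measurable
  qed
  then show ?thesis
    unfolding levy_exponent_eq by (intro continuous_intros) auto
qed

lemma levy_exponent_zero[simp]: "levy_exponent a R m 0 = 0"
  by (simp add: levy_exponent_def)

lemma continuous_char_fun_ray:
  fixes M :: "'a::{real_inner, polish_space} measure"
  assumes "prob_space M" and sets[measurable_cong]: "sets M = sets borel"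
  shows "continuous_on UNIV (\<lambda>t. char_fun M (t *\<^sub>R \<xi>))"
proof -
  interpret prob_space M by fact
  show ?thesis
    unfolding continuous_on_sequentially o_def
  proof (intro allI ballI impI)
    fix u :: "nat \<Rightarrow> real" and t assume "(\<forall>n. u n \<in> UNIV) \<and> u \<longlonglongrightarrow> t"
    then have u: "u \<longlonglongrightarrow> t" by simp
    show "(\<lambda>n. char_fun M (u n *\<^sub>R \<xi>)) \<longlonglongrightarrow> char_fun M (t *\<^sub>R \<xi>)"
      unfolding char_fun_def
      by (rule integral_dominated_convergence[where w="\<lambda>_. 1"])
        (auto intro!: AE_I2 tendsto_intros u)
  qed
qed

text \<open>
  The values lie in \<open>2 \<pi> i \<int>\<close>.  This lemma turns an identity between exponentials of
  exponents into an identity between the exponents.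
\<close>
lemma continuous_logarithm_of_one:
  fixes f :: "real \<Rightarrow> complex"
  assumes "continuous_on UNIV f" "\<And>t. exp (f t) = 1" "f 0 = 0"
  shows "f t = 0"
proof -
  have "f constant_on UNIV"
  proof (rule continuous_discrete_range_constant)
    fix x :: real
    have "2 * pi \<le> norm (f y - f x)" if "f y \<noteq> f x" for y
    proof -
      from assms(2)[of x] obtain m :: int where m: "Re (f x) = 0" "Im (f x) = of_int (2 * m) * pi"
        unfolding exp_eq_1 by blast
      from assms(2)[of y] obtain n :: int where n: "Re (f y) = 0" "Im (f y) = of_int (2 * n) * pi"
        unfolding exp_eq_1 by blast
      have "n \<noteq> m" using that m n by (auto simp: complex_eq_iff)
      then have "1 \<le> \<bar>n - m\<bar>" by linarith
      then have "1 \<le> \<bar>real_of_int n - of_int m\<bar>" by linarith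
      then have "2 * pi \<le> \<bar>real_of_int n - of_int m\<bar> * (2 * pi)" by simp
      also have "\<dots> = \<bar>Im (f y - f x)\<bar>"
      proof -
        have "Im (f y - f x) = (of_int n - of_int m) * (2 * pi)" using m n by (simp add: algebra_simps)
        then show ?thesis by (simp add: abs_mult)
      qed
      also have "\<dots> \<le> norm (f y - f x)" by (rule abs_Im_le_cmod)
      finally show ?thesis .
    qed
    then show "\<exists>e>0. \<forall>y. y \<in> UNIV \<and> f y \<noteq> f x \<longrightarrow> e \<le> norm (f y - f x)"
      by (intro exI[of _ "2 * pi"]) auto
  qed (use assms in auto)
  then show ?thesis using assms(3) by (metis UNIV_I constant_on_def)
qed

lemma continuous_root_of_one:
  fixes f :: "real \<Rightarrow> complex"
  assumes "continuous_on UNIV f" "\<And>t. f t ^ n = 1" "f 0 = 1" "1 \<le> n"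
  shows "f t = 1"
proof -
  have "finite (f ` UNIV)"
    by (rule finite_subset[of _ "{z. z ^ n = 1}"]) (use assms in \<open>auto intro: finite_roots_unity\<close>)
  then have "f constant_on UNIV"
    using assms by (intro continuous_finite_range_constant) auto
  then show ?thesis using assms(3) by (metis UNIV_I constant_on_def)
qed

section \<open>Monotonicity of the triplets\<close>
definition cos_density :: "'a::{real_inner, polish_space} measure \<Rightarrow> 'a \<Rightarrow> 'a measure" where
  "cos_density m \<eta> = density m (\<lambda>x. ennreal (1 - cos (\<eta> \<bullet> x)))"

lemma sets_cos_density[simp]: "sets (cos_density m \<eta>) = sets m"
  by (simp add: cos_density_def)

lemma one_minus_cos_le_weight:
  "1 - cos (\<eta> \<bullet> x) \<le> (2 + (norm \<eta>)\<^sup>2) * levy_weight x"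
proof -
  define u where "u = \<eta> \<bullet> x"
  have "\<bar>u\<bar> \<le> norm \<eta> * norm x" unfolding u_def by (rule Cauchy_Schwarz_ineq2)
  then have "\<bar>u\<bar>\<^sup>2 \<le> (norm \<eta> * norm x)\<^sup>2" by (intro power_mono) auto
  then have u: "u\<^sup>2 \<le> (norm \<eta>)\<^sup>2 * (norm x)\<^sup>2" by (simp add: power_mult_distrib)
  have "(sin (u/2))\<^sup>2 \<le> (u/2)\<^sup>2" using abs_sin_x_le_abs_x[of "u/2"] unfolding abs_le_square_iff .
  moreover have "1 - cos u = 2 * (sin (u/2))\<^sup>2"
    using cos_double_sin[of "u/2"] by simp
  moreover have "(u/2)\<^sup>2 = u\<^sup>2 / 4" by (simp add: power_divide)
  ultimately have 1: "1 - cos u \<le> (norm \<eta>)\<^sup>2 * (norm x)\<^sup>2" using u zero_le_power2[of u] by linarith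
  have 2: "1 - cos u \<le> 2" using cos_ge_minus_one[of u] by linarith
  show ?thesis
  proof (cases "(norm x)\<^sup>2 \<le> 1")
    case True
    then have "levy_weight x = (norm x)\<^sup>2" by (simp add: levy_weight_def)
    then show ?thesis using 1 zero_le_power2[of "norm x"] unfolding u_def distrib_right \<open>levy_weight x = (norm x)\<^sup>2\<close> by linarith
  next
    case False
    then have "levy_weight x = 1" by (simp add: levy_weight_def)
    then show ?thesis using 2 unfolding u_def by (simp add: add_increasing2)
  qed
qed

context
  fixes m :: "'a::{real_inner, polish_space} measure"
  assumes sets[measurable_cong]: "sets m = sets borel" and mass: "levy_mass m < \<infinity>"
begin

lemma integrable_one_minus_cos: "integrable m (\<lambda>x. 1 - cos (\<eta> \<bullet> x))"
proof (rule Bochner_Integration.integrable_bound)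
  show "integrable m (\<lambda>x. (2 + (norm \<eta>)\<^sup>2) * levy_weight x)"
    by (intro integrable_mult_right integrable_levy_weight sets mass)
  show "AE x in m. norm (1 - cos (\<eta> \<bullet> x)) \<le> norm ((2 + (norm \<eta>)\<^sup>2) * levy_weight x)"
  proof (rule AE_I2)
    fix x
    have "norm (1 - cos (\<eta> \<bullet> x)) = 1 - cos (\<eta> \<bullet> x)" by simp
    also have "\<dots> \<le> (2 + (norm \<eta>)\<^sup>2) * levy_weight x" by (rule one_minus_cos_le_weight)
    also have "\<dots> \<le> norm ((2 + (norm \<eta>)\<^sup>2) * levy_weight x)" by (simp only: real_norm_def abs_ge_self)
    finally show "norm (1 - cos (\<eta> \<bullet> x)) \<le> norm ((2 + (norm \<eta>)\<^sup>2) * levy_weight x)" .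
  qed
qed measurable

lemma finite_cos_density: "finite_measure (cos_density m \<eta>)"
proof (rule finite_measureI)
  have "emeasure (cos_density m \<eta>) (space (cos_density m \<eta>)) = (\<integral>\<^sup>+x. ennreal (1 - cos (\<eta> \<bullet> x)) \<partial>m)"
    unfolding cos_density_def by (subst emeasure_density) (auto intro!: nn_integral_cong)
  also have "\<dots> < \<infinity>" using integrable_one_minus_cos[of \<eta>] by (simp add: integrable_iff_bounded)
  finally show "emeasure (cos_density m \<eta>) (space (cos_density m \<eta>)) \<noteq> \<infinity>" by simp
qed

lemma integral_cos_density:
  fixes f :: "'a \<Rightarrow> complex"
  assumes "f \<in> borel_measurable borel"
  shows "(CLINT x|cos_density m \<eta>. f x) = (CLINT x|m. (1 - cos (\<eta> \<bullet> x)) *\<^sub>R f x)"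
  unfolding cos_density_def
  by (rule integral_density) (use assms in \<open>auto simp: measurable_cong_sets[OF sets refl]\<close>)

text \<open>
  The drift and the compensator in the kernel are linear in \<open>\<xi>\<close> and drop out.  The quadratic form leaves its
  value at \<open>\<eta>\<close> by the parallelogram identity, and the jump integral leaves the cosine density because
  \<open>iexp (u + v) + iexp (u - v) = 2 cos v iexp u\<close>.
\<close>
lemma levy_exponent_second_difference:
  "(levy_exponent a R m (\<xi> + \<eta>) + levy_exponent a R m (\<xi> - \<eta>)) / 2 - levy_exponent a R m \<xi> =
     of_real (R \<eta> \<bullet> \<eta> / 2) + char_fun (cos_density m \<eta>) \<xi>"
proof -
  have int: "integrable m (levy_kernel \<zeta>)" for \<zeta>
    by (rule integrable_levy_kernel[OF sets mass])
  have pointwise: "levy_kernel \<xi> x - (levy_kernel (\<xi> + \<eta>) x + levy_kernel (\<xi> - \<eta>) x) / 2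
      = (1 - cos (\<eta> \<bullet> x)) *\<^sub>R iexp (x \<bullet> \<xi>)" for x
  proof -
    define u where "u = \<xi> \<bullet> x"
    define v where "v = \<eta> \<bullet> x"
    have *: "(\<xi> + \<eta>) \<bullet> x = u + v" "(\<xi> - \<eta>) \<bullet> x = u - v" "x \<bullet> \<xi> = u"
      by (simp_all add: u_def v_def inner_add inner_diff inner_commute)
    have e: "iexp (u + v) + iexp (u - v) = 2 * of_real (cos v) * iexp u"
      by (simp add: complex_eq_iff Re_exp Im_exp cos_add sin_add cos_diff sin_diff algebra_simps)
    have "levy_kernel \<xi> x - (levy_kernel (\<xi> + \<eta>) x + levy_kernel (\<xi> - \<eta>) x) / 2
        = iexp u - (iexp (u + v) + iexp (u - v)) / 2"
    proof -
      define E where "E = complex_of_real (1 + (norm x)\<^sup>2)"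
      have "E \<noteq> 0" unfolding E_def of_real_eq_0_iff using zero_le_power2[of "norm x"] by linarith
      then show ?thesis
        unfolding levy_kernel_def * u_def[symmetric] E_def[symmetric] of_real_add[of u v] of_real_diff
        by (simp add: field_simps)
    qed
    also have "\<dots> = (1 - cos v) *\<^sub>R iexp u"
      unfolding e by (simp add: scaleR_conv_of_real algebra_simps)
    finally show ?thesis unfolding * v_def .
  qed
  have "char_fun (cos_density m \<eta>) \<xi>
      = (CLINT x|m. levy_kernel \<xi> x - (levy_kernel (\<xi> + \<eta>) x + levy_kernel (\<xi> - \<eta>) x) / 2)"
    unfolding char_fun_def pointwise by (rule integral_cos_density) measurable
  also have "\<dots> = (CLINT x|m. levy_kernel \<xi> x)
      - ((CLINT x|m. levy_kernel (\<xi> + \<eta>) x) + (CLINT x|m. levy_kernel (\<xi> - \<eta>) x)) / 2"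
    by (simp add: int)
  finally have c: "char_fun (cos_density m \<eta>) \<xi> = (CLINT x|m. levy_kernel \<xi> x)
      - ((CLINT x|m. levy_kernel (\<xi> + \<eta>) x) + (CLINT x|m. levy_kernel (\<xi> - \<eta>) x)) / 2" .
  have q: "R (\<xi> + \<eta>) \<bullet> (\<xi> + \<eta>) + R (\<xi> - \<eta>) \<bullet> (\<xi> - \<eta>) = 2 * (R \<xi> \<bullet> \<xi>) + 2 * (R \<eta> \<bullet> \<eta>)"
    by (simp add: blinfun.add_right blinfun.diff_right inner_add inner_diff)
  have "complex_of_real (R (\<xi> + \<eta>) \<bullet> (\<xi> + \<eta>)) + of_real (R (\<xi> - \<eta>) \<bullet> (\<xi> - \<eta>))
      = 2 * of_real (R \<xi> \<bullet> \<xi>) + 2 * of_real (R \<eta> \<bullet> \<eta>)"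
    using arg_cong[OF q, of complex_of_real] by simp
  moreover define P where "P = complex_of_real (R (\<xi> + \<eta>) \<bullet> (\<xi> + \<eta>))"
  moreover define Q where "Q = complex_of_real (R (\<xi> - \<eta>) \<bullet> (\<xi> - \<eta>))"
  ultimately have PQ: "P = 2 * of_real (R \<xi> \<bullet> \<xi>) + 2 * of_real (R \<eta> \<bullet> \<eta>) - Q"
    by (metis add_diff_cancel_right')
  show ?thesis
    unfolding levy_exponent_eq c inner_add_right[of a \<xi> \<eta>] inner_diff_right[of a \<xi> \<eta>]
      of_real_add of_real_diff of_real_divide P_def[symmetric] Q_def[symmetric] PQ
    by (simp add: field_simps)
qed

end

lemma char_fun_msum:
  fixes M N :: "'a::{real_inner, polish_space} measure"
  assumes "finite_measure M" "finite_measure N" and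
    [measurable_cong]: "sets M = sets borel" "sets N = sets borel"
  shows "char_fun (msum M N) \<xi> = char_fun M \<xi> + char_fun N \<xi>"
proof -
  interpret M: finite_measure M by fact
  interpret N: finite_measure N by fact
  show ?thesis unfolding char_fun_def
    by (rule integral_msum)
      (auto simp: assms(3,4) intro!: M.integrable_const_bound[of _ 1] N.integrable_const_bound[of _ 1])
qed

lemma finite_measure_msum:
  assumes "finite_measure M" "finite_measure N" "sets N = sets M"
  shows "finite_measure (msum M N)"
proof (rule finite_measureI)
  have "space M = space N" using assms(3) sets_eq_imp_space_eq by metis
  then show "emeasure (msum M N) (space (msum M N)) \<noteq> \<infinity>"
    using finite_measure.emeasure_finite[OF assms(1)] finite_measure.emeasure_finite[OF assms(2)]
      emeasure_msum[OF assms(3) sets.top]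
    by simp
qed

text \<open>The point mass \<open>c\<close> at the origin, whose characteristic function is the constant \<open>c\<close>.\<close>
definition dirac_zero :: "real \<Rightarrow> 'a::{real_inner, polish_space} measure" where
  "dirac_zero c = density (return borel 0) (\<lambda>_. ennreal c)"

lemma dirac_zero:
  assumes "0 \<le> c"
  shows "sets (dirac_zero c :: 'a::{real_inner, polish_space} measure) = sets borel"
    "finite_measure (dirac_zero c :: 'a measure)" "char_fun (dirac_zero c :: 'a measure) \<xi> = of_real c"
    "A \<in> sets borel \<Longrightarrow> emeasure (dirac_zero c :: 'a measure) A = ennreal c * indicator A 0"
proof -
  show s: "sets (dirac_zero c :: 'a measure) = sets borel" by (simp add: dirac_zero_def)
  show e: "emeasure (dirac_zero c :: 'a measure) A = ennreal c * indicator A 0" if "A \<in> sets borel" for A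
    using that unfolding dirac_zero_def by (simp add: emeasure_density_const)
  show "finite_measure (dirac_zero c :: 'a measure)"
    using e[of UNIV] by (intro finite_measureI) (simp add: dirac_zero_def ennreal_mult_eq_top_iff)
  have "char_fun (dirac_zero c :: 'a measure) \<xi> = (CLINT x|return borel (0::'a). c *\<^sub>R iexp (x \<bullet> \<xi>))"
    unfolding char_fun_def dirac_zero_def by (rule integral_density) (use assms in auto)
  also have "\<dots> = of_real c" by (subst integral_return) (auto simp: scaleR_conv_of_real)
  finally show "char_fun (dirac_zero c :: 'a measure) \<xi> = of_real c" .
qed

lemma exists_dense_cos_less_one:
  fixes x :: "'a::real_inner"
  assumes D: "\<And>X. open X \<Longrightarrow> X \<noteq> {} \<Longrightarrow> \<exists>d\<in>D. d \<in> X" and x: "x \<noteq> 0"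
  shows "\<exists>\<eta>\<in>D. cos (\<eta> \<bullet> x) < 1"
proof -
  let ?X = "{\<eta>. 0 < \<eta> \<bullet> x} \<inter> {\<eta>. \<eta> \<bullet> x < 2 * pi}"
  have "open ?X" by (intro open_Int open_Collect_less continuous_intros)
  moreover have "(1 / (x \<bullet> x)) *\<^sub>R x \<in> ?X"
    using x pi_gt3 by simp
  ultimately obtain \<eta> where \<eta>: "\<eta> \<in> D" "0 < \<eta> \<bullet> x" "\<eta> \<bullet> x < 2 * pi" using D[of ?X] by blast
  have "0 < sin ((\<eta> \<bullet> x) / 2)" using \<eta> by (intro sin_gt_zero) auto
  then have "cos (2 * ((\<eta> \<bullet> x) / 2)) < 1" unfolding cos_double_sin by simp
  then show ?thesis using \<eta>(1) by auto
qed

text \<open>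
  On the set where \<open>cos (\<eta> \<bullet> x) < 1\<close> the measure is recovered from its cosine density by division.
  Countably many \<open>\<eta>\<close> suffice to cover the complement of the origin, and the comparison is summed over
  the disjoint pieces.
\<close>
lemma measure_le_if_cos_density_le:
  fixes m1 m2 :: "'a::{real_inner, polish_space} measure"
  assumes [measurable_cong]: "sets m1 = sets borel" "sets m2 = sets borel" and zero: "emeasure m2 {0} = 0"
    and le: "\<And>\<eta> A. A \<in> sets borel \<Longrightarrow> emeasure (cos_density m2 \<eta>) A \<le> emeasure (cos_density m1 \<eta>) A"
    and A[measurable]: "A \<in> sets borel"
  shows "emeasure m2 A \<le> emeasure m1 A"
proof -
  obtain D :: "'a set" where D: "countable D" "\<And>X. open X \<Longrightarrow> X \<noteq> {} \<Longrightarrow> \<exists>d\<in>D. d \<in> X"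
    using countable_dense_exists by blast
  define d where "d = from_nat_into D"
  define B where "B k = {x. cos (d k \<bullet> x) < 1}" for k
  have [measurable]: "B k \<in> sets borel" for k unfolding B_def by measurable
  define C where "C k = disjointed B k \<inter> A" for k
  have Cm[measurable]: "C k \<in> sets borel" for k unfolding C_def disjointed_def by measurable
  have disj: "disjoint_family C"
    using disjoint_family_disjointed[of B] by (auto simp: C_def disjoint_family_on_def)
  have cover: "A - {0} \<subseteq> (\<Union>k. C k)"
  proof
    fix x assume x: "x \<in> A - {0}"
    then obtain \<eta> where "\<eta> \<in> D" "cos (\<eta> \<bullet> x) < 1" using exists_dense_cos_less_one[OF D(2)] by blast
    then have "x \<in> (\<Union>k. B k)" using from_nat_into_surj[OF D(1)] unfolding B_def d_def by force
    then show "x \<in> (\<Union>k. C k)" using x unfolding UN_disjointed_eq[of B, symmetric] C_def by blast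
  qed
  have piece: "emeasure m2 (C k) \<le> emeasure m1 (C k)" for k
  proof -
    define h where "h x = ennreal (1 / (1 - cos (d k \<bullet> x))) * indicator (C k) x" for x
    have [measurable]: "h \<in> borel_measurable borel" unfolding h_def[abs_def] by measurable
    have CB: "C k \<subseteq> B k" using disjointed_subset[of B k] by (auto simp: C_def)
    have *: "emeasure m (C k) = (\<integral>\<^sup>+x. h x \<partial>cos_density m (d k))" if [measurable_cong]: "sets m = sets borel" for m
    proof -
      have "(\<integral>\<^sup>+x. h x \<partial>cos_density m (d k)) = (\<integral>\<^sup>+x. ennreal (1 - cos (d k \<bullet> x)) * h x \<partial>m)"
        unfolding cos_density_def by (subst nn_integral_density) auto
      also have "\<dots> = (\<integral>\<^sup>+x. indicator (C k) x \<partial>m)"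
      proof (rule nn_integral_cong)
        fix x
        show "ennreal (1 - cos (d k \<bullet> x)) * h x = indicator (C k) x"
        proof (cases "x \<in> C k")
          case True
          then have "cos (d k \<bullet> x) < 1" using CB by (auto simp: B_def)
          then show ?thesis using True by (simp add: h_def ennreal_mult[symmetric])
        qed (simp add: h_def)
      qed
      finally show ?thesis by (simp add: that)
    qed
    have "cos_density m2 (d k) \<le> cos_density m1 (d k)"
      by (subst le_measure) (auto simp: le assms(1,2))
    then show ?thesis unfolding *[OF assms(1)] *[OF assms(2)]
      by (intro nn_integral_mono_measure) (simp_all add: assms(1,2))
  qed
  have "emeasure m2 A \<le> emeasure m2 ((\<Union>k. C k) \<union> {0})"
    using cover by (intro emeasure_mono) (auto simp: assms(2))
  also have "\<dots> \<le> emeasure m2 (\<Union>k. C k) + emeasure m2 {0}"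
    by (rule emeasure_subadditive) (auto simp: assms(2))
  also have "\<dots> = (\<Sum>k. emeasure m2 (C k))"
    using disj zero by (simp add: suminf_emeasure assms(2) image_subset_iff)
  also have "\<dots> \<le> (\<Sum>k. emeasure m1 (C k))"
    by (intro suminf_le piece) auto
  also have "\<dots> = emeasure m1 (\<Union>k. C k)"
    using disj by (intro suminf_emeasure) (auto simp: assms(1))
  also have "\<dots> \<le> emeasure m1 A"
    by (intro emeasure_mono) (auto simp: C_def assms(1))
  finally show ?thesis .
qed

text \<open>
  Taking second differences of the additive identity and moving nothing but non-negative terms to
  each side, one reads it as the equality of the characteristic functions of two finite measures, in
  which the Gaussian parts appear as point masses at the origin.  The measures agree; evaluating them
  at \<open>{0}\<close>, where cosine densities have no mass, separates the Gaussian part from the jump part.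
\<close>
lemma levy_exponent_additive_imp_mono:
  fixes m1 m2 m3 :: "'a::{real_inner, polish_space} measure" and U :: "'a \<Rightarrow> 'a"
  assumes m: "levy_measure m1" "levy_measure m2" "levy_measure m3"
    and R: "nonneg_op R1" "nonneg_op R2" "nonneg_op R3"
    and U[measurable]: "U \<in> borel_measurable borel"
    and V: "\<And>x \<xi>. U x \<bullet> \<xi> = x \<bullet> V \<xi>" "linear V"
    and eq: "\<And>\<xi>. levy_exponent a1 R1 m1 \<xi> = levy_exponent a2 R2 m2 \<xi> + levy_exponent a3 R3 m3 (V \<xi>)"
  shows "R1 \<eta> \<bullet> \<eta> = R2 \<eta> \<bullet> \<eta> + R3 (V \<eta>) \<bullet> V \<eta>"
    and "A \<in> sets borel \<Longrightarrow> emeasure m2 A \<le> emeasure m1 A"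
proof -
  note [measurable_cong] = m[THEN levy_measure_iff[THEN iffD1], THEN conjunct1]
  have sets: "sets m1 = sets borel" "sets m2 = sets borel" "sets m3 = sets borel"
    and mass: "levy_mass m1 < \<infinity>" "levy_mass m2 < \<infinity>" "levy_mass m3 < \<infinity>"
    using m by (auto simp: levy_measure_iff)
  define A1 A2 A3 where "A1 \<eta> = cos_density m1 \<eta>" "A2 \<eta> = cos_density m2 \<eta>"
    "A3 \<eta> = distr (cos_density m3 (V \<eta>)) borel U" for \<eta>
  have U3: "U \<in> borel_measurable (cos_density m3 \<zeta>)" for \<zeta>
    using U unfolding measurable_cong_sets[OF trans[OF sets_cos_density sets(3)] refl] .
  have fin: "finite_measure (A1 \<eta>)" "finite_measure (A2 \<eta>)" "finite_measure (A3 \<eta>)" for \<eta>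
  proof -
    show "finite_measure (A1 \<eta>)" "finite_measure (A2 \<eta>)"
      unfolding A1_A2_A3_def by (intro finite_cos_density sets mass)+
    show "finite_measure (A3 \<eta>)"
      unfolding A1_A2_A3_def by (intro finite_measure.finite_measure_distr finite_cos_density sets mass U3)
  qed
  have setsA: "sets (A1 \<eta>) = sets borel" "sets (A2 \<eta>) = sets borel" "sets (A3 \<eta>) = sets borel" for \<eta>
    using sets by (simp_all add: A1_A2_A3_def)
  \<comment> \<open>The Gaussian parts, which are constant in \<open>\<xi>\<close>.\<close>
  define c1 c2 where "c1 \<eta> = R1 \<eta> \<bullet> \<eta> / 2" "c2 \<eta> = R2 \<eta> \<bullet> \<eta> / 2 + R3 (V \<eta>) \<bullet> V \<eta> / 2" for \<eta>
  have c: "0 \<le> c1 \<eta>" "0 \<le> c2 \<eta>" for \<eta> using R by (auto simp: c1_c2_def nonneg_op_def)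
  have char3: "char_fun (A3 \<eta>) \<xi> = char_fun (cos_density m3 (V \<eta>)) (V \<xi>)" for \<eta> \<xi>
    unfolding char_fun_def A1_A2_A3_def
    by (subst integral_distr[OF U3]) (auto simp: V(1))
  have char_eq: "char_fun (msum (A1 \<eta>) (dirac_zero (c1 \<eta>))) \<xi> = char_fun (msum (msum (A2 \<eta>) (A3 \<eta>)) (dirac_zero (c2 \<eta>))) \<xi>" for \<eta> \<xi>
  proof -
    have l: "V (\<xi> + \<eta>) = V \<xi> + V \<eta>" "V (\<xi> - \<eta>) = V \<xi> - V \<eta>"
      by (simp_all add: linear_add[OF V(2)] linear_diff[OF V(2)])
    have "of_real (c1 \<eta>) + char_fun (A1 \<eta>) \<xi>
        = (levy_exponent a1 R1 m1 (\<xi> + \<eta>) + levy_exponent a1 R1 m1 (\<xi> - \<eta>)) / 2 - levy_exponent a1 R1 m1 \<xi>"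
      unfolding A1_A2_A3_def c1_c2_def by (rule levy_exponent_second_difference[OF sets(1) mass(1), symmetric])
    also have "\<dots> = ((levy_exponent a2 R2 m2 (\<xi> + \<eta>) + levy_exponent a2 R2 m2 (\<xi> - \<eta>)) / 2 - levy_exponent a2 R2 m2 \<xi>)
       + ((levy_exponent a3 R3 m3 (V \<xi> + V \<eta>) + levy_exponent a3 R3 m3 (V \<xi> - V \<eta>)) / 2 - levy_exponent a3 R3 m3 (V \<xi>))"
      unfolding eq l by (simp add: field_simps)
    also have "\<dots> = (of_real (R2 \<eta> \<bullet> \<eta> / 2) + char_fun (A2 \<eta>) \<xi>) + (of_real (R3 (V \<eta>) \<bullet> V \<eta> / 2) + char_fun (A3 \<eta>) \<xi>)"
      unfolding levy_exponent_second_difference[OF sets(2) mass(2)] levy_exponent_second_difference[OF sets(3) mass(3)] char3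
      by (simp add: A1_A2_A3_def)
    finally show ?thesis
      using fin c
      by (simp add: char_fun_msum dirac_zero setsA finite_measure_msum) (simp add: c1_c2_def add_ac)
  qed
  have meas_eq: "msum (A1 \<eta>) (dirac_zero (c1 \<eta>)) = msum (msum (A2 \<eta>) (A3 \<eta>)) (dirac_zero (c2 \<eta>))" for \<eta>
    by (rule finite_borel_pair.char_fun_uniqueness[OF finite_borel_pair.intro char_eq])
      (simp_all add: finite_measure_msum fin dirac_zero c setsA)
  have em: "emeasure (A1 \<eta>) A + ennreal (c1 \<eta>) * indicator A 0
      = emeasure (A2 \<eta>) A + emeasure (A3 \<eta>) A + ennreal (c2 \<eta>) * indicator A 0" if "A \<in> sets borel" for A \<eta>
    using arg_cong[OF meas_eq, of "\<lambda>M. emeasure M A" \<eta>] that c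
    by (simp add: emeasure_msum setsA dirac_zero)
  have zero: "emeasure (cos_density m \<zeta>) B = 0"
    if B: "B \<in> sets borel" "\<And>x. x \<in> B \<Longrightarrow> \<zeta> \<bullet> x = 0" and [measurable_cong]: "sets m = sets borel" for m :: "'a measure" and \<zeta> B
  proof -
    have "emeasure (cos_density m \<zeta>) B = (\<integral>\<^sup>+x. ennreal (1 - cos (\<zeta> \<bullet> x)) * indicator B x \<partial>m)"
      unfolding cos_density_def using B by (intro emeasure_density) auto
    also have "\<dots> = (\<integral>\<^sup>+x. 0 \<partial>m)"
      by (intro nn_integral_cong) (use B(2) in \<open>auto split: split_indicator\<close>)
    finally show ?thesis by simp
  qed
  have zero3: "emeasure (A3 \<eta>) {0} = 0" for \<eta>
  proof -
    have "emeasure (A3 \<eta>) {0} = emeasure (cos_density m3 (V \<eta>)) {x. U x = 0}"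
      unfolding A1_A2_A3_def
      by (subst emeasure_distr[OF U3]) (auto simp: sets_eq_imp_space_eq[OF sets(3)] cos_density_def vimage_def)
    also have "\<dots> = 0"
    proof (rule zero)
      show "{x. U x = 0} \<in> sets borel" by measurable
      show "V \<eta> \<bullet> x = 0" if "x \<in> {x. U x = 0}" for x using that V(1)[of x \<eta>] by (simp add: inner_commute)
    qed (rule sets)
    finally show ?thesis .
  qed
  have "ennreal (c1 \<eta>) = ennreal (c2 \<eta>)"
    using em[of "{0}" \<eta>] zero[of "{0}" \<eta> m1] zero[of "{0}" \<eta> m2] zero3[of \<eta>] sets
    by (simp add: A1_A2_A3_def)
  then have c12: "c1 \<eta> = c2 \<eta>" for \<eta>
    using em[of "{0}" \<eta>] zero[of "{0}" \<eta> m1] zero[of "{0}" \<eta> m2] zero3[of \<eta>] sets c[of \<eta>]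
    by (simp add: A1_A2_A3_def)
  then show "R1 \<eta> \<bullet> \<eta> = R2 \<eta> \<bullet> \<eta> + R3 (V \<eta>) \<bullet> V \<eta>"
    using c12[of \<eta>] by (simp add: c1_c2_def)
  show "emeasure m2 A \<le> emeasure m1 A" if "A \<in> sets borel"
  proof (rule measure_le_if_cos_density_le[OF sets(1,2) _ _ that])
    show "emeasure m2 {0} = 0" using m(2) by (simp add: levy_measure_iff)
    fix \<eta> and B :: "'a set" assume B: "B \<in> sets borel"
    have fin_c: "ennreal (c2 \<eta>) * indicator B 0 \<noteq> \<top>" by (simp add: indicator_def)
    have "emeasure (A1 \<eta>) B = emeasure (A2 \<eta>) B + emeasure (A3 \<eta>) B"
    proof -
      have "ennreal (c2 \<eta>) * indicator B 0 + emeasure (A1 \<eta>) B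
          = ennreal (c2 \<eta>) * indicator B 0 + (emeasure (A2 \<eta>) B + emeasure (A3 \<eta>) B)"
        using em[OF B, of \<eta>] unfolding c12 by (simp only: add.commute)
      then show ?thesis using fin_c unfolding ennreal_add_left_cancel infinity_ennreal_def by blast
    qed
    then have "emeasure (A2 \<eta>) B \<le> emeasure (A1 \<eta>) B" by simp
    then show "emeasure (cos_density m2 \<eta>) B \<le> emeasure (cos_density m1 \<eta>) B"
      unfolding A1_A2_A3_def .
  qed
qed

section \<open>A dimension-free bound from Gaussian averages\<close>
lemma norm_one_minus_exp_le:
  fixes z :: complex
  assumes "Re z \<le> 0"
  shows "norm (1 - exp z) \<le> norm z"
proof -
  have "norm (exp 0 - exp z) \<le> 1 * norm (0 - z)"
  proof (rule field_differentiable_bound)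
    show "convex {z. Re z \<le> 0}" by (rule convex_halfspace_Re_le)
    show "(exp has_field_derivative exp w) (at w within {z. Re z \<le> 0})" for w :: complex
      by (rule DERIV_exp[THEN has_field_derivative_at_within])
    show "norm (exp w) \<le> 1" if "w \<in> {z. Re z \<le> 0}" for w using that by simp
  qed (use assms in auto)
  then show ?thesis by simp
qed

definition gauss_coords :: "'a set \<Rightarrow> ('a \<Rightarrow> real) measure" where
  "gauss_coords F = (\<Pi>\<^sub>M e\<in>F. std_normal_distribution)"

definition gauss_vector :: "'a::real_vector set \<Rightarrow> ('a \<Rightarrow> real) \<Rightarrow> 'a" where
  "gauss_vector F g = (\<Sum>e\<in>F. g e *\<^sub>R e)"

locale gaussian_vector =
  fixes F :: "'a::{real_inner, polish_space} set"
  assumes F: "orthonormal F" "finite F"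
begin

sublocale P: product_prob_space "\<lambda>_. std_normal_distribution" F
  using real_dist_normal_dist by (simp add: product_prob_space_def product_prob_space_axioms_def
      product_sigma_finite_def real_distribution_def prob_space_imp_sigma_finite)

lemma prob_space_gauss_coords: "prob_space (gauss_coords F)"
  unfolding gauss_coords_def by (rule P.prob_space_axioms)

lemma measurable_gauss_vector[measurable]: "gauss_vector F \<in> borel_measurable (gauss_coords F)"
  unfolding gauss_vector_def[abs_def] gauss_coords_def
proof (rule borel_measurable_sum)
  fix e assume "e \<in> F"
  then have "(\<lambda>g. g e) \<in> measurable (\<Pi>\<^sub>M e\<in>F. std_normal_distribution) std_normal_distribution"
    by (rule measurable_component_singleton)
  then have "(\<lambda>g. g e) \<in> borel_measurable (\<Pi>\<^sub>M e\<in>F. std_normal_distribution)" by simp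
  then show "(\<lambda>g. g e *\<^sub>R e) \<in> borel_measurable (\<Pi>\<^sub>M e\<in>F. std_normal_distribution)"
    by (intro borel_measurable_scaleR) auto
qed

lemma gauss_vector_char:
  "(CLINT g|gauss_coords F. iexp (x \<bullet> gauss_vector F g)) = of_real (exp (- (\<Sum>e\<in>F. (x \<bullet> e)\<^sup>2) / 2))"
proof -
  have N: "prob_space std_normal_distribution"
    using real_dist_normal_dist by (simp add: real_distribution_def)
  have "iexp (x \<bullet> gauss_vector F g) = (\<Prod>e\<in>F. iexp ((x \<bullet> e) * g e))" for g
  proof -
    have "\<i> * complex_of_real (x \<bullet> gauss_vector F g) = (\<Sum>e\<in>F. \<i> * complex_of_real ((x \<bullet> e) * g e))"
      by (simp add: gauss_vector_def inner_sum_right sum_distrib_left mult_ac)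
    then show ?thesis by (simp only: exp_sum[OF F(2)])
  qed
  then have "(CLINT g|gauss_coords F. iexp (x \<bullet> gauss_vector F g))
      = (\<integral>g. (\<Prod>e\<in>F. iexp ((x \<bullet> e) * g e)) \<partial>gauss_coords F)" by simp
  also have "\<dots> = (\<Prod>e\<in>F. CLINT t|std_normal_distribution. iexp ((x \<bullet> e) * t))"
    unfolding gauss_coords_def
  proof (rule P.product_integral_prod[OF F(2)])
    show "integrable std_normal_distribution (\<lambda>t. iexp ((x \<bullet> e) * t))" for e
      by (rule finite_measure.integrable_const_bound[OF prob_space.finite_measure[OF N], of _ 1]) auto
  qed
  also have "\<dots> = (\<Prod>e\<in>F. complex_of_real (exp (- ((x \<bullet> e)\<^sup>2) / 2)))"
    using char_std_normal_distribution unfolding char_def fun_eq_iff by (intro prod.cong refl) blast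
  also have "\<dots> = of_real (exp (\<Sum>e\<in>F. - ((x \<bullet> e)\<^sup>2) / 2))"
    by (simp add: exp_sum[OF F(2)])
  also have "(\<Sum>e\<in>F. - ((x \<bullet> e)\<^sup>2) / 2) = - (\<Sum>e\<in>F. (x \<bullet> e)\<^sup>2) / 2"
    by (simp add: sum_negf sum_divide_distrib)
  finally show ?thesis .
qed

lemma gauss_covariance:
  assumes "e \<in> F" "f \<in> F"
  shows "integrable (gauss_coords F) (\<lambda>g. g e * g f)"
    and "(LINT g|gauss_coords F. g e * g f) = (if e = f then 1 else 0)"
proof -
  have N: "prob_space std_normal_distribution"
    using real_dist_normal_dist by (simp add: real_distribution_def)
  \<comment> \<open>Both cases \<open>e = f\<close> and \<open>e \<noteq> f\<close> are written as a product over the coordinates.\<close>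
  define \<phi> where "\<phi> i t = (if i = e then t else 1) * (if i = f then t else (1::real))" for i t
  have prod: "g e * g f = (\<Prod>i\<in>F. \<phi> i (g i))" for g
    using assms F(2) by (simp add: \<phi>_def prod.distrib)
  have moments: "integrable std_normal_distribution (\<lambda>t. t)" "integrable std_normal_distribution (\<lambda>t. t * t)"
    "(LINT t|std_normal_distribution. t) = 0" "(LINT t|std_normal_distribution. t * t) = 1"
    using integrable_std_normal_distribution_moment[of 1] integrable_std_normal_distribution_moment[of 2]
      integral_std_normal_distribution_moment_odd[of 1] std_normal_distribution_even_moments(1)[of 1]
    by (simp_all add: power2_eq_square)
  have int: "integrable std_normal_distribution (\<phi> i)" for i
    using moments by (cases "i = e"; cases "i = f") (simp_all add: \<phi>_def[abs_def])
  show "integrable (gauss_coords F) (\<lambda>g. g e * g f)"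
    unfolding prod gauss_coords_def by (rule P.product_integrable_prod[OF F(2) int])
  have "(LINT g|gauss_coords F. g e * g f) = (\<Prod>i\<in>F. LINT t|std_normal_distribution. \<phi> i t)"
    unfolding prod gauss_coords_def by (rule P.product_integral_prod[OF F(2) int])
  also have "\<dots> = (if e = f then 1 else 0)"
  proof (cases "e = f")
    case True
    have "(LINT t|std_normal_distribution. \<phi> i t) = 1" for i
      using moments True prob_space.prob_space[OF N] by (cases "i = e") (simp_all add: \<phi>_def)
    then show ?thesis using True by simp
  next
    case False
    have "(LINT t|std_normal_distribution. \<phi> e t) = 0"
      using moments False by (simp add: \<phi>_def)
    then show ?thesis using False assms F(2) by (auto intro!: prod_zero)
  qed
  finally show "(LINT g|gauss_coords F. g e * g f) = (if e = f then 1 else 0)" .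
qed

text \<open>
  The expectation is the partial trace of \<open>A\<close>, which the full trace bounds whatever
  the number of coordinates.
\<close>
lemma gauss_quadratic_form:
  assumes A: "linear A" and nn: "\<And>x. 0 \<le> A x \<bullet> x"
  shows "(\<integral>\<^sup>+g. ennreal (A (gauss_vector F g) \<bullet> gauss_vector F g) \<partial>gauss_coords F)
    = (\<Sum>e\<in>F. ennreal (A e \<bullet> e))"
proof -
  have expand: "A (gauss_vector F g) \<bullet> gauss_vector F g = (\<Sum>e\<in>F. \<Sum>f\<in>F. (A e \<bullet> f) * (g e * g f))" for g
    unfolding gauss_vector_def
    by (simp add: linear_sum[OF A] linear_cmul[OF A] inner_sum_left inner_sum_right sum_distrib_left mult_ac)
      (subst sum.swap, simp add: mult_ac)
  have int: "integrable (gauss_coords F) (\<lambda>g. A (gauss_vector F g) \<bullet> gauss_vector F g)"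
    unfolding expand by (intro Bochner_Integration.integrable_sum integrable_mult_right gauss_covariance)
  have "(LINT g|gauss_coords F. A (gauss_vector F g) \<bullet> gauss_vector F g)
      = (\<Sum>e\<in>F. \<Sum>f\<in>F. (A e \<bullet> f) * (if e = f then 1 else 0))"
    unfolding expand
    by (simp add: Bochner_Integration.integral_sum Bochner_Integration.integrable_sum integrable_mult_right gauss_covariance)
  also have "\<dots> = (\<Sum>e\<in>F. A e \<bullet> e)"
    using F(2) by (intro sum.cong refl) (simp add: if_distrib cong: if_cong)
  finally have "(LINT g|gauss_coords F. A (gauss_vector F g) \<bullet> gauss_vector F g) = (\<Sum>e\<in>F. A e \<bullet> e)" .
  then show ?thesis
    using nn_integral_eq_integral[OF int] nn by (simp add: sum_ennreal)
qed

lemma gauss_second_moment: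
  "(\<integral>\<^sup>+g. ennreal ((v \<bullet> gauss_vector F g)\<^sup>2) \<partial>gauss_coords F) \<le> ennreal ((norm v)\<^sup>2)"
proof -
  have "linear (\<lambda>x. (v \<bullet> x) *\<^sub>R v)"
    by (rule linearI) (simp_all add: inner_add_right scaleR_add_left)
  from gauss_quadratic_form[OF this]
  have "(\<integral>\<^sup>+g. ennreal ((v \<bullet> gauss_vector F g)\<^sup>2) \<partial>gauss_coords F) = (\<Sum>e\<in>F. ennreal ((v \<bullet> e)\<^sup>2))"
    by (simp add: power2_eq_square)
  also have "\<dots> = ennreal (\<Sum>e\<in>F. (v \<bullet> e)\<^sup>2)" by (rule sum_ennreal) simp
  also have "\<dots> \<le> ennreal ((norm v)\<^sup>2)" by (intro ennreal_leI bessel_ineq F)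
  finally show ?thesis .
qed

lemma gauss_abs_moment:
  "(\<integral>\<^sup>+g. ennreal \<bar>v \<bullet> gauss_vector F g\<bar> \<partial>gauss_coords F) \<le> ennreal (norm v)"
proof (cases "v = 0")
  case False
  interpret G: prob_space "gauss_coords F" by (rule prob_space_gauss_coords)
  define n where "n = norm v"
  have n: "0 < n" using False by (simp add: n_def)
  \<comment> \<open>A linearised square root: with \<open>n = norm v\<close> the right-hand side has expectation at most \<open>n\<close>.\<close>
  have "\<bar>u\<bar> \<le> n / 2 + (1 / (2 * n)) * u\<^sup>2" for u
  proof -
    have "0 \<le> (\<bar>u\<bar> - n)\<^sup>2" by simp
    then have "2 * n * \<bar>u\<bar> \<le> n\<^sup>2 + u\<^sup>2" by (simp add: power2_diff mult_ac)
    then show ?thesis using n by (simp add: field_simps power2_eq_square)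
  qed
  then have "(\<integral>\<^sup>+g. ennreal \<bar>v \<bullet> gauss_vector F g\<bar> \<partial>gauss_coords F)
      \<le> (\<integral>\<^sup>+g. ennreal (n / 2) + ennreal (1 / (2 * n)) * ennreal ((v \<bullet> gauss_vector F g)\<^sup>2) \<partial>gauss_coords F)"
    using n by (intro nn_integral_mono) (simp add: ennreal_mult[symmetric] ennreal_plus[symmetric] del: ennreal_plus)
  also have "\<dots> = ennreal (n / 2) + ennreal (1 / (2 * n)) * (\<integral>\<^sup>+g. ennreal ((v \<bullet> gauss_vector F g)\<^sup>2) \<partial>gauss_coords F)"
    by (simp add: nn_integral_add nn_integral_cmult G.emeasure_space_1)
  also have "\<dots> \<le> ennreal (n / 2) + ennreal (1 / (2 * n)) * ennreal (n\<^sup>2)"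
    using gauss_second_moment[of v] by (intro add_left_mono mult_left_mono) (auto simp: n_def)
  also have "\<dots> = ennreal n"
    using n by (simp add: ennreal_mult[symmetric] ennreal_plus[symmetric] power2_eq_square del: ennreal_plus)
  finally show ?thesis by (simp add: n_def)
qed simp

lemma gauss_levy_kernel:
  "(\<integral>\<^sup>+g. ennreal (norm (levy_kernel (gauss_vector F g) x)) \<partial>gauss_coords F) \<le> 4 * ennreal (levy_weight x)"
proof -
  interpret G: prob_space "gauss_coords F" by (rule prob_space_gauss_coords)
  define w where "w = levy_weight x"
  define v where "v = w / (norm x)\<^sup>2"
  have wv: "0 \<le> w" "0 \<le> v" by (simp_all add: w_def v_def)
  have "(\<integral>\<^sup>+g. ennreal (norm (levy_kernel (gauss_vector F g) x)) \<partial>gauss_coords F)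
      \<le> (\<integral>\<^sup>+g. ennreal (3 * w) + ennreal v * ennreal ((x \<bullet> gauss_vector F g)\<^sup>2) \<partial>gauss_coords F)"
  proof (rule nn_integral_mono)
    fix g
    have "norm (levy_kernel (gauss_vector F g) x) \<le> 3 * w + v * (x \<bullet> gauss_vector F g)\<^sup>2"
      using norm_levy_kernel_le[of "gauss_vector F g" x] by (simp add: w_def v_def inner_commute mult.commute)
    then show "ennreal (norm (levy_kernel (gauss_vector F g) x)) \<le> ennreal (3 * w) + ennreal v * ennreal ((x \<bullet> gauss_vector F g)\<^sup>2)"
      using wv by (simp add: ennreal_mult[symmetric] ennreal_plus[symmetric] del: ennreal_plus)
  qed
  also have "\<dots> = ennreal (3 * w) + ennreal v * (\<integral>\<^sup>+g. ennreal ((x \<bullet> gauss_vector F g)\<^sup>2) \<partial>gauss_coords F)"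
    by (simp add: nn_integral_add nn_integral_cmult G.emeasure_space_1)
  also have "\<dots> \<le> ennreal (3 * w) + ennreal v * ennreal ((norm x)\<^sup>2)"
    using gauss_second_moment[of x] by (intro add_left_mono mult_left_mono) auto
  also have "\<dots> = ennreal (3 * w + v * (norm x)\<^sup>2)"
    using wv by (simp add: ennreal_mult[symmetric] ennreal_plus[symmetric] del: ennreal_plus)
  also have "3 * w + v * (norm x)\<^sup>2 \<le> 4 * w" by (simp add: v_def wv)
  also have "ennreal (4 * w) = 4 * ennreal w" using wv by (simp add: ennreal_mult)
  finally show ?thesis by (simp add: w_def ennreal_leI)
qed

text \<open>
  By Fubini's theorem the left-hand side is the real number \<open>\<integral> (1 - char_fun \<rho> \<xi>) \<gamma>(d\<xi>)\<close>, where \<open>\<gamma>\<close> is the standard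
  Gaussian law on the span of \<open>F\<close>.  The integrand is at most \<open>|levy_exponent b Q D \<xi>|\<close> in absolute value, since
  the exponent of \<open>\<rho>\<close> has non-negative real part, and the Gaussian expectation of each of the three
  parts of the exponent is bounded independently of \<open>F\<close>.
\<close>
lemma gaussian_smoothing_bound:
  assumes \<rho>: "borel_prob \<rho>" and D: "levy_measure D" and Q: "nonneg_op Q" and c: "0 \<le> c" "c \<le> 1"
    and char: "\<And>\<xi>. char_fun \<rho> \<xi> = exp (- (of_real c * levy_exponent b Q D \<xi>))"
  shows "(\<integral>\<^sup>+x. ennreal (1 - exp (- (\<Sum>e\<in>F. (x \<bullet> e)\<^sup>2) / 2)) \<partial>\<rho>)
    \<le> ennreal (norm b) + (\<Sum>e\<in>F. ennreal (Q e \<bullet> e)) + 4 * levy_mass D"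
proof -
  interpret G: prob_space "gauss_coords F" by (rule prob_space_gauss_coords)
  interpret \<rho>: prob_space \<rho> using \<rho> by (simp add: borel_prob_def)
  interpret D: sigma_finite_measure D using D by (simp add: levy_measure_iff)
  have sets[measurable_cong]: "sets \<rho> = sets borel" "sets D = sets borel"
    using \<rho> D by (auto simp: borel_prob_def levy_measure_iff)
  interpret G\<rho>: pair_sigma_finite "gauss_coords F" \<rho> ..
  interpret G\<rho>': pair_prob_space "gauss_coords F" \<rho> ..
  interpret GD: pair_sigma_finite "gauss_coords F" D ..
  define h where "h x = (\<Sum>e\<in>F. (x \<bullet> e)\<^sup>2)" for x
  have h: "0 \<le> h x" for x by (simp add: h_def sum_nonneg)
  have [measurable]: "h \<in> borel_measurable borel" unfolding h_def[abs_def] by measurable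
  have int_e: "integrable \<rho> (\<lambda>x. exp (- h x / 2))"
    by (rule \<rho>.integrable_const_bound[of _ 1]) (auto simp: h)
  have [measurable]: "char_fun \<rho> \<in> borel_measurable borel"
    unfolding char_fun_def[abs_def] by measurable
  have "complex_of_real (LINT x|\<rho>. exp (- h x / 2)) = (CLINT x|\<rho>. (CLINT g|gauss_coords F. iexp (x \<bullet> gauss_vector F g)))"
    unfolding gauss_vector_char h_def[symmetric] by simp
  also have "\<dots> = (CLINT g|gauss_coords F. (CLINT x|\<rho>. iexp (x \<bullet> gauss_vector F g)))"
  proof (rule G\<rho>.Fubini_integral, rule G\<rho>'.P.integrable_const_bound[of _ 1])
    show "(\<lambda>(g, x). iexp (x \<bullet> gauss_vector F g)) \<in> borel_measurable (gauss_coords F \<Otimes>\<^sub>M \<rho>)"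
      by measurable
  qed auto
  finally have e: "complex_of_real (LINT x|\<rho>. exp (- h x / 2)) = (CLINT g|gauss_coords F. char_fun \<rho> (gauss_vector F g))"
    by (simp add: char_fun_def)
  have char_le: "norm (char_fun \<rho> \<xi>) \<le> 1" for \<xi>
    unfolding char_fun_def
    using integral_norm_bound[of \<rho> "\<lambda>x. iexp (x \<bullet> \<xi>)"] \<rho>.prob_space by simp
  have int_char: "integrable (gauss_coords F) (\<lambda>g. char_fun \<rho> (gauss_vector F g))"
    by (rule G.integrable_const_bound[of _ 1]) (use char_le in auto)
  have "complex_of_real (LINT x|\<rho>. 1 - exp (- h x / 2)) = (CLINT g|gauss_coords F. 1 - char_fun \<rho> (gauss_vector F g))"
    using e int_e int_char by (simp add: \<rho>.prob_space G.prob_space)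
  then have "(LINT x|\<rho>. 1 - exp (- h x / 2)) \<le> norm (CLINT g|gauss_coords F. 1 - char_fun \<rho> (gauss_vector F g))"
    by (metis abs_ge_self norm_of_real)
  then have "ennreal (LINT x|\<rho>. 1 - exp (- h x / 2)) \<le> ennreal (norm (CLINT g|gauss_coords F. 1 - char_fun \<rho> (gauss_vector F g)))"
    by (rule ennreal_leI)
  also have "\<dots> \<le> (\<integral>\<^sup>+g. ennreal (norm (1 - char_fun \<rho> (gauss_vector F g))) \<partial>gauss_coords F)"
    by (rule integral_norm_bound_ennreal) (use int_char in auto)
  also have "\<dots> \<le> (\<integral>\<^sup>+g. ennreal \<bar>b \<bullet> gauss_vector F g\<bar> + ennreal (Q (gauss_vector F g) \<bullet> gauss_vector F g)
      + (\<integral>\<^sup>+x. ennreal (norm (levy_kernel (gauss_vector F g) x)) \<partial>D) \<partial>gauss_coords F)"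
  proof (rule nn_integral_mono)
    fix g
    define \<xi> where "\<xi> = gauss_vector F g"
    have Q0: "0 \<le> Q \<xi> \<bullet> \<xi>" using Q by (simp add: nonneg_op_def)
    let ?z = "- (of_real c * levy_exponent b Q D \<xi>)"
    have "exp (Re ?z) \<le> 1" using char_le[of \<xi>] unfolding char by (simp only: norm_exp_eq_Re)
    then have "norm (1 - char_fun \<rho> \<xi>) \<le> norm ?z" unfolding char by (intro norm_one_minus_exp_le) simp
    also have "\<dots> = c * norm (levy_exponent b Q D \<xi>)" using c by (simp add: norm_mult)
    also have "\<dots> \<le> norm (levy_exponent b Q D \<xi>)" using c by (simp add: mult_left_le_one_le)
    also have "\<dots> \<le> \<bar>b \<bullet> \<xi>\<bar> + Q \<xi> \<bullet> \<xi> + norm (CLINT x|D. levy_kernel \<xi> x)"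
    proof -
      have "norm (levy_exponent b Q D \<xi>) \<le> norm (- \<i> * of_real (b \<bullet> \<xi>)) + norm (complex_of_real ((Q \<xi> \<bullet> \<xi>) / 2)) + norm (CLINT x|D. levy_kernel \<xi> x)"
        unfolding levy_exponent_eq by (intro order_trans[OF norm_triangle_ineq4] add_mono norm_triangle_ineq order_refl)
      also have "norm (- \<i> * of_real (b \<bullet> \<xi>)) = \<bar>b \<bullet> \<xi>\<bar>" by (simp add: norm_mult)
      also have "norm (complex_of_real ((Q \<xi> \<bullet> \<xi>) / 2)) \<le> Q \<xi> \<bullet> \<xi>" using Q0 unfolding norm_of_real by simp
      finally show ?thesis by simp
    qed
    finally have "ennreal (norm (1 - char_fun \<rho> \<xi>)) \<le> ennreal (\<bar>b \<bullet> \<xi>\<bar> + Q \<xi> \<bullet> \<xi> + norm (CLINT x|D. levy_kernel \<xi> x))"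
      by (rule ennreal_leI)
    also have "\<dots> = ennreal \<bar>b \<bullet> \<xi>\<bar> + ennreal (Q \<xi> \<bullet> \<xi>) + ennreal (norm (CLINT x|D. levy_kernel \<xi> x))"
      using Q0 by simp
    also have "ennreal (norm (CLINT x|D. levy_kernel \<xi> x)) \<le> (\<integral>\<^sup>+x. ennreal (norm (levy_kernel \<xi> x)) \<partial>D)"
      by (rule integral_norm_bound_ennreal[OF integrable_levy_kernel]) (use D sets in \<open>auto simp: levy_measure_iff\<close>)
    finally show "ennreal (norm (1 - char_fun \<rho> (gauss_vector F g))) \<le> ennreal \<bar>b \<bullet> gauss_vector F g\<bar>
        + ennreal (Q (gauss_vector F g) \<bullet> gauss_vector F g) + (\<integral>\<^sup>+x. ennreal (norm (levy_kernel (gauss_vector F g) x)) \<partial>D)"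
      unfolding \<xi>_def by (simp add: add_left_mono)
  qed
  also have "\<dots> = (\<integral>\<^sup>+g. ennreal \<bar>b \<bullet> gauss_vector F g\<bar> \<partial>gauss_coords F)
      + (\<integral>\<^sup>+g. ennreal (Q (gauss_vector F g) \<bullet> gauss_vector F g) \<partial>gauss_coords F)
      + (\<integral>\<^sup>+g. (\<integral>\<^sup>+x. ennreal (norm (levy_kernel (gauss_vector F g) x)) \<partial>D) \<partial>gauss_coords F)"
  proof -
    have [measurable]: "(\<lambda>x. Q x) \<in> borel_measurable borel"
      by (intro borel_measurable_continuous_onI continuous_intros)
    have [measurable]: "(\<lambda>g. \<integral>\<^sup>+x. ennreal (norm (levy_kernel (gauss_vector F g) x)) \<partial>D) \<in> borel_measurable (gauss_coords F)"
      unfolding levy_kernel_def by measurable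
    show ?thesis by (simp add: nn_integral_add)
  qed
  also have "(\<integral>\<^sup>+g. (\<integral>\<^sup>+x. ennreal (norm (levy_kernel (gauss_vector F g) x)) \<partial>D) \<partial>gauss_coords F)
      = (\<integral>\<^sup>+x. (\<integral>\<^sup>+g. ennreal (norm (levy_kernel (gauss_vector F g) x)) \<partial>gauss_coords F) \<partial>D)"
    by (rule GD.Fubini'[symmetric]) (simp add: levy_kernel_def)
  also have "\<dots> \<le> (\<integral>\<^sup>+x. 4 * ennreal (levy_weight x) \<partial>D)"
    by (intro nn_integral_mono gauss_levy_kernel)
  also have "\<dots> = 4 * levy_mass D" by (simp add: levy_mass_def nn_integral_cmult)
  also have "(\<integral>\<^sup>+g. ennreal \<bar>b \<bullet> gauss_vector F g\<bar> \<partial>gauss_coords F) \<le> ennreal (norm b)"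
    by (rule gauss_abs_moment)
  also have "(\<integral>\<^sup>+g. ennreal (Q (gauss_vector F g) \<bullet> gauss_vector F g) \<partial>gauss_coords F) = (\<Sum>e\<in>F. ennreal (Q e \<bullet> e))"
    by (rule gauss_quadratic_form) (use Q in \<open>auto simp: nonneg_op_def intro: bounded_linear.linear blinfun.bounded_linear_right\<close>)
  finally have "ennreal (LINT x|\<rho>. 1 - exp (- h x / 2)) \<le> ennreal (norm b) + (\<Sum>e\<in>F. ennreal (Q e \<bullet> e)) + 4 * levy_mass D"
    by (simp add: add_mono)
  moreover have "(\<integral>\<^sup>+x. ennreal (1 - exp (- h x / 2)) \<partial>\<rho>) = ennreal (LINT x|\<rho>. 1 - exp (- h x / 2))"
    using int_e h by (intro nn_integral_eq_integral) auto
  ultimately show ?thesis by (simp add: h_def)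
qed

end

lemma levy_weight_le_exp: "levy_weight x \<le> 3 * (1 - exp (- (norm x)\<^sup>2 / 2))"
proof -
  define r where "r = (norm x)\<^sup>2"
  have r: "0 \<le> r" by (simp add: r_def)
  have "exp (- r / 2) = 1 / exp (r / 2)" by (simp add: exp_minus inverse_eq_divide)
  also have "\<dots> \<le> 1 / (1 + r / 2)" using r exp_ge_add_one_self[of "r/2"] by (intro divide_left_mono) auto
  finally have "1 - 1 / (1 + r / 2) \<le> 1 - exp (- r / 2)" by simp
  moreover have "1 - 1 / (1 + r / 2) = r / (2 + r)" using r by (simp add: field_simps)
  moreover have "min 1 r \<le> 3 * (r / (2 + r))"
  proof (cases "r \<le> 1")
    case True
    then have "r * (2 + r) \<le> r * 3" using r by (intro mult_left_mono) auto
    then show ?thesis using True r by (simp add: field_simps)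
  qed (use r in \<open>simp add: field_simps\<close>)
  ultimately have "min 1 r \<le> 3 * (1 - exp (- r / 2))"
    by (metis mult_left_mono order_trans zero_le_numeral)
  then show ?thesis by (simp add: levy_weight_def r_def)
qed

text \<open>
  The finite sets of directions increase to an orthonormal basis, so that the Gaussian bound passes to
  \<open>1 - exp (- |x|\<^sup>2 / 2)\<close>, which dominates a multiple of \<open>levy_weight x\<close>.  The factor \<open>c\<close> allows the
  application to convolution roots.
\<close>
theorem levy_weight_integral_bound:
  fixes \<rho> :: "'a::{real_inner, polish_space} measure"
  assumes \<rho>: "borel_prob \<rho>" and D: "levy_measure D" and Q: "nonneg_op Q" and c: "0 \<le> c" "c \<le> 1"
    and char: "\<And>\<xi>. char_fun \<rho> \<xi> = exp (- (of_real c * levy_exponent b Q D \<xi>))"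
  shows "levy_mass \<rho> \<le> 3 * (ennreal (norm b) + tr Q + 4 * levy_mass D)"
proof -
  have [measurable_cong]: "sets \<rho> = sets borel" using \<rho> by (simp add: borel_prob_def)
  obtain F :: "nat \<Rightarrow> 'a set" where Fn: "\<And>n. finite (F n)" "\<And>n. F n \<subseteq> onb" "\<And>n. orthonormal (F n)"
    "incseq F" "\<And>x. (\<lambda>n. proj_on (F n) x) \<longlonglongrightarrow> x"
    using orthonormal_basis_exhaustion[OF orthonormal_basis_onb] by metis
  define h where "h n x = (\<Sum>e\<in>F n. (x \<bullet> e)\<^sup>2)" for n x
  have h_lim: "(\<lambda>n. h n x) \<longlonglongrightarrow> (norm x)\<^sup>2" for x
    unfolding h_def norm_proj_on[OF Fn(3,1), symmetric] by (intro tendsto_intros Fn(5))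
  have h_mono: "h m x \<le> h n x" if "m \<le> n" for m n x
    unfolding h_def using Fn(4) that by (intro sum_mono2 Fn) (auto simp: incseq_def)
  have "(\<lambda>n. \<integral>\<^sup>+x. ennreal (1 - exp (- h n x / 2)) \<partial>\<rho>) \<longlonglongrightarrow> (\<integral>\<^sup>+x. ennreal (1 - exp (- (norm x)\<^sup>2 / 2)) \<partial>\<rho>)"
  proof (rule nn_integral_LIMSEQ)
    show "incseq (\<lambda>n x. ennreal (1 - exp (- h n x / 2)))"
      by (auto simp: incseq_def le_fun_def h_mono intro!: ennreal_leI)
    show "(\<lambda>x. ennreal (1 - exp (- h n x / 2))) \<in> borel_measurable \<rho>" for n
      unfolding h_def by measurable
    show "(\<lambda>n. ennreal (1 - exp (- h n x / 2))) \<longlonglongrightarrow> ennreal (1 - exp (- (norm x)\<^sup>2 / 2))" for x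
      by (intro tendsto_ennrealI tendsto_intros h_lim) auto
  qed
  moreover have "(\<integral>\<^sup>+x. ennreal (1 - exp (- h n x / 2)) \<partial>\<rho>) \<le> ennreal (norm b) + tr Q + 4 * levy_mass D" for n
  proof -
    interpret gaussian_vector "F n" by unfold_locales (rule Fn)+
    have "(\<integral>\<^sup>+x. ennreal (1 - exp (- h n x / 2)) \<partial>\<rho>) \<le> ennreal (norm b) + (\<Sum>e\<in>F n. ennreal (Q e \<bullet> e)) + 4 * levy_mass D"
      unfolding h_def by (rule gaussian_smoothing_bound[OF assms])
    also have "\<dots> \<le> ennreal (norm b) + tr Q + 4 * levy_mass D"
      by (intro add_mono order_refl sum_le_tr Fn)
    finally show ?thesis .
  qed
  ultimately have "(\<integral>\<^sup>+x. ennreal (1 - exp (- (norm x)\<^sup>2 / 2)) \<partial>\<rho>) \<le> ennreal (norm b) + tr Q + 4 * levy_mass D"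
    by (intro LIMSEQ_le_const2) auto
  then have "3 * (\<integral>\<^sup>+x. ennreal (1 - exp (- (norm x)\<^sup>2 / 2)) \<partial>\<rho>) \<le> 3 * (ennreal (norm b) + tr Q + 4 * levy_mass D)"
    by (intro mult_left_mono) auto
  moreover have "levy_mass \<rho> \<le> 3 * (\<integral>\<^sup>+x. ennreal (1 - exp (- (norm x)\<^sup>2 / 2)) \<partial>\<rho>)"
  proof -
    have "levy_mass \<rho> \<le> (\<integral>\<^sup>+x. 3 * ennreal (1 - exp (- (norm x)\<^sup>2 / 2)) \<partial>\<rho>)"
      unfolding levy_mass_def
    proof (rule nn_integral_mono)
      fix x
      have "ennreal (levy_weight x) \<le> ennreal (3 * (1 - exp (- (norm x)\<^sup>2 / 2)))"
        by (intro ennreal_leI levy_weight_le_exp)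
      then show "ennreal (levy_weight x) \<le> 3 * ennreal (1 - exp (- (norm x)\<^sup>2 / 2))"
        by (simp only: ennreal_mult'[of 3, simplified])
    qed
    also have "\<dots> = 3 * (\<integral>\<^sup>+x. ennreal (1 - exp (- (norm x)\<^sup>2 / 2)) \<partial>\<rho>)"
      by (rule nn_integral_cmult) measurable
    finally show ?thesis .
  qed
  ultimately show ?thesis by (rule order_trans[rotated])
qed

section \<open>Infinite convolutions\<close>
lemma char_fun_hconv:
  fixes M N :: "'a::{real_inner, polish_space} measure"
  assumes M: "borel_prob M" and N: "borel_prob N"
  shows "char_fun (hconv M N) \<xi> = char_fun M \<xi> * char_fun N \<xi>" and "borel_prob (hconv M N)"
proof -
  interpret M: prob_space M using M by (simp add: borel_prob_def)
  interpret N: prob_space N using N by (simp add: borel_prob_def)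
  have [measurable_cong]: "sets M = sets borel" "sets N = sets borel"
    using M N by (auto simp: borel_prob_def)
  interpret MN: pair_sigma_finite M N ..
  interpret P: pair_prob_space M N ..
  have int: "integrable M (\<lambda>x. iexp (x \<bullet> \<xi>))" "integrable N (\<lambda>x. iexp (x \<bullet> \<xi>))"
    by (auto intro!: M.integrable_const_bound[of _ 1] N.integrable_const_bound[of _ 1])
  have "char_fun (hconv M N) \<xi> = (CLINT z|M \<Otimes>\<^sub>M N. iexp ((case z of (x, y) \<Rightarrow> x + y) \<bullet> \<xi>))"
    unfolding char_fun_def hconv_def by (rule integral_distr) measurable
  also have "\<dots> = (CLINT z|M \<Otimes>\<^sub>M N. iexp (fst z \<bullet> \<xi>) * iexp (snd z \<bullet> \<xi>))"
    by (intro Bochner_Integration.integral_cong refl)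
      (auto simp: inner_add_left exp_add[symmetric] distrib_left)
  also have "\<dots> = (CLINT x|M. (CLINT y|N. iexp (x \<bullet> \<xi>) * iexp (y \<bullet> \<xi>)))"
  proof (subst MN.integral_fst'[symmetric])
    show "integrable (M \<Otimes>\<^sub>M N) (\<lambda>z. iexp (fst z \<bullet> \<xi>) * iexp (snd z \<bullet> \<xi>))"
      by (rule P.P.integrable_const_bound[of _ 1]) (auto simp: norm_mult)
  qed simp
  also have "\<dots> = char_fun M \<xi> * char_fun N \<xi>"
    using int by (simp add: char_fun_def)
  finally show "char_fun (hconv M N) \<xi> = char_fun M \<xi> * char_fun N \<xi>" .
  show "borel_prob (hconv M N)"
    unfolding borel_prob_def hconv_def
    by (auto intro!: P.P.prob_space_distr)
qed

lemma char_fun_hconv_power: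
  fixes N :: "'a::{real_inner, polish_space} measure"
  assumes N: "borel_prob N"
  shows "char_fun ((hconv N ^^ n) (return borel 0)) \<xi> = char_fun N \<xi> ^ n \<and>
    borel_prob ((hconv N ^^ n) (return borel 0))"
proof (induction n)
  case 0
  show ?case
    by (simp add: char_fun_def integral_return borel_prob_def prob_space_return)
next
  case (Suc n)
  then show ?case using char_fun_hconv[OF N] by simp
qed

lemma char_fun_distr:
  fixes M :: "'a::{real_inner, polish_space} measure"
  assumes M: "borel_prob M" and U[measurable]: "U \<in> borel_measurable borel" and V: "\<And>x \<xi>. U x \<bullet> \<xi> = x \<bullet> V \<xi>"
  shows "char_fun (distr M borel U) \<xi> = char_fun M (V \<xi>)" and "borel_prob (distr M borel U)"
proof -
  have sets: "sets M = sets borel" and "prob_space M" using M by (auto simp: borel_prob_def)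
  have U': "U \<in> borel_measurable M" using U unfolding measurable_cong_sets[OF sets refl] .
  show "char_fun (distr M borel U) \<xi> = char_fun M (V \<xi>)"
    unfolding char_fun_def by (subst integral_distr[OF U']) (auto simp: V)
  show "borel_prob (distr M borel U)"
    unfolding borel_prob_def using prob_space.prob_space_distr[OF \<open>prob_space M\<close> U'] by simp
qed

lemma borel_prob_eqI:
  fixes M N :: "'a::{real_inner, polish_space} measure"
  assumes "borel_prob M" "borel_prob N" "\<And>\<xi>. char_fun M \<xi> = char_fun N \<xi>"
  shows "M = N"
  using assms
  by (intro finite_borel_pair.char_fun_uniqueness finite_borel_pair.intro prob_space.finite_measure)
    (auto simp: borel_prob_def)

lemma convergent_if_summable_norm:
  fixes x :: "nat \<Rightarrow> 'a::{real_normed_vector, complete_space}"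
  assumes "summable (\<lambda>k. norm (x k))"
  shows "convergent (\<lambda>n. \<Sum>k<n. x k)"
proof -
  have "Cauchy (\<lambda>n. \<Sum>k<n. norm (x k))"
    using assms by (simp add: summable_iff_convergent convergent_Cauchy)
  have "Cauchy (\<lambda>n. \<Sum>k<n. x k)"
  proof (rule metric_CauchyI)
    fix e :: real assume "0 < e"
    then obtain N where N: "\<And>m n. N \<le> m \<Longrightarrow> N \<le> n \<Longrightarrow> dist (\<Sum>k<m. norm (x k)) (\<Sum>k<n. norm (x k)) < e"
      using \<open>Cauchy (\<lambda>n. \<Sum>k<n. norm (x k))\<close> unfolding Cauchy_def by metis
    have *: "dist (\<Sum>k<m. x k) (\<Sum>k<n. x k) \<le> dist (\<Sum>k<m. norm (x k)) (\<Sum>k<n. norm (x k))" if "m \<le> n" for m n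
    proof -
      have split: "(\<Sum>k<n. f k) = (\<Sum>k<m. f k) + (\<Sum>k=m..<n. f k)" for f :: "nat \<Rightarrow> 'b::real_normed_vector"
        using sum.atLeastLessThan_concat[of 0 m n f] that by (simp add: atLeast0LessThan)
      have "norm (\<Sum>k=m..<n. x k) \<le> (\<Sum>k=m..<n. norm (x k))" by (rule norm_sum)
      also have "\<dots> \<le> \<bar>\<Sum>k=m..<n. norm (x k)\<bar>" by simp
      finally show ?thesis by (simp add: dist_norm split[of x] split[of "\<lambda>k. norm (x k)"])
    qed
    show "\<exists>M. \<forall>m\<ge>M. \<forall>n\<ge>M. dist (\<Sum>k<m. x k) (\<Sum>k<n. x k) < e"
    proof (intro exI allI impI)
      fix m n assume "N \<le> m" "N \<le> n"
      then show "dist (\<Sum>k<m. x k) (\<Sum>k<n. x k) < e"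
        using *[of m n] *[of n m] N[of m n] N[of n m]
        by (cases "m \<le> n") (auto simp: dist_commute)
    qed
  qed
  then show ?thesis by (rule Cauchy_convergent)
qed

text \<open>
  The truncation at \<open>1\<close> is harmless: the terms of a convergent series of truncated norms are
  eventually smaller than \<open>1\<close>, and from then on no term is truncated.
\<close>
lemma AE_summable_if_sum_finite:
  fixes Y :: "nat \<Rightarrow> 'b \<Rightarrow> 'a::{real_inner, polish_space}"
  assumes [measurable]: "\<And>k. Y k \<in> borel_measurable M"
    and fin: "(\<Sum>k. \<integral>\<^sup>+\<omega>. ennreal (min 1 (norm (Y k \<omega>))) \<partial>M) < \<infinity>"
  shows "AE \<omega> in M. summable (\<lambda>k. norm (Y k \<omega>))"
proof -
  have "(\<integral>\<^sup>+\<omega>. (\<Sum>k. ennreal (min 1 (norm (Y k \<omega>)))) \<partial>M) < \<infinity>"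
    using fin by (subst nn_integral_suminf) auto
  then have "AE \<omega> in M. (\<Sum>k. ennreal (min 1 (norm (Y k \<omega>)))) \<noteq> \<infinity>"
    by (intro nn_integral_noteq_infinite) auto
  then show ?thesis
  proof eventually_elim
    case (elim \<omega>)
    then have s: "summable (\<lambda>k. min 1 (norm (Y k \<omega>)))"
      by (intro summable_suminf_not_top) auto
    then have "(\<lambda>k. min 1 (norm (Y k \<omega>))) \<longlonglongrightarrow> 0" by (rule summable_LIMSEQ_zero)
    then have "eventually (\<lambda>k. min 1 (norm (Y k \<omega>)) < 1) sequentially"
      by (rule order_tendstoD) simp
    then have "eventually (\<lambda>k. norm (norm (Y k \<omega>)) \<le> min 1 (norm (Y k \<omega>))) sequentially"
      by eventually_elim (auto simp: min_def split: if_splits)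
    then show ?case using s by (rule summable_comparison_test_ev)
  qed
qed

text \<open>
  The coordinates of the product space are independent with laws \<open>\<rho> k\<close>, and their series converges
  absolutely almost surely.  \<open>\<nu>\<close> is the law of its sum.
\<close>
theorem infinite_convolution:
  fixes \<rho> :: "nat \<Rightarrow> 'a::{real_inner, polish_space} measure"
  assumes \<rho>: "\<And>k. borel_prob (\<rho> k)"
    and fin: "(\<Sum>k. \<integral>\<^sup>+x. ennreal (min 1 (norm x)) \<partial>\<rho> k) < \<infinity>"
  shows "\<exists>\<nu>. borel_prob \<nu> \<and> (\<forall>\<xi>. (\<lambda>n. \<Prod>k<n. char_fun (\<rho> k) \<xi>) \<longlonglongrightarrow> char_fun \<nu> \<xi>)"
proof -
  have sets[measurable_cong]: "sets (\<rho> k) = sets borel" and prob: "prob_space (\<rho> k)" for k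
    using \<rho> by (auto simp: borel_prob_def)
  interpret P: product_prob_space \<rho> UNIV
    using prob by (simp add: product_prob_space_def product_prob_space_axioms_def product_sigma_finite_def
        prob_space_imp_sigma_finite)
  let ?P = "\<Pi>\<^sub>M k\<in>UNIV. \<rho> k"
  have Y: "(\<lambda>\<omega>. \<omega> k) \<in> measurable ?P (\<rho> k)" for k by (rule measurable_component_singleton) simp
  then have Y'[measurable]: "(\<lambda>\<omega>. \<omega> k) \<in> borel_measurable ?P" for k
    unfolding measurable_cong_sets[OF refl sets] .
  have comp: "distr ?P (\<rho> k) (\<lambda>\<omega>. \<omega> k) = \<rho> k" for k by (rule P.PiM_component) simp
  have "(\<integral>\<^sup>+\<omega>. ennreal (min 1 (norm (\<omega> k))) \<partial>?P) = (\<integral>\<^sup>+x. ennreal (min 1 (norm x)) \<partial>\<rho> k)" for k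
  proof -
    have "(\<lambda>x::'a. ennreal (min 1 (norm x))) \<in> borel_measurable (\<rho> k)"
      unfolding measurable_cong_sets[OF sets refl] by measurable
    then have "(\<lambda>x::'a. ennreal (min 1 (norm x))) \<in> borel_measurable (distr ?P (\<rho> k) (\<lambda>\<omega>. \<omega> k))"
      by (simp only: comp)
    from nn_integral_distr[OF Y this] show ?thesis unfolding comp by simp
  qed
  then have ae: "AE \<omega> in ?P. summable (\<lambda>k. norm (\<omega> k))"
    by (intro AE_summable_if_sum_finite) (use fin in auto)

  define S where "S n \<omega> = (\<Sum>k<n. \<omega> k)" for n and \<omega> :: "nat \<Rightarrow> 'a"
  \<comment> \<open>Stated with the extended sum, the convergence set is visibly measurable.\<close>
  define G where "G = {\<omega> \<in> space ?P. (\<Sum>k. ennreal (norm (\<omega> k))) < \<top>}"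
  have [measurable]: "G \<in> sets ?P" unfolding G_def by measurable
  have G_iff: "\<omega> \<in> G \<longleftrightarrow> \<omega> \<in> space ?P \<and> summable (\<lambda>k. norm (\<omega> k))" for \<omega>
  proof -
    have "summable (\<lambda>k. norm (\<omega> k)) \<longleftrightarrow> (\<Sum>k. ennreal (norm (\<omega> k))) \<noteq> \<top>"
      using ennreal_suminf_neq_top[of "\<lambda>k. norm (\<omega> k)"] summable_suminf_not_top[of "\<lambda>k. norm (\<omega> k)"]
      by (metis norm_ge_zero)
    then show ?thesis unfolding G_def less_top[symmetric] mem_Collect_eq by simp
  qed
  define T where "T \<omega> = (if \<omega> \<in> G then lim (\<lambda>n. S n \<omega>) else 0)" for \<omega>
  have conv: "(\<lambda>n. if \<omega> \<in> G then S n \<omega> else 0) \<longlonglongrightarrow> T \<omega>" for \<omega>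
    using convergent_if_summable_norm[of \<omega>]
    by (auto simp: T_def S_def G_iff convergent_LIMSEQ_iff)
  have T[measurable]: "T \<in> borel_measurable ?P"
  proof (rule borel_measurable_LIMSEQ_metric)
    show "(\<lambda>\<omega>. if \<omega> \<in> G then S n \<omega> else 0) \<in> borel_measurable ?P" for n
      unfolding S_def by measurable
  qed (rule conv)
  define \<nu> where "\<nu> = distr ?P borel T"
  have "borel_prob \<nu>" unfolding \<nu>_def borel_prob_def by (auto intro!: P.prob_space_distr)
  moreover have "(\<lambda>n. \<Prod>k<n. char_fun (\<rho> k) \<xi>) \<longlonglongrightarrow> char_fun \<nu> \<xi>" for \<xi>
  proof -
    have prod: "(\<Prod>k<n. char_fun (\<rho> k) \<xi>) = (CLINT \<omega>|?P. iexp (S n \<omega> \<bullet> \<xi>))" for n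
    proof -
      have "(CLINT \<omega>|?P. iexp (S n \<omega> \<bullet> \<xi>)) = (CLINT \<omega>|?P. (\<Prod>k<n. iexp (restrict \<omega> {..<n} k \<bullet> \<xi>)))"
        by (intro Bochner_Integration.integral_cong refl)
          (simp add: S_def inner_sum_left sum_distrib_left exp_sum)
      also have "\<dots> = (CLINT f|distr ?P (\<Pi>\<^sub>M k\<in>{..<n}. \<rho> k) (\<lambda>\<omega>. restrict \<omega> {..<n}). (\<Prod>k<n. iexp (f k \<bullet> \<xi>)))"
      proof (rule integral_distr[symmetric])
        show "(\<lambda>\<omega>. restrict \<omega> {..<n}) \<in> measurable ?P (\<Pi>\<^sub>M k\<in>{..<n}. \<rho> k)"
          by (rule measurable_restrict_subset) simp
        show "(\<lambda>f. \<Prod>k<n. iexp (f k \<bullet> \<xi>)) \<in> borel_measurable (\<Pi>\<^sub>M k\<in>{..<n}. \<rho> k)"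
        proof (rule borel_measurable_prod)
          fix k assume "k \<in> {..<n}"
          then have "(\<lambda>f. f k) \<in> measurable (\<Pi>\<^sub>M k\<in>{..<n}. \<rho> k) (\<rho> k)" by (rule measurable_component_singleton)
          then have [measurable]: "(\<lambda>f. f k) \<in> borel_measurable (\<Pi>\<^sub>M k\<in>{..<n}. \<rho> k)"
            unfolding measurable_cong_sets[OF refl sets] .
          show "(\<lambda>f. iexp (f k \<bullet> \<xi>)) \<in> borel_measurable (\<Pi>\<^sub>M k\<in>{..<n}. \<rho> k)" by measurable
        qed
      qed
      also have "distr ?P (\<Pi>\<^sub>M k\<in>{..<n}. \<rho> k) (\<lambda>\<omega>. restrict \<omega> {..<n}) = (\<Pi>\<^sub>M k\<in>{..<n}. \<rho> k)"
        by (rule P.distr_PiM_restrict_finite) auto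
      also have "(CLINT f|(\<Pi>\<^sub>M k\<in>{..<n}. \<rho> k). (\<Prod>k<n. iexp (f k \<bullet> \<xi>))) = (\<Prod>k<n. char_fun (\<rho> k) \<xi>)"
        unfolding char_fun_def
      proof (rule P.product_integral_prod)
        show "integrable (\<rho> k) (\<lambda>x. iexp (x \<bullet> \<xi>))" for k
        proof (rule finite_measure.integrable_const_bound[OF prob_space.finite_measure[OF prob], of _ 1])
          show "(\<lambda>x. iexp (x \<bullet> \<xi>)) \<in> borel_measurable (\<rho> k)"
            unfolding measurable_cong_sets[OF sets refl] by measurable
        qed auto
      qed simp
      finally show ?thesis by simp
    qed
    have "(\<lambda>n. CLINT \<omega>|?P. iexp (S n \<omega> \<bullet> \<xi>)) \<longlonglongrightarrow> (CLINT \<omega>|?P. iexp (T \<omega> \<bullet> \<xi>))"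
    proof (rule integral_dominated_convergence[where w="\<lambda>_. 1"])
      show "AE \<omega> in ?P. (\<lambda>n. iexp (S n \<omega> \<bullet> \<xi>)) \<longlonglongrightarrow> iexp (T \<omega> \<bullet> \<xi>)"
        using ae AE_space
      proof eventually_elim
        case (elim \<omega>)
        then have "\<omega> \<in> G" by (simp add: G_iff)
        then have "(\<lambda>n. S n \<omega>) \<longlonglongrightarrow> T \<omega>" using conv[of \<omega>] by simp
        then show ?case by (intro tendsto_intros)
      qed
    qed (auto simp: S_def)
    moreover have "(CLINT \<omega>|?P. iexp (T \<omega> \<bullet> \<xi>)) = char_fun \<nu> \<xi>"
      unfolding char_fun_def \<nu>_def by (subst integral_distr) auto
    ultimately show ?thesis by (simp add: prod)
  qed
  ultimately show ?thesis by blast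
qed

section \<open>Limits of monotone families of triplets\<close>
lemma antimono_tendsto_SUP_at_bot:
  fixes f :: "real \<Rightarrow> 'b::{conditionally_complete_linorder, linorder_topology}"
  assumes mono: "\<And>r s. s \<le> r \<Longrightarrow> r \<le> t \<Longrightarrow> f r \<le> f s" and bdd: "bdd_above (f ` {..t})"
  shows "(f \<longlongrightarrow> (SUP s\<in>{..t}. f s)) at_bot"
proof (rule order_tendstoI)
  have ev: "eventually (\<lambda>s. s \<le> r) at_bot" for r :: real by (rule eventually_le_at_bot)
  fix y assume "y < (SUP s\<in>{..t}. f s)"
  then obtain r where "r \<le> t" "y < f r" using less_cSUP_iff[OF _ bdd] by auto
  show "eventually (\<lambda>s. y < f s) at_bot"
    using ev[of r] by eventually_elim (use \<open>r \<le> t\<close> \<open>y < f r\<close> in \<open>auto intro: less_le_trans mono\<close>)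
next
  have ev: "eventually (\<lambda>s. s \<le> r) at_bot" for r :: real by (rule eventually_le_at_bot)
  fix y assume y: "(SUP s\<in>{..t}. f s) < y"
  show "eventually (\<lambda>s. f s < y) at_bot"
    using ev[of t] by eventually_elim (rule le_less_trans[OF cSUP_upper[OF _ bdd] y], simp)
qed

lemma tr_add:
  fixes A B C :: "'a::real_inner \<Rightarrow>\<^sub>L 'a"
  assumes "nonneg_op A" "nonneg_op B" "\<And>x. C x \<bullet> x = A x \<bullet> x + B x \<bullet> x"
  shows "tr C = tr A + tr B"
proof -
  have "tr C = (\<Sum>\<^sub>\<infinity>e\<in>onb. ennreal (A e \<bullet> e) + ennreal (B e \<bullet> e))"
    unfolding tr_def using assms by (intro infsum_cong) (simp add: nonneg_op_def)
  also have "\<dots> = tr A + tr B"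
    unfolding tr_def by (intro infsum_add nonneg_summable_on_complete) auto
  finally show ?thesis .
qed

lemma levy_mass_msum:
  fixes M D :: "'a::{real_inner, polish_space} measure"
  assumes [measurable_cong]: "sets M = sets borel" and "sets D = sets borel"
  shows "levy_mass (msum M D) = levy_mass M + levy_mass D"
  unfolding levy_mass_def
proof (rule nn_integral_msum)
  show "(\<lambda>x. ennreal (levy_weight x)) \<in> borel_measurable M" by measurable
qed (simp add: assms)

lemma levy_measure_difference:
  fixes M N :: "'a::{real_inner, polish_space} measure"
  assumes M: "levy_measure M" and N: "levy_measure N"
    and le: "\<And>A. A \<in> sets borel \<Longrightarrow> emeasure M A \<le> emeasure N A"
  shows "\<exists>D. levy_measure D \<and> N = msum M D \<and> levy_mass N = levy_mass M + levy_mass D"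
proof -
  have sets: "sets M = sets borel" "sets N = sets borel" and sf: "sigma_finite_measure N"
    using M N by (auto simp: levy_measure_iff)
  then obtain D where D: "sets D = sets borel" "N = msum M D"
    using measure_difference[of M N] le by auto
  have mass: "levy_mass N = levy_mass M + levy_mass D"
    unfolding D(2) by (rule levy_mass_msum[OF sets(1) D(1)])
  have D_le: "emeasure D A \<le> emeasure N A" if "A \<in> sets borel" for A
    unfolding D(2) using that sets(1) D(1) by (subst emeasure_msum) auto
  have "sigma_finite_measure D"
  proof
    obtain B where "countable B" "B \<subseteq> sets N" "\<Union>B = space N" "\<forall>a\<in>B. emeasure N a \<noteq> \<infinity>"
      using sigma_finite_measure.sigma_finite_countable[OF sf] by blast
    moreover have "space D = space N" using D(1) sets(2) sets_eq_imp_space_eq by metis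
    ultimately show "\<exists>A. countable A \<and> A \<subseteq> sets D \<and> \<Union>A = space D \<and> (\<forall>a\<in>A. emeasure D a \<noteq> \<infinity>)"
      using D_le D(1) sets(2) by (intro exI[of _ B]) (auto simp: top_unique subset_iff, metis top_unique)
  qed
  moreover have "emeasure D {0} = 0" using D_le[of "{0}"] N by (simp add: levy_measure_iff)
  moreover have "levy_mass D < \<infinity>"
    using mass N by (auto simp: levy_measure_iff less_top ennreal_add_eq_top)
  ultimately show ?thesis using D mass by (auto simp: levy_measure_iff)
qed

lemma levy_exponent_msum:
  fixes M D :: "'a::{real_inner, polish_space} measure"
  assumes "levy_measure M" "levy_measure D"
  shows "levy_exponent a R (msum M D) \<xi> = levy_exponent a' R' M \<xi> + levy_exponent (a - a') (R - R') D \<xi>"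
proof -
  have "(CLINT x|msum M D. levy_kernel \<xi> x) = (CLINT x|M. levy_kernel \<xi> x) + (CLINT x|D. levy_kernel \<xi> x)"
    using assms by (intro integral_msum integrable_levy_kernel) (auto simp: levy_measure_iff)
  then show ?thesis
    by (simp add: levy_exponent_eq blinfun.diff_left inner_diff_left diff_divide_distrib algebra_simps)
qed

lemma norm_integral_levy_kernel_le:
  fixes D :: "'a::{real_inner, polish_space} measure"
  assumes "levy_measure D"
  shows "norm (CLINT x|D. levy_kernel \<xi> x) \<le> (3 + (norm \<xi>)\<^sup>2) * enn2real (levy_mass D)"
proof -
  have D: "sets D = sets borel" "levy_mass D < \<infinity>" using assms by (auto simp: levy_measure_iff)
  have "norm (CLINT x|D. levy_kernel \<xi> x) \<le> (LINT x|D. norm (levy_kernel \<xi> x))"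
    by (rule integral_norm_bound)
  also have "\<dots> \<le> (LINT x|D. (3 + (norm \<xi>)\<^sup>2) * levy_weight x)"
    by (intro integral_mono integrable_norm integrable_mult_right integrable_levy_kernel
        integrable_levy_weight D norm_levy_kernel_le_weight)
  also have "(LINT x|D. levy_weight x) = enn2real (levy_mass D)"
    unfolding levy_mass_def using integrable_levy_weight[OF D] by (intro integral_eq_nn_integral) auto
  then have "(LINT x|D. (3 + (norm \<xi>)\<^sup>2) * levy_weight x) = (3 + (norm \<xi>)\<^sup>2) * enn2real (levy_mass D)" by simp
  finally show ?thesis .
qed

text \<open>
  The situation for one fixed \<open>t\<close>, with only the monotonicity that the convolution
  identity provides and the uniform bounds.  The drift is left out because it need not be monotone.
\<close>
locale monotone_triplets =
  fixes t :: real and R :: "real \<Rightarrow> 'a::{real_inner, polish_space} \<Rightarrow>\<^sub>L 'a" and m :: "real \<Rightarrow> 'a measure"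
  assumes R: "\<And>s. s \<le> t \<Longrightarrow> nonneg_symmetric_trace_class (R s)"
    and m: "\<And>s. s \<le> t \<Longrightarrow> levy_measure (m s)"
    and R_mono: "\<And>r s x. s \<le> r \<Longrightarrow> r \<le> t \<Longrightarrow> R r x \<bullet> x \<le> R s x \<bullet> x"
    and m_mono: "\<And>r s A. s \<le> r \<Longrightarrow> r \<le> t \<Longrightarrow> A \<in> sets borel \<Longrightarrow> emeasure (m r) A \<le> emeasure (m s) A"
    and R_bound: "(SUP s\<in>{..t}. tr (R s)) < \<infinity>"
    and m_bound: "(SUP s\<in>{..t}. levy_mass (m s)) < \<infinity>"
begin

lemma R': "s \<le> t \<Longrightarrow> symmetric_op (R s)" "s \<le> t \<Longrightarrow> nonneg_op (R s)"
  using R by (auto simp: nonneg_symmetric_trace_class_def)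

lemma m_sets: "s \<le> t \<Longrightarrow> sets (m s) = sets borel"
  using m by (auto simp: levy_measure_iff)

definition tr_bound where "tr_bound = enn2real (SUP s\<in>{..t}. tr (R s))"

lemma tr_bound: "(SUP s\<in>{..t}. tr (R s)) = ennreal tr_bound" "0 \<le> tr_bound"
  using R_bound by (simp_all add: tr_bound_def)

lemma tr_R_le: "s \<le> t \<Longrightarrow> tr (R s) \<le> ennreal tr_bound"
  unfolding tr_bound(1)[symmetric] by (rule SUP_upper) simp

lemma quadratic_le:
  assumes "s \<le> t" shows "R s x \<bullet> x \<le> tr_bound * (norm x)\<^sup>2"
proof -
  have "enn2real (tr (R s)) \<le> tr_bound"
    using tr_R_le[OF assms] tr_bound(2) by (rule enn2real_leI[rotated])
  then have "enn2real (tr (R s)) * (norm x)\<^sup>2 \<le> tr_bound * (norm x)\<^sup>2" by (rule mult_right_mono) simp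
  with quadratic_form_le_tr[OF R[OF assms]] show ?thesis by (rule order_trans)
qed

lemma bilinear_le:
  assumes "s \<le> t" shows "\<bar>R s x \<bullet> y\<bar> \<le> tr_bound * norm x * norm y"
proof -
  have "(R s x \<bullet> y)\<^sup>2 \<le> (R s x \<bullet> x) * (R s y \<bullet> y)"
    by (rule nonneg_op_Cauchy_Schwarz[OF R'[OF assms]])
  also have "\<dots> \<le> (tr_bound * (norm x)\<^sup>2) * (tr_bound * (norm y)\<^sup>2)"
    using R'(2)[OF assms] tr_bound(2) by (intro mult_mono quadratic_le assms) (auto simp: nonneg_op_def)
  also have "\<dots> = (tr_bound * norm x * norm y)\<^sup>2" by (simp add: power2_eq_square mult_ac)
  finally have "\<bar>R s x \<bullet> y\<bar> \<le> \<bar>tr_bound * norm x * norm y\<bar>" by (simp only: abs_le_square_iff)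
  then show ?thesis using tr_bound(2) by simp
qed

lemma quadratic_convergent: "\<exists>l. ((\<lambda>s. R s x \<bullet> x) \<longlongrightarrow> l) at_bot"
  by (rule exI, rule antimono_tendsto_SUP_at_bot[where t=t])
    (auto intro!: R_mono bdd_aboveI2[where M="tr_bound * (norm x)\<^sup>2"] quadratic_le)

lemma bilinear_convergent: "\<exists>l. ((\<lambda>s. R s x \<bullet> y) \<longlongrightarrow> l) at_bot"
proof -
  obtain l1 l2 where l: "((\<lambda>s. R s (x + y) \<bullet> (x + y)) \<longlongrightarrow> l1) at_bot" "((\<lambda>s. R s (x - y) \<bullet> (x - y)) \<longlongrightarrow> l2) at_bot"
    using quadratic_convergent by metis
  have "((\<lambda>s. (R s (x + y) \<bullet> (x + y) - R s (x - y) \<bullet> (x - y)) / 4) \<longlongrightarrow> (l1 - l2) / 4) at_bot"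
    by (intro tendsto_intros l) auto
  moreover have "eventually (\<lambda>s. (R s (x + y) \<bullet> (x + y) - R s (x - y) \<bullet> (x - y)) / 4 = R s x \<bullet> y) at_bot"
    using eventually_le_at_bot[of t]
  proof eventually_elim
    case (elim s)
    have "R s y \<bullet> x = R s x \<bullet> y" using R'(1)[OF elim] by (simp add: symmetric_op_def inner_commute)
    then show ?case by (simp add: blinfun.add_right blinfun.diff_right inner_add inner_diff)
  qed
  ultimately show ?thesis by (intro exI) (rule Lim_transform_eventually)
qed

text \<open>
  Polarisation reduces the limit to that of monotone quadratic forms.  The limiting bilinear form is
  bounded by the bound on the traces, and the Riesz representation yields the operator.
\<close>
lemma op_limit_exists: "\<exists>Q::'a \<Rightarrow>\<^sub>L 'a. \<forall>x y. ((\<lambda>s. R s x \<bullet> y) \<longlongrightarrow> Q x \<bullet> y) at_bot"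
proof -
  obtain b where b: "\<And>x y. ((\<lambda>s. R s x \<bullet> y) \<longlongrightarrow> b x y) at_bot"
    using bilinear_convergent by metis
  have uniq: "b x y = l" if "((\<lambda>s. R s x \<bullet> y) \<longlongrightarrow> l) at_bot" for x y l
    using tendsto_unique[OF _ b that] by simp
  have add1: "b (x + x') y = b x y + b x' y" for x x' y
    by (rule uniq) (simp only: blinfun.add_right inner_add_left, intro tendsto_add b)
  have scale1: "b (c *\<^sub>R x) y = c * b x y" for c x y
    by (rule uniq) (simp only: blinfun.scaleR_right inner_scaleR_left, intro tendsto_mult_left b)
  have add2: "b x (y + y') = b x y + b x y'" for x y y'
    by (rule uniq) (simp only: inner_add_right, intro tendsto_add b)
  have scale2: "b x (c *\<^sub>R y) = c * b x y" for c x y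
    by (rule uniq) (simp only: inner_scaleR_right, intro tendsto_mult_left b)
  have bound: "\<bar>b x y\<bar> \<le> tr_bound * norm x * norm y" for x y
  proof (rule tendsto_upperbound)
    show "((\<lambda>s. \<bar>R s x \<bullet> y\<bar>) \<longlongrightarrow> \<bar>b x y\<bar>) at_bot" by (intro tendsto_rabs b)
    show "eventually (\<lambda>s. \<bar>R s x \<bullet> y\<bar> \<le> tr_bound * norm x * norm y) at_bot"
      using eventually_le_at_bot[of t] by eventually_elim (rule bilinear_le)
  qed simp
  have "\<exists>z. \<forall>y. b x y = z \<bullet> y" for x
  proof (rule riesz_representation)
    show "bounded_linear (b x)"
      by (rule bounded_linear_intro[where K="tr_bound * norm x"])
        (use add2 scale2 bound[of x] in \<open>auto simp: mult_ac\<close>)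
  qed
  then obtain q where q: "\<And>x y. b x y = q x \<bullet> y" by metis
  have "bounded_linear q"
  proof (rule bounded_linear_intro[where K=tr_bound])
    show "q (x + x') = q x + q x'" for x x'
      by (rule vector_eq_rdot[THEN iffD1]) (simp add: inner_add_left q[symmetric] add1)
    show "q (c *\<^sub>R x) = c *\<^sub>R q x" for c x
      by (rule vector_eq_rdot[THEN iffD1]) (simp add: q[symmetric] scale1)
    show "norm (q x) \<le> norm x * tr_bound" for x
    proof (cases "q x = 0")
      case False
      have "norm (q x) * norm (q x) \<le> (tr_bound * norm x) * norm (q x)"
        using bound[of x "q x"] by (simp add: q power2_norm_eq_inner[symmetric] power2_eq_square)
      then show ?thesis using False by (simp add: mult.commute)
    qed (use tr_bound in simp)
  qed
  then have "blinfun_apply (Blinfun q) = q" by (rule bounded_linear_Blinfun_apply)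
  then show ?thesis using b q by (intro exI[of _ "Blinfun q"]) simp
qed

definition Q where "Q = (THE Q :: 'a \<Rightarrow>\<^sub>L 'a. \<forall>x y. ((\<lambda>s. R s x \<bullet> y) \<longlongrightarrow> Q x \<bullet> y) at_bot)"

lemma Q: "((\<lambda>s. R s x \<bullet> y) \<longlongrightarrow> Q x \<bullet> y) at_bot"
proof -
  have "\<exists>!Q::'a \<Rightarrow>\<^sub>L 'a. \<forall>x y. ((\<lambda>s. R s x \<bullet> y) \<longlongrightarrow> Q x \<bullet> y) at_bot"
  proof (rule ex_ex1I[OF op_limit_exists])
    fix A B :: "'a \<Rightarrow>\<^sub>L 'a"
    assume A: "\<forall>x y. ((\<lambda>s. R s x \<bullet> y) \<longlongrightarrow> A x \<bullet> y) at_bot" and B: "\<forall>x y. ((\<lambda>s. R s x \<bullet> y) \<longlongrightarrow> B x \<bullet> y) at_bot"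
    have "A x \<bullet> y = B x \<bullet> y" for x y
      using A B tendsto_unique[OF trivial_limit_at_bot_linorder] by blast
    then show "A = B" by (intro blinfun_eqI) (metis vector_eq_rdot)
  qed
  from theI'[OF this] show ?thesis unfolding Q_def by blast
qed

lemma R_le_Q: "s \<le> t \<Longrightarrow> R s x \<bullet> x \<le> Q x \<bullet> x"
proof (rule tendsto_lowerbound[OF Q])
  assume "s \<le> t"
  show "eventually (\<lambda>r. R s x \<bullet> x \<le> R r x \<bullet> x) at_bot"
    using eventually_le_at_bot[of s] by eventually_elim (rule R_mono[OF _ \<open>s \<le> t\<close>])
qed simp

lemma nonneg_op_Q: "nonneg_op Q"
  using R_le_Q[OF order_refl] R'(2)[OF order_refl] by (auto simp: nonneg_op_def intro: order_trans)

lemma symmetric_op_Q: "symmetric_op Q"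
  unfolding symmetric_op_def
proof (intro allI)
  fix x y
  have "((\<lambda>s. R s x \<bullet> y) \<longlongrightarrow> x \<bullet> Q y) at_bot"
  proof (rule Lim_transform_eventually)
    show "((\<lambda>s. R s y \<bullet> x) \<longlongrightarrow> x \<bullet> Q y) at_bot" using Q[of y x] by (simp add: inner_commute)
    show "eventually (\<lambda>s. R s y \<bullet> x = R s x \<bullet> y) at_bot"
      using eventually_le_at_bot[of t] by eventually_elim (use R'(1) in \<open>simp add: symmetric_op_def inner_commute\<close>)
  qed
  then show "Q x \<bullet> y = x \<bullet> Q y" using tendsto_unique[OF trivial_limit_at_bot_linorder Q] by blast
qed

lemma tr_mono: "s \<le> r \<Longrightarrow> r \<le> t \<Longrightarrow> tr (R r) \<le> tr (R s)"
  unfolding tr_eq_SUP by (intro SUP_subset_mono order_refl sum_mono ennreal_leI R_mono)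

text \<open>
  The trace is a supremum over finite sets of basis vectors.  On each of them the limit in \<open>s\<close> can be
  taken inside the sum, which bounds the trace of the limit; the other inequality is monotonicity.
\<close>
lemma tr_Q: "tr Q = (SUP s\<in>{..t}. tr (R s))"
proof (rule antisym)
  show "(SUP s\<in>{..t}. tr (R s)) \<le> tr Q"
    unfolding tr_eq_SUP[of Q]
    by (rule SUP_least) (unfold tr_eq_SUP, intro SUP_subset_mono order_refl sum_mono ennreal_leI R_le_Q, simp)
  show "tr Q \<le> (SUP s\<in>{..t}. tr (R s))"
    unfolding tr_eq_SUP[of Q]
  proof (rule SUP_least)
    fix F :: "'a set" assume F: "F \<in> {F. finite F \<and> F \<subseteq> onb}"
    show "(\<Sum>e\<in>F. ennreal (Q e \<bullet> e)) \<le> (SUP s\<in>{..t}. tr (R s))"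
    proof (rule tendsto_upperbound)
      show "((\<lambda>s. \<Sum>e\<in>F. ennreal (R s e \<bullet> e)) \<longlongrightarrow> (\<Sum>e\<in>F. ennreal (Q e \<bullet> e))) at_bot"
        by (intro tendsto_sum tendsto_ennrealI Q)
      show "eventually (\<lambda>s. (\<Sum>e\<in>F. ennreal (R s e \<bullet> e)) \<le> (SUP s\<in>{..t}. tr (R s))) at_bot"
        using eventually_le_at_bot[of t]
      proof eventually_elim
        case (elim s)
        have "(\<Sum>e\<in>F. ennreal (R s e \<bullet> e)) \<le> tr (R s)" using F by (intro sum_le_tr) auto
        also have "\<dots> \<le> (SUP s\<in>{..t}. tr (R s))" using elim by (intro SUP_upper) simp
        finally show ?case .
      qed
    qed simp
  qed
qed

lemma nonneg_symmetric_trace_class_Q: "nonneg_symmetric_trace_class Q"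
  unfolding nonneg_symmetric_trace_class_def tr_Q using symmetric_op_Q nonneg_op_Q R_bound by simp

definition M where "M = (SUP s\<in>{..t}. m s)"

lemma m_le: "s \<le> r \<Longrightarrow> r \<le> t \<Longrightarrow> m r \<le> m s"
  using m_mono m_sets by (subst le_measure) auto

lemma sets_M: "sets M = sets borel"
  unfolding M_def by (rule sets_SUP) (auto simp: m_sets)

lemma emeasure_M:
  assumes "A \<in> sets borel" shows "emeasure M A = (SUP s\<in>{..t}. emeasure (m s) A)"
  unfolding M_def
proof (rule emeasure_SUP_chain[where N=borel])
  show "Complete_Partial_Order.chain (\<le>) (m ` {..t})"
    unfolding chain_def using m_le by (auto, metis linear)
qed (use assms m_sets in auto)

lemma m_le_M: "s \<le> t \<Longrightarrow> A \<in> sets borel \<Longrightarrow> emeasure (m s) A \<le> emeasure M A"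
  unfolding emeasure_M by (rule SUP_upper) simp

lemma emeasure_tendsto_M:
  assumes "A \<in> sets borel" shows "((\<lambda>s. emeasure (m s) A) \<longlongrightarrow> emeasure M A) at_bot"
  unfolding emeasure_M[OF assms] by (rule antimono_tendsto_SUP_at_bot) (auto intro: m_mono assms)

text \<open>
  The integral over the limit measure is approximated from below by finite sums of masses of sets,
  along which the limit in \<open>s\<close> can be taken.
\<close>
lemma levy_mass_M_le: "levy_mass M \<le> (SUP s\<in>{..t}. levy_mass (m s))"
  unfolding levy_mass_def[of M] nn_integral_def
proof (rule SUP_least)
  fix g assume "g \<in> {g. simple_function M g \<and> g \<le> (\<lambda>x. ennreal (levy_weight x))}"
  then have g: "simple_function M g" and g_le: "\<And>x. g x \<le> ennreal (levy_weight x)" by (auto simp: le_fun_def)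
  have g_fin: "g x \<noteq> \<top>" for x using g_le[of x] by (auto simp: top_unique)
  have sp: "space (m s) = space M" if "s \<le> t" for s
    using that m_sets sets_M sets_eq_imp_space_eq by metis
  have meas: "g -` {y} \<inter> space M \<in> sets borel" for y
    using simple_functionD(2)[OF g, of "{y}"] sets_M by simp
  show "integral\<^sup>S M g \<le> (SUP s\<in>{..t}. levy_mass (m s))"
  proof (rule tendsto_upperbound)
    show "((\<lambda>s. \<Sum>y\<in>g ` space M. y * emeasure (m s) (g -` {y} \<inter> space M)) \<longlongrightarrow> integral\<^sup>S M g) at_bot"
      unfolding simple_integral_def
      by (intro tendsto_sum ennreal_tendsto_cmult emeasure_tendsto_M meas) (auto simp: g_fin less_top[symmetric])
    show "eventually (\<lambda>s. (\<Sum>y\<in>g ` space M. y * emeasure (m s) (g -` {y} \<inter> space M)) \<le> (SUP s\<in>{..t}. levy_mass (m s))) at_bot"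
      using eventually_le_at_bot[of t]
    proof eventually_elim
      case (elim s)
      have gs: "simple_function (m s) g"
        using g sp[OF elim] m_sets[OF elim] sets_M by (simp add: simple_function_def)
      have "(\<Sum>y\<in>g ` space M. y * emeasure (m s) (g -` {y} \<inter> space M)) = integral\<^sup>S (m s) g"
        unfolding simple_integral_def sp[OF elim] ..
      also have "\<dots> = integral\<^sup>N (m s) g" by (rule nn_integral_eq_simple_integral[OF gs, symmetric])
      also have "\<dots> \<le> levy_mass (m s)" unfolding levy_mass_def by (intro nn_integral_mono g_le)
      also have "\<dots> \<le> (SUP s\<in>{..t}. levy_mass (m s))" using elim by (intro SUP_upper) simp
      finally show ?case .
    qed
  qed simp
qed

lemma levy_mass_M: "levy_mass M = (SUP s\<in>{..t}. levy_mass (m s))"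
proof (rule antisym[OF levy_mass_M_le], rule SUP_least)
  fix s assume "s \<in> {..t}"
  then have "m s \<le> M" "sets (m s) = sets M"
    using m_le_M sets_M m_sets by (auto simp: le_measure)
  then show "levy_mass (m s) \<le> levy_mass M"
    unfolding levy_mass_def by (intro nn_integral_mono_measure)
qed

lemma levy_measure_M: "levy_measure M"
proof -
  note [measurable_cong] = sets_M
  have mass: "levy_mass M < \<infinity>" using m_bound by (simp add: levy_mass_M)
  have zero: "emeasure M {0} = 0"
    using m by (auto simp: emeasure_M levy_measure_iff)
  have "sigma_finite_measure M"
  proof
    define B where "B n = {x::'a. 1 / real (Suc n) \<le> levy_weight x}" for n
    have Bm[measurable]: "B n \<in> sets borel" for n unfolding B_def by measurable
    have fin: "emeasure M (B n) \<noteq> \<infinity>" for n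
    proof -
      have "ennreal (1 / real (Suc n)) * emeasure M (B n) = (\<integral>\<^sup>+x. ennreal (1 / real (Suc n)) * indicator (B n) x \<partial>M)"
        by (rule nn_integral_cmult_indicator[symmetric]) (simp add: sets_M)
      also have "\<dots> \<le> levy_mass M"
        unfolding levy_mass_def by (intro nn_integral_mono) (auto simp: B_def intro!: ennreal_leI split: split_indicator)
      finally show ?thesis using mass by (auto simp: ennreal_mult_eq_top_iff ennreal_mult_top top_unique)
    qed
    have "(\<Union>n. B n) \<union> {0} = UNIV"
    proof -
      have "x \<in> (\<Union>n. B n)" if "x \<noteq> 0" for x
      proof -
        have "0 < levy_weight x" using that by (simp add: levy_weight_def)
        then obtain n where "inverse (real (Suc n)) < levy_weight x" using reals_Archimedean by blast
        then show ?thesis by (auto simp: B_def inverse_eq_divide intro!: exI[of _ n])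
      qed
      then show ?thesis by auto
    qed
    then show "\<exists>A. countable A \<and> A \<subseteq> sets M \<and> \<Union>A = space M \<and> (\<forall>a\<in>A. emeasure M a \<noteq> \<infinity>)"
      using fin zero sets_eq_imp_space_eq[OF sets_M]
      by (intro exI[of _ "insert {0} (range B)"]) (auto simp: sets_M)
  qed
  then show ?thesis using mass zero sets_M by (simp add: levy_measure_iff)
qed

lemma levy_mass_tendsto: "((\<lambda>s. enn2real (levy_mass (m s))) \<longlongrightarrow> enn2real (levy_mass M)) at_bot"
proof -
  have "levy_mass (m r) \<le> levy_mass (m s)" if "s \<le> r" "r \<le> t" for r s
    unfolding levy_mass_def using that by (intro nn_integral_mono_measure m_le) (auto simp: m_sets)
  then have "((\<lambda>s. levy_mass (m s)) \<longlongrightarrow> levy_mass M) at_bot"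
    unfolding levy_mass_M by (intro antimono_tendsto_SUP_at_bot) auto
  then show ?thesis using levy_measure_M by (intro tendsto_enn2real) (auto simp: levy_measure_iff)
qed

lemma tr_tendsto: "((\<lambda>s. enn2real (tr (R s))) \<longlongrightarrow> enn2real (tr Q)) at_bot"
proof -
  have "((\<lambda>s. tr (R s)) \<longlongrightarrow> tr Q) at_bot"
    unfolding tr_Q by (intro antimono_tendsto_SUP_at_bot tr_mono) auto
  then show ?thesis using R_bound by (intro tendsto_enn2real) (auto simp: tr_Q)
qed

text \<open>
  The difference of the jump integrals is the integral of the kernel over the difference measure
  \<open>M - m s\<close>, whose mass tends to \<open>0\<close>.
\<close>
lemma levy_exponent_tendsto:
  assumes a: "(a \<longlongrightarrow> a_inf) at_bot"
  shows "((\<lambda>s. levy_exponent (a s) (R s) (m s) \<xi>) \<longlongrightarrow> levy_exponent a_inf Q M \<xi>) at_bot"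
proof -
  have "((\<lambda>s. CLINT x|m s. levy_kernel \<xi> x) \<longlongrightarrow> (CLINT x|M. levy_kernel \<xi> x)) at_bot"
  proof (rule LIM_zero_cancel)
    show "((\<lambda>s. (CLINT x|m s. levy_kernel \<xi> x) - (CLINT x|M. levy_kernel \<xi> x)) \<longlongrightarrow> 0) at_bot"
    proof (rule Lim_null_comparison)
      have "((\<lambda>s. (3 + (norm \<xi>)\<^sup>2) * (enn2real (levy_mass M) - enn2real (levy_mass (m s))))
          \<longlongrightarrow> (3 + (norm \<xi>)\<^sup>2) * (enn2real (levy_mass M) - enn2real (levy_mass M))) at_bot"
        by (intro tendsto_intros levy_mass_tendsto)
      then show "((\<lambda>s. (3 + (norm \<xi>)\<^sup>2) * (enn2real (levy_mass M) - enn2real (levy_mass (m s)))) \<longlongrightarrow> 0) at_bot" by simp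
      show "eventually (\<lambda>s. norm ((CLINT x|m s. levy_kernel \<xi> x) - (CLINT x|M. levy_kernel \<xi> x))
          \<le> (3 + (norm \<xi>)\<^sup>2) * (enn2real (levy_mass M) - enn2real (levy_mass (m s)))) at_bot"
        using eventually_le_at_bot[of t]
      proof eventually_elim
        case (elim s)
        obtain D where D: "levy_measure D" "M = msum (m s) D" "levy_mass M = levy_mass (m s) + levy_mass D"
          using levy_measure_difference[OF m[OF elim] levy_measure_M m_le_M[OF elim]] by blast
        have "(CLINT x|M. levy_kernel \<xi> x) = (CLINT x|m s. levy_kernel \<xi> x) + (CLINT x|D. levy_kernel \<xi> x)"
          unfolding D(2) using D(1) m[OF elim] by (intro integral_msum integrable_levy_kernel) (auto simp: levy_measure_iff)
        moreover have "enn2real (levy_mass M) - enn2real (levy_mass (m s)) = enn2real (levy_mass D)"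
          unfolding D(3) using D(1) m[OF elim] by (subst enn2real_plus) (auto simp: levy_measure_iff)
        ultimately show ?case using norm_integral_levy_kernel_le[OF D(1), of \<xi>] by simp
      qed
    qed
  qed
  then show ?thesis unfolding levy_exponent_eq by (intro tendsto_intros a Q) auto
qed

text \<open>
  The increments of the triplet from \<open>r\<close> to \<open>s\<close> again form a triplet.  Mass and trace are stated
  through real differences because these tend to \<open>0\<close>.
\<close>
lemma increment:
  assumes "s \<le> r" "r \<le> t"
  shows "\<exists>D. levy_measure D \<and> nonneg_op (R s - R r) \<and>
    (\<forall>a a' \<xi>. levy_exponent a (R s) (m s) \<xi> - levy_exponent a' (R r) (m r) \<xi> = levy_exponent (a - a') (R s - R r) D \<xi>) \<and>
    levy_mass D = ennreal (enn2real (levy_mass (m s)) - enn2real (levy_mass (m r))) \<and>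
    tr (R s - R r) = ennreal (enn2real (tr (R s)) - enn2real (tr (R r)))"
proof -
  have st: "s \<le> t" using assms by simp
  obtain D where D: "levy_measure D" "m s = msum (m r) D" "levy_mass (m s) = levy_mass (m r) + levy_mass D"
    using levy_measure_difference[OF m[OF assms(2)] m[OF st] m_mono[OF assms]] by blast
  have nn: "nonneg_op (R s - R r)"
    using R_mono[OF assms] by (simp add: nonneg_op_def blinfun.diff_left inner_diff_left)
  have tr: "tr (R s) = tr (R r) + tr (R s - R r)"
    by (rule tr_add[OF R'(2)[OF assms(2)] nn]) (simp add: blinfun.diff_left inner_diff_left)
  have fin: "tr (R s) < \<top>" "tr (R r) < \<top>" using R[OF st] R[OF assms(2)] by (auto simp: nonneg_symmetric_trace_class_def)
  then have fin': "tr (R s - R r) < \<top>" unfolding tr by (simp add: ennreal_add_less_top)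
  have "enn2real (tr (R s)) - enn2real (tr (R r)) = enn2real (tr (R s - R r))"
    using tr fin fin' by (simp add: enn2real_plus)
  moreover have "enn2real (levy_mass (m s)) - enn2real (levy_mass (m r)) = enn2real (levy_mass D)"
    unfolding D(3) using D(1) m[OF assms(2)] by (subst enn2real_plus) (auto simp: levy_measure_iff)
  moreover have "levy_mass D < \<top>" using D(1) by (simp add: levy_measure_iff)
  moreover have "levy_exponent a (R s) (m s) \<xi> - levy_exponent a' (R r) (m r) \<xi> = levy_exponent (a - a') (R s - R r) D \<xi>" for a a' \<xi>
    unfolding D(2) using levy_exponent_msum[OF m[OF assms(2)] D(1)] by (simp add: algebra_simps)
  ultimately show ?thesis using D(1) nn fin' by (intro exI[of _ D]) (simp add: less_top)
qed

end

section \<open>Construction of the limit measure\<close>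
lemma has_triplet_borel_prob: "has_triplet M a R m \<Longrightarrow> borel_prob M"
  by (simp add: has_triplet_def infinitely_divisible_def)

lemma char_fun_zero: "borel_prob M \<Longrightarrow> char_fun M 0 = 1"
  by (simp add: char_fun_def borel_prob_def prob_space.prob_space)

text \<open>
  The quotient of \<open>char_fun N\<close> and the right-hand side is, along each ray, a continuous function with
  values among the \<open>n\<close>-th roots of unity that starts at \<open>1\<close>.
\<close>
lemma char_fun_convolution_root:
  fixes M :: "'a::{real_inner, polish_space} measure"
  assumes M: "has_triplet M a R m" and n: "1 \<le> (n::nat)"
  shows "\<exists>N. borel_prob N \<and> (\<forall>\<xi>. char_fun N \<xi> = exp (- (of_real (1 / n) * levy_exponent a R m \<xi>)))"
proof -
  have m: "sets m = sets borel" "levy_mass m < \<infinity>"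
    and char: "\<And>\<xi>. char_fun M \<xi> = exp (- levy_exponent a R m \<xi>)"
    using M by (auto simp: has_triplet_def levy_measure_iff)
  obtain N where N: "borel_prob N" "M = (hconv N ^^ n) (return borel 0)"
    using M n by (auto simp: has_triplet_def infinitely_divisible_def)
  have power: "char_fun N \<xi> ^ n = char_fun M \<xi>" for \<xi>
    using char_fun_hconv_power[OF N(1), of n \<xi>] N(2) by simp
  have "char_fun N \<xi> = exp (- (of_real (1 / n) * levy_exponent a R m \<xi>))" for \<xi>
  proof -
    define f where "f \<tau> = char_fun N (\<tau> *\<^sub>R \<xi>) * exp (of_real (1 / n) * levy_exponent a R m (\<tau> *\<^sub>R \<xi>))" for \<tau> :: real
    have "f 1 = 1"
    proof (rule continuous_root_of_one[OF _ _ _ n])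
      show "continuous_on UNIV f"
        unfolding f_def using N(1)
        by (intro continuous_intros continuous_char_fun_ray continuous_levy_exponent_ray m) (auto simp: borel_prob_def)
      show "f \<tau> ^ n = 1" for \<tau>
      proof -
        have "f \<tau> ^ n = char_fun M (\<tau> *\<^sub>R \<xi>) * exp (of_nat n * (of_real (1 / n) * levy_exponent a R m (\<tau> *\<^sub>R \<xi>)))"
          unfolding f_def power_mult_distrib power exp_of_nat_mult ..
        also have "of_nat n * (of_real (1 / n) * levy_exponent a R m (\<tau> *\<^sub>R \<xi>)) = levy_exponent a R m (\<tau> *\<^sub>R \<xi>)"
          using n by simp
        finally show ?thesis by (simp add: char exp_minus)
      qed
      show "f 0 = 1" using char_fun_zero[OF N(1)] by (simp add: f_def)
    qed
    then have "char_fun N \<xi> * exp (of_real (1 / n) * levy_exponent a R m \<xi>) = 1" by (simp add: f_def)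
    then show ?thesis unfolding exp_minus by (metis inverse_unique mult.commute)
  qed
  then show ?thesis using N(1) by blast
qed

lemma integral_min_norm_le:
  fixes \<rho> :: "'a::{real_inner, polish_space} measure"
  assumes \<rho>: "borel_prob \<rho>" and mass: "levy_mass \<rho> \<le> ennreal ((1/4) ^ n)"
  shows "(\<integral>\<^sup>+x. ennreal (min 1 (norm x)) \<partial>\<rho>) \<le> ennreal (2 * (1/2) ^ n)"
proof -
  have [measurable_cong]: "sets \<rho> = sets borel" and "prob_space \<rho>" using \<rho> by (auto simp: borel_prob_def)
  interpret prob_space \<rho> by fact
  have pos: "0 < (2::real) ^ n" "1 \<le> (2::real) ^ n" by auto
  \<comment> \<open>Balancing: a mass of order \<open>4 ^ - n\<close> of the truncated square gives \<open>2 ^ - n\<close> for the truncated norm.\<close>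
  have pw: "min 1 (norm x) \<le> (1/2) ^ n + 2 ^ n * levy_weight x" for x :: 'a
  proof (cases "norm x \<le> 1")
    case True
    then have w: "levy_weight x = (norm x)\<^sup>2" by (simp add: levy_weight_def power_le_one)
    have "0 \<le> (1 - z)\<^sup>2 + z" if "0 \<le> z" for z :: real using that by (intro add_nonneg_nonneg) auto
    then have "z \<le> 1 + z\<^sup>2" if "0 \<le> z" for z :: real using that by (simp add: power2_diff)
    from this[of "2 ^ n * norm x"] have "2 ^ n * norm x \<le> 1 + 2 ^ n * (2 ^ n * (norm x)\<^sup>2)"
      by (simp add: power_mult_distrib power2_eq_square mult_ac)
    then have "2 ^ n * norm x \<le> 2 ^ n * ((1/2) ^ n + 2 ^ n * (norm x)\<^sup>2)"
      by (simp add: distrib_left power_one_over)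
    then have "norm x \<le> (1/2) ^ n + 2 ^ n * (norm x)\<^sup>2" using pos by simp
    then show ?thesis using True w by simp
  next
    case False
    then have "levy_weight x = 1" by (simp add: levy_weight_def one_less_power less_imp_le)
    moreover have "0 \<le> (1/2 :: real) ^ n" by simp
    then have "1 \<le> (1/2 :: real) ^ n + 2 ^ n" using pos(2) by linarith
    ultimately show ?thesis using False by simp
  qed
  have "(\<integral>\<^sup>+x. ennreal (min 1 (norm x)) \<partial>\<rho>) \<le> (\<integral>\<^sup>+x. ennreal ((1/2) ^ n) + ennreal (2 ^ n) * ennreal (levy_weight x) \<partial>\<rho>)"
  proof (rule nn_integral_mono)
    fix x :: 'a
    have "ennreal (min 1 (norm x)) \<le> ennreal ((1/2) ^ n + 2 ^ n * levy_weight x)" by (rule ennreal_leI[OF pw])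
    also have "\<dots> = ennreal ((1/2) ^ n) + ennreal (2 ^ n) * ennreal (levy_weight x)"
      by (subst ennreal_plus) (auto simp: ennreal_mult)
    finally show "ennreal (min 1 (norm x)) \<le> ennreal ((1/2) ^ n) + ennreal (2 ^ n) * ennreal (levy_weight x)" .
  qed
  also have "\<dots> = ennreal ((1/2) ^ n) + ennreal (2 ^ n) * levy_mass \<rho>"
    by (simp add: nn_integral_add nn_integral_cmult levy_mass_def emeasure_space_1)
  also have "\<dots> \<le> ennreal ((1/2) ^ n) + ennreal (2 ^ n) * ennreal ((1/4) ^ n)"
    by (intro add_left_mono mult_left_mono mass) auto
  also have "\<dots> = ennreal ((1/2) ^ n + 2 ^ n * (1/4) ^ n)"
    by (subst ennreal_plus) (auto simp: ennreal_mult)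
  also have "(2::real) ^ n * (1/4) ^ n = (1/2) ^ n" by (simp flip: power_mult_distrib)
  finally show ?thesis by simp
qed

context monotone_triplets
begin

text \<open>
  A Cauchy criterion: drift, trace and mass converge, so the increments between two
  sufficiently early times are small, and with them the law of the increment.
\<close>
lemma small_increments:
  assumes a: "(a \<longlongrightarrow> a_inf) at_bot" and \<epsilon>: "0 < \<epsilon>" and c: "0 \<le> c" "c \<le> 1"
  shows "\<exists>\<sigma>. \<forall>s r \<rho>. s \<le> r \<longrightarrow> r \<le> \<sigma> \<longrightarrow> r \<le> t \<longrightarrow> borel_prob \<rho> \<longrightarrow>
    (\<forall>\<xi>. char_fun \<rho> \<xi> = exp (- (of_real c * (levy_exponent (a s) (R s) (m s) \<xi> - levy_exponent (a r) (R r) (m r) \<xi>)))) \<longrightarrow>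
    levy_mass \<rho> \<le> ennreal \<epsilon>"
proof -
  \<comment> \<open>Drift and trace contribute \<open>2 \<delta>\<close> each, the mass \<open>4 * 2 \<delta>\<close>, and the estimate has a factor \<open>3\<close>.\<close>
  define \<delta> where "\<delta> = \<epsilon> / 36"
  have \<delta>: "0 < \<delta>" using \<epsilon> by (simp add: \<delta>_def)
  have "eventually (\<lambda>s. dist (a s) a_inf < \<delta> \<and> dist (enn2real (tr (R s))) (enn2real (tr Q)) < \<delta> \<and>
      dist (enn2real (levy_mass (m s))) (enn2real (levy_mass M)) < \<delta>) at_bot"
    by (intro eventually_conj tendstoD a tr_tendsto levy_mass_tendsto \<delta>)
  then obtain \<sigma> where \<sigma>: "\<And>s. s \<le> \<sigma> \<Longrightarrow> dist (a s) a_inf < \<delta> \<and> dist (enn2real (tr (R s))) (enn2real (tr Q)) < \<delta> \<and>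
      dist (enn2real (levy_mass (m s))) (enn2real (levy_mass M)) < \<delta>"
    unfolding eventually_at_bot_linorder by blast
  show ?thesis
  proof (intro exI allI impI)
    fix s r \<rho> assume sr: "s \<le> r" "r \<le> \<sigma>" "r \<le> t" and \<rho>: "borel_prob \<rho>"
      and char: "\<forall>\<xi>. char_fun \<rho> \<xi> = exp (- (of_real c * (levy_exponent (a s) (R s) (m s) \<xi> - levy_exponent (a r) (R r) (m r) \<xi>)))"
    obtain D where D: "levy_measure D" "nonneg_op (R s - R r)"
      "\<And>a a' \<xi>. levy_exponent a (R s) (m s) \<xi> - levy_exponent a' (R r) (m r) \<xi> = levy_exponent (a - a') (R s - R r) D \<xi>"
      "levy_mass D = ennreal (enn2real (levy_mass (m s)) - enn2real (levy_mass (m r)))"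
      "tr (R s - R r) = ennreal (enn2real (tr (R s)) - enn2real (tr (R r)))"
      using increment[OF sr(1,3)] by blast
    have "levy_mass \<rho> \<le> 3 * (ennreal (norm (a s - a r)) + tr (R s - R r) + 4 * levy_mass D)"
      by (rule levy_weight_integral_bound[OF \<rho> D(1,2) c]) (use char D(3) in simp)
    also have "\<dots> \<le> 3 * (ennreal (2 * \<delta>) + ennreal (2 * \<delta>) + 4 * ennreal (2 * \<delta>))"
    proof (intro mult_left_mono add_mono)
      have "dist (a s) (a r) \<le> 2 * \<delta>"
        using \<sigma>[of s] \<sigma>[of r] sr dist_triangle2[of "a s" "a r" a_inf] by simp
      then show "ennreal (norm (a s - a r)) \<le> ennreal (2 * \<delta>)" by (intro ennreal_leI) (simp add: dist_norm)
      have "dist (enn2real (tr (R s))) (enn2real (tr (R r))) \<le> 2 * \<delta>"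
        using \<sigma>[of s] \<sigma>[of r] sr dist_triangle2[of "enn2real (tr (R s))" "enn2real (tr (R r))" "enn2real (tr Q)"] by simp
      then have "enn2real (tr (R s)) - enn2real (tr (R r)) \<le> 2 * \<delta>" by (simp add: dist_real_def)
      then show "tr (R s - R r) \<le> ennreal (2 * \<delta>)" unfolding D(5) by (rule ennreal_leI)
      have "dist (enn2real (levy_mass (m s))) (enn2real (levy_mass (m r))) \<le> 2 * \<delta>"
        using \<sigma>[of s] \<sigma>[of r] sr
          dist_triangle2[of "enn2real (levy_mass (m s))" "enn2real (levy_mass (m r))" "enn2real (levy_mass M)"] by simp
      then have "enn2real (levy_mass (m s)) - enn2real (levy_mass (m r)) \<le> 2 * \<delta>" by (simp add: dist_real_def)
      then show "levy_mass D \<le> ennreal (2 * \<delta>)" unfolding D(4) by (rule ennreal_leI)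
    qed auto
    also have "\<dots> = ennreal (3 * (2 * \<delta> + 2 * \<delta> + 4 * (2 * \<delta>)))"
      using \<delta> by (simp add: ennreal_mult) (simp flip: distrib_right)
    also have "3 * (2 * \<delta> + 2 * \<delta> + 4 * (2 * \<delta>)) = \<epsilon>" by (simp add: \<delta>_def)
    finally show "levy_mass \<rho> \<le> ennreal \<epsilon>" .
  qed
qed

text \<open>
  The value \<open>c = 1\<close> gives the limit measure, and \<open>c = 1 / n\<close> gives its convolution roots.  The
  hypotheses only ask for measures with the scaled exponents, so that the same proof serves both
  cases.
\<close>
lemma limit_measure_exists:
  assumes a: "(a \<longlongrightarrow> a_inf) at_bot" and c: "0 \<le> c" "c \<le> 1"
    and start: "\<And>s. s \<le> t \<Longrightarrow> \<exists>\<rho>. borel_prob \<rho> \<and>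
      (\<forall>\<xi>. char_fun \<rho> \<xi> = exp (- (of_real c * levy_exponent (a s) (R s) (m s) \<xi>)))"
    and incr: "\<And>s r. s \<le> r \<Longrightarrow> r \<le> t \<Longrightarrow> \<exists>\<rho>. borel_prob \<rho> \<and>
      (\<forall>\<xi>. char_fun \<rho> \<xi> = exp (- (of_real c * (levy_exponent (a s) (R s) (m s) \<xi> - levy_exponent (a r) (R r) (m r) \<xi>))))"
  shows "\<exists>\<nu>. borel_prob \<nu> \<and> (\<forall>\<xi>. char_fun \<nu> \<xi> = exp (- (of_real c * levy_exponent a_inf Q M \<xi>)))"
proof -
  define \<psi> where "\<psi> s \<xi> = levy_exponent (a s) (R s) (m s) \<xi>" for s \<xi>
  have "\<forall>n::nat. \<exists>\<sigma>. \<forall>s r \<rho>. s \<le> r \<longrightarrow> r \<le> \<sigma> \<longrightarrow> r \<le> t \<longrightarrow> borel_prob \<rho> \<longrightarrow>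
    (\<forall>\<xi>. char_fun \<rho> \<xi> = exp (- (of_real c * (\<psi> s \<xi> - \<psi> r \<xi>)))) \<longrightarrow> levy_mass \<rho> \<le> ennreal ((1/4) ^ n)"
    unfolding \<psi>_def by (intro allI small_increments[OF a _ c]) simp
  then obtain \<sigma> where \<sigma>: "\<And>n s r \<rho>. s \<le> r \<Longrightarrow> r \<le> \<sigma> n \<Longrightarrow> r \<le> t \<Longrightarrow> borel_prob \<rho> \<Longrightarrow>
    (\<forall>\<xi>. char_fun \<rho> \<xi> = exp (- (of_real c * (\<psi> s \<xi> - \<psi> r \<xi>)))) \<Longrightarrow> levy_mass \<rho> \<le> ennreal ((1/4) ^ (n::nat))"
    by metis
  \<comment> \<open>Subtracting \<open>real n\<close> forces the times to \<open>-\<infinity>\<close> even if the thresholds \<open>\<sigma> n\<close> stay bounded.\<close>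
  define S where "S n = Min (insert t (\<sigma> ` {..n})) - real n" for n
  have S_le: "S n \<le> Min (insert t (\<sigma> ` {..n}))" for n unfolding S_def using of_nat_0_le_iff[of n] by linarith
  have S\<sigma>: "S n \<le> \<sigma> n" and St: "S n \<le> t" for n
    by (rule order_trans[OF S_le], rule Min_le, auto)+
  have Stn: "S n \<le> t - real n" for n unfolding S_def by (intro diff_right_mono Min_le) auto
  have S_dec: "S (Suc n) \<le> S n" for n
    unfolding S_def by (intro diff_mono Min_antimono) auto
  have S_bot: "filterlim S at_bot sequentially"
    unfolding filterlim_at_bot
  proof
    fix Z
    show "eventually (\<lambda>n. S n \<le> Z) sequentially"
      using eventually_ge_at_top[of "nat \<lceil>t - Z\<rceil>"]
    proof eventually_elim
      case (elim n)
      then have "t - Z \<le> real n" by linarith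
      then show ?case using Stn[of n] by simp
    qed
  qed
  obtain \<rho>0 where \<rho>0: "borel_prob \<rho>0" "\<And>\<xi>. char_fun \<rho>0 \<xi> = exp (- (of_real c * \<psi> (S 0) \<xi>))"
    using start[OF St[of 0]] unfolding \<psi>_def by blast
  have "\<forall>n. \<exists>\<rho>. borel_prob \<rho> \<and> (\<forall>\<xi>. char_fun \<rho> \<xi> = exp (- (of_real c * (\<psi> (S (Suc n)) \<xi> - \<psi> (S n) \<xi>))))"
    unfolding \<psi>_def by (intro allI incr S_dec St)
  then obtain \<rho>1 where \<rho>1: "\<And>n. borel_prob (\<rho>1 n)"
    "\<And>n. \<forall>\<xi>. char_fun (\<rho>1 n) \<xi> = exp (- (of_real c * (\<psi> (S (Suc n)) \<xi> - \<psi> (S n) \<xi>)))"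
    by metis
  \<comment> \<open>The series starts with the measure at time \<open>S 0\<close> and continues with the increments.\<close>
  define \<rho> where "\<rho> = case_nat \<rho>0 \<rho>1"
  have prob: "borel_prob (\<rho> k)" for k using \<rho>0 \<rho>1 by (cases k) (simp_all add: \<rho>_def)
  have prod: "(\<Prod>k<Suc n. char_fun (\<rho> k) \<xi>) = exp (- (of_real c * \<psi> (S n) \<xi>))" for n \<xi>
  proof (induction n)
    case 0
    show ?case using \<rho>0 by (simp add: \<rho>_def)
  next
    case (Suc n)
    have "(\<Prod>k<Suc (Suc n). char_fun (\<rho> k) \<xi>) = exp (- (of_real c * \<psi> (S n) \<xi>)) * char_fun (\<rho>1 n) \<xi>"
      unfolding prod.lessThan_Suc[of _ "Suc n"] Suc by (simp add: \<rho>_def)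
    also have "\<dots> = exp (- (of_real c * \<psi> (S (Suc n)) \<xi>))"
      using \<rho>1(2)[of n] by (simp add: exp_add[symmetric] algebra_simps)
    finally show ?case .
  qed
  have bound: "(\<integral>\<^sup>+x. ennreal (min 1 (norm x)) \<partial>\<rho> k) \<le> ennreal (4 * (1/2) ^ k)" for k
  proof (cases k)
    case 0
    interpret prob_space "\<rho> k" using prob by (simp add: borel_prob_def)
    have "(\<integral>\<^sup>+x. ennreal (min 1 (norm x)) \<partial>\<rho> k) \<le> (\<integral>\<^sup>+x. ennreal 1 \<partial>\<rho> k)"
      by (intro nn_integral_mono ennreal_leI) simp
    also have "\<dots> = 1" by (simp add: emeasure_space_1)
    finally show ?thesis using 0 by (simp add: order_trans)
  next
    case (Suc n)
    have "levy_mass (\<rho>1 n) \<le> ennreal ((1/4) ^ n)"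
      by (rule \<sigma>[OF S_dec S\<sigma> St \<rho>1])
    from integral_min_norm_le[OF \<rho>1(1) this] show ?thesis using Suc by (simp add: \<rho>_def)
  qed
  have "(\<Sum>k. \<integral>\<^sup>+x. ennreal (min 1 (norm x)) \<partial>\<rho> k) \<le> (\<Sum>k. ennreal (4 * (1/2) ^ k))"
    by (intro suminf_le bound) auto
  also have "\<dots> < \<infinity>"
    unfolding infinity_ennreal_def less_top[symmetric]
    by (intro ennreal_suminf_neq_top summable_mult summable_geometric) auto
  finally obtain \<nu> where \<nu>: "borel_prob \<nu>" "\<And>\<xi>. (\<lambda>n. \<Prod>k<n. char_fun (\<rho> k) \<xi>) \<longlonglongrightarrow> char_fun \<nu> \<xi>"
    using infinite_convolution[of \<rho>, OF prob] by blast
  have "char_fun \<nu> \<xi> = exp (- (of_real c * levy_exponent a_inf Q M \<xi>))" for \<xi>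
  proof (rule LIMSEQ_unique)
    show "(\<lambda>n. \<Prod>k<Suc n. char_fun (\<rho> k) \<xi>) \<longlonglongrightarrow> char_fun \<nu> \<xi>" by (rule LIMSEQ_Suc[OF \<nu>(2)])
    have "(\<lambda>n. \<psi> (S n) \<xi>) \<longlonglongrightarrow> levy_exponent a_inf Q M \<xi>"
      using filterlim_compose[OF levy_exponent_tendsto[OF a, of \<xi>] S_bot] by (simp add: \<psi>_def)
    then show "(\<lambda>n. \<Prod>k<Suc n. char_fun (\<rho> k) \<xi>) \<longlonglongrightarrow> exp (- (of_real c * levy_exponent a_inf Q M \<xi>))"
      unfolding prod by (intro tendsto_intros)
  qed
  then show ?thesis using \<nu>(1) by blast
qed

text \<open>
  The set function that defines \<open>levy_limit\<close> coincides on the Borel sets with the measure \<open>M\<close>; in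
  particular it is countably additive and does not default to the zero measure.
\<close>
lemma levy_limit_eq_M: "levy_limit (\<lambda>_. m) u = M"
proof -
  have "levy_limit (\<lambda>_. m) u = measure_of UNIV (sets borel) (emeasure M)"
    unfolding levy_limit_def
  proof (rule measure_of_eq)
    fix A :: "'a set" assume "A \<in> sigma_sets UNIV (sets borel)"
    then have A: "A \<in> sets borel" using sets.sigma_sets_eq[of "borel :: 'a measure"] by simp
    have "emeasure M (A - {0}) = emeasure M A"
      using levy_measure_M A by (intro emeasure_Diff_null_set) (auto simp: levy_measure_iff null_sets_def)
    moreover have "Lim at_bot (\<lambda>s. emeasure (m s) (A - {0})) = emeasure M (A - {0})"
      by (intro tendsto_Lim emeasure_tendsto_M) (use A in auto)
    ultimately show "Lim at_bot (\<lambda>s. emeasure (m s) (A - {0})) = emeasure M A" by simp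
  qed simp
  also have "\<dots> = M"
    using measure_of_of_measure[of M] sets_eq_imp_space_eq[OF sets_M] by (simp add: sets_M)
  finally show ?thesis .
qed

end

section \<open>The evolution system of measures\<close>
lemma levy_exponent_cocycle:
  fixes U :: "'a::{real_inner, polish_space} \<Rightarrow> 'a"
  assumes \<mu>: "has_triplet \<mu>1 a1 R1 m1" "has_triplet \<mu>2 a2 R2 m2" "has_triplet \<mu>3 a3 R3 m3"
    and conv: "\<mu>1 = hconv \<mu>2 (distr \<mu>3 borel U)"
    and U: "U \<in> borel_measurable borel" and V: "\<And>x \<xi>. U x \<bullet> \<xi> = x \<bullet> V \<xi>" "linear V"
  shows "levy_exponent a1 R1 m1 \<xi> = levy_exponent a2 R2 m2 \<xi> + levy_exponent a3 R3 m3 (V \<xi>)"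
proof -
  define f where "f \<tau> = levy_exponent a2 R2 m2 (\<tau> *\<^sub>R \<xi>) + levy_exponent a3 R3 m3 (\<tau> *\<^sub>R V \<xi>)
      - levy_exponent a1 R1 m1 (\<tau> *\<^sub>R \<xi>)" for \<tau> :: real
  have m: "sets m1 = sets borel" "levy_mass m1 < \<infinity>" "sets m2 = sets borel" "levy_mass m2 < \<infinity>"
    "sets m3 = sets borel" "levy_mass m3 < \<infinity>"
    and char: "\<And>\<xi>. char_fun \<mu>1 \<xi> = exp (- levy_exponent a1 R1 m1 \<xi>)" "\<And>\<xi>. char_fun \<mu>2 \<xi> = exp (- levy_exponent a2 R2 m2 \<xi>)"
      "\<And>\<xi>. char_fun \<mu>3 \<xi> = exp (- levy_exponent a3 R3 m3 \<xi>)"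
    using \<mu> by (auto simp: has_triplet_def levy_measure_iff)
  note prob = \<mu>[THEN has_triplet_borel_prob]
  have mult: "char_fun \<mu>1 \<zeta> = char_fun \<mu>2 \<zeta> * char_fun \<mu>3 (V \<zeta>)" for \<zeta>
    unfolding conv char_fun_hconv(1)[OF prob(2) char_fun_distr(2)[OF prob(3) U V(1)]]
      char_fun_distr(1)[OF prob(3) U V(1)] ..
  have "f 1 = 0"
  proof (rule continuous_logarithm_of_one)
    show "continuous_on UNIV f"
      unfolding f_def by (intro continuous_intros continuous_levy_exponent_ray m)
    show "exp (f \<tau>) = 1" for \<tau>
    proof -
      have V\<tau>: "V (\<tau> *\<^sub>R \<xi>) = \<tau> *\<^sub>R V \<xi>" using V(2) by (rule linear_cmul)
      have "exp (f \<tau>) * (exp (- levy_exponent a2 R2 m2 (\<tau> *\<^sub>R \<xi>)) * exp (- levy_exponent a3 R3 m3 (\<tau> *\<^sub>R V \<xi>)))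
          = exp (- levy_exponent a1 R1 m1 (\<tau> *\<^sub>R \<xi>))"
        by (simp add: f_def exp_add[symmetric])
      then have "exp (f \<tau>) * exp (- levy_exponent a1 R1 m1 (\<tau> *\<^sub>R \<xi>)) = exp (- levy_exponent a1 R1 m1 (\<tau> *\<^sub>R \<xi>))"
        using mult[of "\<tau> *\<^sub>R \<xi>"] unfolding char V\<tau> by simp
      then show ?thesis by simp
    qed
    show "f 0 = 0" by (simp add: f_def)
  qed
  then show ?thesis by (simp add: f_def)
qed

lemma integral_hconv_distr:
  fixes M N :: "'a::{real_inner, polish_space} measure" and f :: "'a \<Rightarrow> real"
  assumes M: "borel_prob M" and N: "borel_prob N" and U[measurable]: "U \<in> borel_measurable borel"
    and f[measurable]: "f \<in> borel_measurable borel" and bdd: "bounded (range f)"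
  shows "(LINT z|hconv M (distr N borel U). f z) = (LINT x|N. (LINT y|M. f (U x + y)))"
proof -
  have [measurable_cong]: "sets M = sets borel" and sN: "sets N = sets borel" and "prob_space M" "prob_space N"
    using M N by (auto simp: borel_prob_def)
  have UN: "U \<in> borel_measurable N" using U unfolding measurable_cong_sets[OF sN refl] .
  interpret M: prob_space M by fact
  interpret N: prob_space "distr N borel U" using \<open>prob_space N\<close> UN by (rule prob_space.prob_space_distr)
  interpret MN: pair_sigma_finite M "distr N borel U" ..
  interpret P: pair_prob_space M "distr N borel U" ..
  obtain B where B: "\<And>x. norm (f x) \<le> B" using bdd by (auto simp: bounded_iff)
  have "(LINT z|hconv M (distr N borel U). f z) = (LINT z|(M \<Otimes>\<^sub>M distr N borel U). f (case z of (y, x) \<Rightarrow> y + x))"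
    unfolding hconv_def by (rule integral_distr) measurable
  also have "\<dots> = (LINT z|(M \<Otimes>\<^sub>M distr N borel U). (case z of (y, x) \<Rightarrow> f (y + x)))"
    by (simp add: case_prod_beta)
  also have "\<dots> = (LINT x|distr N borel U. (LINT y|M. f (y + x)))"
  proof (rule MN.integral_snd[symmetric], rule P.P.integrable_const_bound[of _ B])
    show "(\<lambda>(y, x). f (y + x)) \<in> borel_measurable (M \<Otimes>\<^sub>M distr N borel U)" by measurable
  qed (use B in auto)
  also have "\<dots> = (LINT x|N. (LINT y|M. f (y + U x)))"
    by (rule integral_distr[OF UN]) measurable
  finally show ?thesis by (simp add: add.commute)
qed

theorem theorem4p9:
  fixes U :: "real \<Rightarrow> real \<Rightarrow> 'a::{real_inner, polish_space} \<Rightarrow>\<^sub>L 'a"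
    and \<mu> :: "real \<Rightarrow> real \<Rightarrow> 'a measure"
    and a :: "real \<Rightarrow> real \<Rightarrow> 'a"
    and R :: "real \<Rightarrow> real \<Rightarrow> 'a \<Rightarrow>\<^sub>L 'a"
    and m :: "real \<Rightarrow> real \<Rightarrow> 'a measure"
    and a_inf :: "real \<Rightarrow> 'a"
  assumes evol: "evolution_family U"
    and triplet: "\<And>t s. s \<le> t \<Longrightarrow> has_triplet (\<mu> t s) (a t s) (R t s) (m t s)"
    and conv: "\<And>t r s. s \<le> r \<Longrightarrow> r \<le> t \<Longrightarrow>
                 \<mu> t s = hconv (\<mu> t r) (distr (\<mu> r s) borel (U t r))"
    and H1: "\<And>t. (SUP s\<in>{..t}. tr (R t s)) < \<infinity>"
    and H2: "\<And>t. (SUP s\<in>{..t}. \<integral>\<^sup>+x. ennreal (min 1 ((norm x)\<^sup>2)) \<partial>m t s) < \<infinity>"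
    and H3: "\<And>t. ((\<lambda>s. a t s) \<longlongrightarrow> a_inf t) at_bot"
  shows
    "(\<forall>t. (\<forall>A\<in>sets borel. 0 \<notin> A \<longrightarrow>
             ((\<lambda>s. emeasure (m t s) A) \<longlongrightarrow> emeasure (levy_limit m t) A) at_bot) \<and>
          levy_measure (levy_limit m t)) \<and>
     (\<forall>t. (\<forall>x y. ((\<lambda>s. R t s x \<bullet> y) \<longlongrightarrow> op_limit R t x \<bullet> y) at_bot) \<and>
          nonneg_symmetric_trace_class (op_limit R t) \<and>
          tr (op_limit R t) = (SUP s\<in>{..t}. tr (R t s)) \<and>
          (SUP s\<in>{..t}. tr (R t s)) < \<infinity>) \<and>
     (\<exists>\<nu>. \<forall>t. has_triplet (\<nu> t) (a_inf t) (op_limit R t) (levy_limit m t)) \<and>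
     (\<forall>\<nu>. (\<forall>t. has_triplet (\<nu> t) (a_inf t) (op_limit R t) (levy_limit m t)) \<longrightarrow>
          evolution_system_of_measures (transition U \<mu>) \<nu>)"
proof -
  have prob: "borel_prob (\<mu> t s)" if "s \<le> t" for t s
    using has_triplet_borel_prob[OF triplet[OF that]] .
  have R: "nonneg_symmetric_trace_class (R t s)" and nn: "nonneg_op (R t s)" and m: "levy_measure (m t s)"
    and char: "\<And>\<xi>. char_fun (\<mu> t s) \<xi> = exp (- levy_exponent (a t s) (R t s) (m t s) \<xi>)" if "s \<le> t" for t s
    using triplet[OF that] by (auto simp: has_triplet_def nonneg_symmetric_trace_class_def)
  have U[measurable]: "(\<lambda>x. U t s x) \<in> borel_measurable borel" for t s
    by (intro borel_measurable_continuous_onI continuous_intros)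
  have "\<forall>t s. \<exists>V. (\<forall>x \<xi>. U t s x \<bullet> \<xi> = x \<bullet> V \<xi>) \<and> linear V"
    using adjoint_exists by blast
  then obtain V where V: "\<And>t s x \<xi>. U t s x \<bullet> \<xi> = x \<bullet> V t s \<xi>" "\<And>t s. linear (V t s)" by metis
  define \<psi> where "\<psi> t s \<xi> = levy_exponent (a t s) (R t s) (m t s) \<xi>" for t s \<xi>
  have cocycle: "\<psi> t s \<xi> = \<psi> t r \<xi> + \<psi> r s (V t r \<xi>)" if "s \<le> r" "r \<le> t" for t r s \<xi>
    unfolding \<psi>_def using that
    by (intro levy_exponent_cocycle[OF triplet triplet triplet conv U V]) auto
  have mono: "monotone_triplets t (R t) (m t)" for t
  proof
    fix r s x assume sr: "s \<le> r" "r \<le> t"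
    have st: "s \<le> t" using sr by simp
    note additive = levy_exponent_additive_imp_mono[OF m[OF st] m[OF sr(2)] m[OF sr(1)]
        nn[OF st] nn[OF sr(2)] nn[OF sr(1)] U V cocycle[OF sr, unfolded \<psi>_def]]
    show "R t r x \<bullet> x \<le> R t s x \<bullet> x"
      using additive(1)[of x] nn[OF sr(1)] by (simp add: nonneg_op_def)
    show "emeasure (m t r) A \<le> emeasure (m t s) A" if "A \<in> sets borel" for A
      by (rule additive(2)[OF that])
  qed (use R m H1 H2 in \<open>auto simp: levy_mass_def levy_weight_def\<close>)
  have levy: "levy_limit m t = monotone_triplets.M t (m t)" for t
    using monotone_triplets.levy_limit_eq_M[OF mono, of t t] by (simp add: levy_limit_def)
  have op: "op_limit R t = monotone_triplets.Q (R t)" for t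
    unfolding op_limit_def monotone_triplets.Q_def[OF mono] ..
  define \<Psi> where "\<Psi> t \<xi> = levy_exponent (a_inf t) (op_limit R t) (levy_limit m t) \<xi>" for t \<xi>
  have \<psi>_lim: "((\<lambda>s. \<psi> t s \<xi>) \<longlongrightarrow> \<Psi> t \<xi>) at_bot" for t \<xi>
    unfolding \<psi>_def \<Psi>_def levy op by (rule monotone_triplets.levy_exponent_tendsto[OF mono H3])
  have limits_levy: "((\<lambda>s. emeasure (m t s) A) \<longlongrightarrow> emeasure (levy_limit m t) A) at_bot" if "A \<in> sets borel" for t A
    unfolding levy by (rule monotone_triplets.emeasure_tendsto_M[OF mono that])
  have levy_measure_limit: "levy_measure (levy_limit m t)" for t
    unfolding levy by (rule monotone_triplets.levy_measure_M[OF mono])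
  have limits_op: "((\<lambda>s. R t s x \<bullet> y) \<longlongrightarrow> op_limit R t x \<bullet> y) at_bot" for t x y
    unfolding op by (rule monotone_triplets.Q[OF mono])
  have trace_class: "nonneg_symmetric_trace_class (op_limit R t)"
    and tr_limit: "tr (op_limit R t) = (SUP s\<in>{..t}. tr (R t s))" for t
    unfolding op by (rule monotone_triplets.nonneg_symmetric_trace_class_Q[OF mono], rule monotone_triplets.tr_Q[OF mono])

  have root: "\<exists>\<nu>. borel_prob \<nu> \<and> (\<forall>\<xi>. char_fun \<nu> \<xi> = exp (- (of_real (1 / real n) * \<Psi> t \<xi>)))" if n: "1 \<le> n" for n :: nat and t
    unfolding \<Psi>_def levy op
  proof (rule monotone_triplets.limit_measure_exists[OF mono H3])
    show "0 \<le> 1 / real n" "1 / real n \<le> 1" using n by auto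
    show "\<exists>\<rho>. borel_prob \<rho> \<and> (\<forall>\<xi>. char_fun \<rho> \<xi> = exp (- (of_real (1 / real n) * levy_exponent (a t s) (R t s) (m t s) \<xi>)))"
      if "s \<le> t" for s
      by (rule char_fun_convolution_root[OF triplet[OF that] n])
    show "\<exists>\<rho>. borel_prob \<rho> \<and> (\<forall>\<xi>. char_fun \<rho> \<xi> = exp (- (of_real (1 / real n) *
        (levy_exponent (a t s) (R t s) (m t s) \<xi> - levy_exponent (a t r) (R t r) (m t r) \<xi>))))"
      if sr: "s \<le> r" "r \<le> t" for s r
    proof -
      obtain N where N: "borel_prob N" "\<And>\<xi>. char_fun N \<xi> = exp (- (of_real (1 / real n) * \<psi> r s \<xi>))"
        using char_fun_convolution_root[OF triplet[OF sr(1)] n] unfolding \<psi>_def by blast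
      have "\<psi> r s (V t r \<xi>) = \<psi> t s \<xi> - \<psi> t r \<xi>" for \<xi> using cocycle[OF sr] by simp
      then show ?thesis
        using char_fun_distr[OF N(1) U V(1), of t r] N(2) unfolding \<psi>_def
        by (intro exI[of _ "distr N borel (U t r)"]) auto
    qed
  qed
  have exists: "\<exists>\<nu>. has_triplet \<nu> (a_inf t) (op_limit R t) (levy_limit m t)" for t
  proof -
    obtain \<nu> where \<nu>: "borel_prob \<nu>" "\<And>\<xi>. char_fun \<nu> \<xi> = exp (- \<Psi> t \<xi>)"
      using root[of 1 t] by auto
    have "\<exists>N. borel_prob N \<and> \<nu> = (hconv N ^^ n) (return borel 0)" if n: "1 \<le> n" for n :: nat
    proof -
      obtain N where N: "borel_prob N" "\<And>\<xi>. char_fun N \<xi> = exp (- (of_real (1 / real n) * \<Psi> t \<xi>))"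
        using root[OF n] by blast
      have "\<nu> = (hconv N ^^ n) (return borel 0)"
      proof (rule borel_prob_eqI[OF \<nu>(1)])
        show "borel_prob ((hconv N ^^ n) (return borel 0))" using char_fun_hconv_power[OF N(1)] by blast
        fix \<xi>
        have "char_fun ((hconv N ^^ n) (return borel 0)) \<xi> = exp (of_nat n * (- (of_real (1 / real n) * \<Psi> t \<xi>)))"
          using char_fun_hconv_power[OF N(1), of n \<xi>] by (simp only: N(2) exp_of_nat_mult)
        also have "of_nat n * (- (of_real (1 / real n) * \<Psi> t \<xi>)) = - \<Psi> t \<xi>" using n by simp
        finally show "char_fun \<nu> \<xi> = char_fun ((hconv N ^^ n) (return borel 0)) \<xi>" by (simp add: \<nu>(2))
      qed
      then show ?thesis using N(1) by blast
    qed
    then show ?thesis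
      using \<nu> trace_class levy_measure_limit by (auto simp: has_triplet_def infinitely_divisible_def \<Psi>_def)
  qed
  have evolution: "evolution_system_of_measures (transition U \<mu>) \<nu>"
    if \<nu>: "\<forall>t. has_triplet (\<nu> t) (a_inf t) (op_limit R t) (levy_limit m t)" for \<nu>
    unfolding evolution_system_of_measures_def
  proof (intro conjI allI impI ballI)
    show prob_\<nu>: "borel_prob (\<nu> t)" for t using \<nu> has_triplet_borel_prob by blast
    fix s t :: real and f :: "'a \<Rightarrow> real" assume st: "s \<le> t" and f: "f \<in> borel_measurable borel" "bounded (range f)"
    have char_\<nu>: "char_fun (\<nu> t) \<xi> = exp (- \<Psi> t \<xi>)" for t \<xi> using \<nu> by (simp add: has_triplet_def \<Psi>_def)
    have \<Psi>_cocycle: "\<Psi> t \<xi> = \<psi> t s \<xi> + \<Psi> s (V t s \<xi>)" for \<xi>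
    proof (rule tendsto_unique[OF trivial_limit_at_bot_linorder \<psi>_lim])
      have "((\<lambda>r. \<psi> t s \<xi> + \<psi> s r (V t s \<xi>)) \<longlongrightarrow> \<psi> t s \<xi> + \<Psi> s (V t s \<xi>)) at_bot"
        by (intro tendsto_intros \<psi>_lim)
      moreover have "eventually (\<lambda>r. \<psi> t s \<xi> + \<psi> s r (V t s \<xi>) = \<psi> t r \<xi>) at_bot"
        using eventually_le_at_bot[of s] by eventually_elim (rule cocycle[OF _ st, symmetric])
      ultimately show "((\<lambda>r. \<psi> t r \<xi>) \<longlongrightarrow> \<psi> t s \<xi> + \<Psi> s (V t s \<xi>)) at_bot"
        by (rule Lim_transform_eventually)
    qed
    note distr = char_fun_distr[OF prob_\<nu> U V(1)]
    have "\<nu> t = hconv (\<mu> t s) (distr (\<nu> s) borel (U t s))"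
    proof (rule borel_prob_eqI[OF prob_\<nu> char_fun_hconv(2)[OF prob[OF st] distr(2)]])
      fix \<xi>
      have "char_fun (hconv (\<mu> t s) (distr (\<nu> s) borel (U t s))) \<xi> = exp (- \<psi> t s \<xi>) * exp (- \<Psi> s (V t s \<xi>))"
        unfolding char_fun_hconv(1)[OF prob[OF st] distr(2)] distr(1) char_\<nu> char[OF st] \<psi>_def ..
      then show "char_fun (\<nu> t) \<xi> = char_fun (hconv (\<mu> t s) (distr (\<nu> s) borel (U t s))) \<xi>"
        by (simp add: char_\<nu> \<Psi>_cocycle exp_add[symmetric])
    qed
    then show "(LINT x|\<nu> s. transition U \<mu> s t f x) = (LINT x|\<nu> t. f x)"
      unfolding transition_def using integral_hconv_distr[OF prob[OF st] prob_\<nu> U f] by simp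
  qed
  have "\<exists>\<nu>. \<forall>t. has_triplet (\<nu> t) (a_inf t) (op_limit R t) (levy_limit m t)"
    by (rule choice) (use exists in blast)
  then show ?thesis
    by (intro conjI allI ballI impI limits_levy levy_measure_limit limits_op trace_class tr_limit H1 evolution) blast+
qed

end
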